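(* Let the integer $-D<0$ be a fundamental discriminant and assume that $h(-D)=2k+1$ for an integer $k\ge 0$. Then there are $2k+1$ distinct reduced forms of discriminant $-D$, which can be listed as $Q_0(x,y)$, $Q_1(x,y)$, $\bar Q_1(x,y)$, $\ldots$, $Q_k(x,y)$, $\bar Q_k(x,y)$, where $Q_0$ is the principal form and $\bar Q_i(x,y)=a_ix^2-b_ixy+c_iy^2$ is the conjugate form corresponding to $Q_i(x,y)=a_ix^2+b_ixy+c_iy^2$. Let $w=6$ if $D=3$, $w=4$ if $D=4$, and $w=2$ otherwise. For a positive integer $n$ let $a(n,Q)$ be the number of representations of $n$ by $Q$. The following holds for every positive integer $n$. (i) If $k=0$, then $$a(n,Q_0)=w\sum_{d\mid n}\left(\frac{-D}{d}\right).$$ (ii) For $k\ge 1$ and $1\le r\le k$, let $$F_{D,r}(z):=\frac12\left(\sum_{a,b\in\mathbb{Z}}q^{Q_0(a,b)}-\sum_{a,b\in\mathbb{Z}}q^{Q_r(a,b)}\right)=\sum_{n=1}^\infty t_r(n)q^n .$$ Then $F_{D,r}(z)$ is a cusp form of weight $1$, level $D$, and character $\left(\frac{-D}{\cdot}\right)$ with $t_r(1)=1$. Moreover, $$a(n,Q_0)=\frac{2}{2k+1}\sum_{d\mid n}\left(\frac{-D}{d}\right)+\frac{4}{2k+1}\sum_{j=1}^k t_j(n),$$ and, for $1\le r\le k$, $$a(n,Q_r)=a(n,\bar Q_r)=\frac{2}{2k+1}\sum_{d\mid n}\left(\frac{-D}{d}\right)+\frac{4}{2k+1}\sum_{\substack{j=1\\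 j\ne r}}^k t_j(n)-\frac{4k-2}{2k+1}\,t_r(n).$$
   Context: A primitive positive definite integral binary quadratic form $Q(x,y)=ax^2+bxy+cy^2$ has discriminant $b^2-4ac$. It is reduced if $|b|\le a\le c$, and $b\ge 0$ whenever $|b|=a$ or $a=c$. Two forms $Q_1,Q_2$ are properly equivalent if $Q_1(x,y)=Q_2(px+qy,rx+sy)$ for integers $p,q,r,s$ with $ps-qr=1$; every primitive positive definite form is properly equivalent to a unique reduced form. The class number $h(-D)$ is the number of proper equivalence classes of primitive positive definite forms of discriminant $-D$. For a negative discriminant $d$ the principal form is $x^2-\frac d4y^2$ if $d\equiv 0\pmod 4$ and $x^2+xy+\frac{1-d}{4}y^2$ if $d\equiv 1\pmod 4$. The number of representations of $n$ by $Q$ is $a(n,Q)=\#\{(x,y)\in\mathbb{Z}^2: Q(x,y)=n\}$. The symbol $\left(\frac{-D}{\cdot}\right)$ is the Kronecker symbol. Throughout $q=e^{2\pi i z}$ with $z$ in the upper half-plane. A cusp form of weight $1$, level $D$ and character $\left(\frac{-D}{\cdot}\right)$ is an element of $S_1\left(\Gamma_0(D),\left(\frac{-D}{\cdot}\right)\right)$. *)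

theory Defs
  imports
    "HOL-Complex_Analysis.Complex_Analysis"
    "HOL-Number_Theory.Number_Theory"
    "HOL-Computational_Algebra.Squarefree"
begin

section \<open>Binary quadratic forms\<close>

text \<open>\<open>BQF a b c\<close> stands for \<open>a x\<^sup>2 + b x y + c y\<^sup>2\<close>.\<close>
datatype bqf = BQF (coeff_a: int) (coeff_b: int) (coeff_c: int)

definition bqf_eval :: "bqf \<Rightarrow> int \<Rightarrow> int \<Rightarrow> int" where
  "bqf_eval Q x y = coeff_a Q * x^2 + coeff_b Q * x * y + coeff_c Q * y^2"

definition bqf_disc :: "bqf \<Rightarrow> int" where
  "bqf_disc Q = (coeff_b Q)^2 - 4 * coeff_a Q * coeff_c Q"

definition bqf_primitive :: "bqf \<Rightarrow> bool" where
  "bqf_primitive Q \<longleftrightarrow> Gcd {coeff_a Q, coeff_b Q, coeff_c Q} = 1"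

definition bqf_pos_def :: "bqf \<Rightarrow> bool" where
  "bqf_pos_def Q \<longleftrightarrow> (\<forall>x y. (x, y) \<noteq> (0, 0) \<longrightarrow> bqf_eval Q x y > 0)"

definition bqf_reduced :: "bqf \<Rightarrow> bool" where
  "bqf_reduced Q \<longleftrightarrow>
     \<bar>coeff_b Q\<bar> \<le> coeff_a Q \<and> coeff_a Q \<le> coeff_c Q \<and>
     (\<bar>coeff_b Q\<bar> = coeff_a Q \<or> coeff_a Q = coeff_c Q \<longrightarrow> coeff_b Q \<ge> 0)"

definition properly_equivalent :: "bqf \<Rightarrow> bqf \<Rightarrow> bool" where
  "properly_equivalent Q1 Q2 \<longleftrightarrow>
     (\<exists>p q r s. p * s - q * r = 1 \<and>
        (\<forall>x y. bqf_eval Q1 x y = bqf_eval Q2 (p * x + q * y) (r * x + s * y)))"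

definition forms_of_disc :: "int \<Rightarrow> bqf set" where
  "forms_of_disc d = {Q. bqf_primitive Q \<and> bqf_pos_def Q \<and> bqf_disc Q = d}"

definition reduced_forms :: "int \<Rightarrow> bqf set" where
  "reduced_forms d = {Q \<in> forms_of_disc d. bqf_reduced Q}"

text \<open>In this definition \<open>d\<close> is the (negative) discriminant, so \<open>h(-D)\<close> is
  \<open>class_number (- int D)\<close>.\<close>
definition class_number :: "int \<Rightarrow> nat" where
  "class_number d =
     card (forms_of_disc d //
       {(Q1, Q2). Q1 \<in> forms_of_disc d \<and> Q2 \<in> forms_of_disc d \<and> properly_equivalent Q1 Q2})"

definition principal_form :: "int \<Rightarrow> bqf" where
  "principal_form d =
     (if d mod 4 = 0 then BQF 1 0 (- (d div 4)) else BQF 1 1 ((1 - d) div 4))"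

definition bqf_conj :: "bqf \<Rightarrow> bqf" where
  "bqf_conj Q = BQF (coeff_a Q) (- coeff_b Q) (coeff_c Q)"

definition num_reps :: "nat \<Rightarrow> bqf \<Rightarrow> nat" where
  "num_reps n Q = card {(x, y). bqf_eval Q x y = int n}"

text \<open>\<open>Q\<close> lists the reduced forms of discriminant \<open>d\<close>, without repetition, as
  \<open>Q 0\<close> (the principal form), \<open>Q 1\<close>, conjugate of \<open>Q 1\<close>, \dots, \<open>Q k\<close>, conjugate of \<open>Q k\<close>.
  The values \<open>Q i\<close> for \<open>i > k\<close> are irrelevant.\<close>
definition lists_reduced_forms :: "int \<Rightarrow> nat \<Rightarrow> (nat \<Rightarrow> bqf) \<Rightarrow> bool" where
  "lists_reduced_forms d k Q \<longleftrightarrow>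
     Q 0 = principal_form d \<and>
     (let L = Q 0 # concat (map (\<lambda>i. [Q i, bqf_conj (Q i)]) [1..<Suc k])
      in distinct L \<and> set L = reduced_forms d)"

section \<open>Fundamental discriminants and the Kronecker symbol\<close>

definition fundamental_discriminant :: "int \<Rightarrow> bool" where
  "fundamental_discriminant d \<longleftrightarrow>
     (d mod 4 = 1 \<and> squarefree d \<and> d \<noteq> 1) \<or>
     (d mod 4 = 0 \<and> (d div 4) mod 4 \<in> {2, 3} \<and> squarefree (d div 4))"

definition kronecker_prime :: "int \<Rightarrow> int \<Rightarrow> int" where
  "kronecker_prime a p =
     (if p = 2 then (if even a then 0 else if a mod 8 \<in> {1, 7} then 1 else -1)
      else Legendre a p)"

text \<open>For negative \<open>n\<close> the set \<open>prime_factors n\<close> still consists of the positive primes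
  dividing \<open>n\<close>; the leading sign is the symbol at the unit \<open>-1\<close>.\<close>
definition kronecker :: "int \<Rightarrow> int \<Rightarrow> int" where
  "kronecker a n =
     (if n = 0 then (if \<bar>a\<bar> = 1 then 1 else 0)
      else (if n < 0 \<and> a < 0 then -1 else 1) *
           (\<Prod>p\<in>prime_factors n. kronecker_prime a p ^ multiplicity p n))"

section \<open>Cusp forms\<close>

definition upper_half_plane :: "complex set" where
  "upper_half_plane = {z. Im z > 0}"

text \<open>\<open>slash w (a, b, c, d) f\<close> is the function \<open>z \<mapsto> (c z + d)\<^sup>-\<^sup>w f ((a z + b) / (c z + d))\<close>.\<close>
definition slash ::
    "int \<Rightarrow> int \<times> int \<times> int \<times> int \<Rightarrow> (complex \<Rightarrow> complex) \<Rightarrow> complex \<Rightarrow> complex" where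
  "slash w = (\<lambda>(a, b, c, d) f z.
     (of_int c * z + of_int d) powi (- w) *
     f ((of_int a * z + of_int b) / (of_int c * z + of_int d)))"

definition SL2Z :: "(int \<times> int \<times> int \<times> int) set" where
  "SL2Z = {(a, b, c, d). a * d - b * c = 1}"

definition Gamma0 :: "nat \<Rightarrow> (int \<times> int \<times> int \<times> int) set" where
  "Gamma0 N = {(a, b, c, d). (a, b, c, d) \<in> SL2Z \<and> int N dvd c}"

text \<open>The space \<open>S\<^sub>w(\<Gamma>\<^sub>0(N), \<psi>)\<close>. As \<open>SL\<^sub>2(\<int>)\<close> acts transitively on the cusps, the last
  clause says that \<open>f\<close> vanishes at every cusp: each \<open>f|\<^sub>w\<gamma>\<close> tends to \<open>0\<close> as \<open>Im z\<close> tends to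
  infinity, uniformly in \<open>Re z\<close>. Only the values of \<open>f\<close> on the upper half-plane matter.\<close>
definition is_cusp_form :: "int \<Rightarrow> nat \<Rightarrow> (int \<Rightarrow> complex) \<Rightarrow> (complex \<Rightarrow> complex) \<Rightarrow> bool" where
  "is_cusp_form w N \<psi> f \<longleftrightarrow>
     f holomorphic_on upper_half_plane \<and>
     (\<forall>(a, b, c, d) \<in> Gamma0 N. \<forall>z \<in> upper_half_plane.
        slash w (a, b, c, d) f z = \<psi> d * f z) \<and>
     (\<forall>\<gamma> \<in> SL2Z. (slash w \<gamma> f \<longlongrightarrow> 0) (filtercomap Im at_top))"

section \<open>Theta series\<close>

definition nome :: "complex \<Rightarrow> complex" where
  "nome z = exp (2 * of_real pi * \<i> * z)"

definition theta :: "bqf \<Rightarrow> complex \<Rightarrow> complex" where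
  "theta Q z = (\<Sum>\<^sub>\<infinity>(a, b)\<in>UNIV. nome z powi bqf_eval Q a b)"

definition theta_diff :: "bqf \<Rightarrow> bqf \<Rightarrow> complex \<Rightarrow> complex" where
  "theta_diff Q Q' z = (theta Q z - theta Q' z) / 2"

end

theory Submission
  imports Defs "HOL-Probability.Characteristic_Functions" "HOL-Real_Asymp.Real_Asymp"
begin

text \<open>A reduced form together with a primitive representation of \<open>n\<close> amounts to a root modulo \<open>n\<close> of
  \<open>t\<^sup>2 + \<epsilon> t + (\<epsilon> + D) / 4\<close>, with \<open>\<epsilon> \<in> {0, 1}\<close> congruent to \<open>D\<close> modulo \<open>2\<close>, up to the \<open>w\<close>
  automorphs of a form; counting the roots by Hensel's lemma gives Dirichlet's formula for the total
  number of representations by all reduced forms. An odd class number forces \<open>D\<close> to be \<open>4\<close>, \<open>8\<close> or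
  a prime and the principal form to be the only ambiguous one, so the representation formulas follow
  by linear algebra from \<open>t\<^sub>r(n) = (a(n, Q\<^sub>0) - a(n, Q\<^sub>r)) / 2\<close>. Poisson summation for Gaussians on
  cosets of \<open>d \<int>\<^sup>2\<close> (Hecke, Schoeneberg) yields the automorphy factor of a theta series under
  \<open>\<Gamma>\<^sub>0(D)\<close> as a Gauss sum modulo the lower right entry \<open>d\<close>. This sum depends on the form only
  through its discriminant. For prime \<open>D\<close> there are two cusps, interchanged by the inversion formula,
  and the constant terms of the theta series cancel at both.\<close>

section \<open>Poisson summation\<close>

text \<open>Splitting \<open>\<gamma> z = b / d + \<tau>\<close> with
  \<open>\<tau> = z / (d (c z + d))\<close> turns a theta series at \<open>\<gamma> z\<close> into a
  combination of coset theta series at \<open>\<tau>\<close>. Hence only the inversion of cosets is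
  needed, and the resulting Gauss sum has a modulus prime to \<open>b D\<close>: no ramified prime
  enters its evaluation. The sum of all theta series is never recognized as an Eisenstein series.
  Its coefficients come from counting, and modularity is proved only for differences, where the
  equal multipliers and constant terms do the work. The cusp condition stays manageable because
  \<open>k \<ge> 1\<close> forces \<open>D \<ge> 12\<close>, which leaves only prime
  \<open>D\<close>; 4 and 8 have class number one. Conjugate forms have equal representation
  numbers, so the total and the \<open>k\<close> differences determine all \<open>k + 1\<close>
  unknown numbers. At \<open>n = 1\<close> the total is 2 and is already exhausted by the
  representations \<open>(1, 0)\<close> and \<open>(-1, 0)\<close> by the principal form; this is
  the reason for \<open>t_r(1) = 1\<close>.\<close>

lemma nome_0 [simp]: "nome 0 = 1"
  by (simp add: nome_def)

lemma nome_add: "nome (x + y) = nome x * nome y"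
  by (simp add: nome_def algebra_simps exp_add)

lemma nome_nonzero [simp]: "nome z \<noteq> 0"
  by (simp add: nome_def)

lemma nome_of_int [simp]: "nome (of_int n) = 1"
proof -
  have "nome (of_int n) = exp (2 * of_int n * of_real pi * \<i>)"
    by (simp add: nome_def algebra_simps)
  then show ?thesis using exp_integer_2pi[of "of_int n"] by simp
qed

lemma nome_eq_1_iff: "nome z = 1 \<longleftrightarrow> z \<in> \<int>"
proof
  assume "nome z = 1"
  then obtain n :: int where "2 * of_real pi * \<i> * z = \<i> * (of_int (2 * n) * of_real pi)"
    unfolding nome_def exp_eq_1 by (auto simp: complex_eq_iff)
  then have "z = of_int n" by (auto simp: field_simps)
  then show "z \<in> \<int>" by simp
qed (auto elim: Ints_cases)

lemma norm_nome: "norm (nome z) = exp (- 2 * pi * Im z)"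
  by (simp add: nome_def)

lemma norm_nome_of_real [simp]: "norm (nome (of_real x)) = 1"
  by (simp add: norm_nome)

lemma nome_of_int_mult: "nome (of_int k * z) = nome z powi k"
proof -
  have "nome (of_int k * z) = exp (of_int k * (2 * of_real pi * \<i> * z))"
    by (simp add: nome_def algebra_simps)
  then show ?thesis by (simp add: exp_power_int nome_def)
qed

lemma has_field_derivative_nome [derivative_intros]:
  "(nome has_field_derivative (2 * of_real pi * \<i> * nome z)) (at z within S)"
  unfolding nome_def by (auto intro!: derivative_eq_intros)

lemma holomorphic_nome [holomorphic_intros]:
  "f holomorphic_on S \<Longrightarrow> (\<lambda>z. nome (f z)) holomorphic_on S"
  unfolding nome_def by (intro holomorphic_intros)

lemma continuous_on_nome [continuous_intros]:
  "continuous_on S f \<Longrightarrow> continuous_on S (\<lambda>z. nome (f z))"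
  unfolding nome_def by (intro continuous_intros)

lemma integral_nome_character:
  "integral {-1/2..1/2} (\<lambda>x. nome (- of_int k * of_real x)) = (if k = 0 then 1 else 0)"
proof (cases "k = 0")
  case False
  let ?E = "\<lambda>z. nome (- of_int k * z) / (- 2 * of_real pi * \<i> * of_int k)"
  have "((\<lambda>x. nome (- of_int k * of_real x)) has_integral
      ?E (of_real (1/2)) - ?E (of_real (-1/2))) {-1/2..1/2}"
  proof (rule fundamental_theorem_of_calculus)
    fix x :: real
    have "(?E has_field_derivative nome (- of_int k * of_real x)) (at (of_real x))"
      using False
      by (auto intro!: derivative_eq_intros DERIV_chain2[of nome, OF has_field_derivative_nome])
    then show "((\<lambda>x. ?E (of_real x)) has_vector_derivative nome (- of_int k * of_real x))
        (at x within {-1/2..1/2})"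
      by (rule has_vector_derivative_real_field)
  qed simp
  moreover have "nome (- of_int k * of_real (1/2)) = nome (- of_int k * of_real (-1/2))"
    using nome_add[of "- of_int k * of_real (-1/2)" "of_int (-k)"] nome_of_int[of "-k"] by simp
  ultimately have "((\<lambda>x. nome (- of_int k * of_real x)) has_integral 0) {-1/2..1/2}"
    by (metis diff_self)
  from integral_unique[OF this] show ?thesis by (simp only: False if_False)
qed simp

section \<open>Pointwise Fourier inversion at the origin\<close>

lemma continuous_on_Icc_norm_bound:
  fixes f :: "real \<Rightarrow> 'a::real_normed_vector"
  assumes "continuous_on {a..b} f"
  obtains B where "\<And>x. x \<in> {a..b} \<Longrightarrow> norm (f x) \<le> B"
  using compact_imp_bounded[OF compact_continuous_image[OF assms compact_Icc]]
  unfolding bounded_iff by blast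

text \<open>A single integration by parts. As \<open>g\<close> is not assumed periodic, the boundary
  terms do not cancel, but they too are of order \<open>1 / \<bar>k\<bar>\<close>. The set
  \<open>S\<close> is arbitrary because the lemma is applied to a quotient known to be holomorphic
  only in the unit disc.\<close>

lemma fourier_coefficient_decay:
  assumes "open S" "g holomorphic_on S" "of_real ` {-1/2..1/2} \<subseteq> S"
  obtains C where "\<And>k::int. k \<noteq> 0 \<Longrightarrow>
    norm (integral {-1/2..1/2} (\<lambda>x::real. g (of_real x) * nome (- of_int k * of_real x))) \<le> C / \<bar>k\<bar>"
proof -
  let ?I = "{-1/2..1/2::real}"
  have cg: "continuous_on ?I (\<lambda>x. g (of_real x))"
    by (rule continuous_on_compose2[OF holomorphic_on_imp_continuous_on[OF assms(2)]])
       (use assms(3) in \<open>auto intro!: continuous_intros\<close>)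
  have cdg: "continuous_on ?I (\<lambda>x. deriv g (of_real x))"
    by (rule continuous_on_compose2[OF holomorphic_on_imp_continuous_on[OF holomorphic_deriv[OF assms(2,1)]]])
       (use assms(3) in \<open>auto intro!: continuous_intros\<close>)
  obtain B where B: "\<And>x. x \<in> ?I \<Longrightarrow> norm (g (of_real x)) \<le> B"
    using continuous_on_Icc_norm_bound[OF cg] by metis
  obtain B' where B': "\<And>x. x \<in> ?I \<Longrightarrow> norm (deriv g (of_real x)) \<le> B'"
    using continuous_on_Icc_norm_bound[OF cdg] by metis
  have "norm (integral ?I (\<lambda>x. g (of_real x) * nome (- of_int k * of_real x)))
      \<le> ((2 * B + B') / (2 * pi)) / \<bar>k\<bar>" if "k \<noteq> 0" for k :: int
  proof -
    define c where "c = - 2 * of_real pi * \<i> * (of_int k :: complex)"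
    have c: "c \<noteq> 0" "norm c = 2 * pi * \<bar>k\<bar>" using that by (auto simp: c_def norm_mult)
    let ?E = "\<lambda>z. nome (- of_int k * z) / c"
    let ?J = "integral ?I (\<lambda>x. deriv g (of_real x) * ?E (of_real x))"
    have nE: "norm (?E (of_real x)) = 1 / (2 * pi * \<bar>k\<bar>)" for x
      using norm_nome_of_real[of "- of_int k * x"] by (simp add: norm_divide c)
    have cE: "continuous_on ?I (\<lambda>x. ?E (of_real x))"
      by (intro continuous_intros) (use c in auto)
    have P: "((\<lambda>x. deriv g (of_real x) * ?E (of_real x) + g (of_real x) * nome (- of_int k * of_real x))
        has_integral g (of_real (1/2)) * ?E (of_real (1/2)) - g (of_real (-1/2)) * ?E (of_real (-1/2))) ?I"
    proof (rule fundamental_theorem_of_calculus)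
      fix x :: real assume "x \<in> ?I"
      then have "(g has_field_derivative deriv g (of_real x)) (at (of_real x))"
        by (intro holomorphic_derivI[OF assms(2,1)]) (use assms(3) in auto)
      moreover have "(?E has_field_derivative nome (- of_int k * of_real x)) (at (of_real x))"
        using c that unfolding c_def
        by (auto intro!: derivative_eq_intros DERIV_chain2[of nome, OF has_field_derivative_nome])
      ultimately have "((\<lambda>z. g z * ?E z) has_field_derivative (deriv g (of_real x) * ?E (of_real x)
          + g (of_real x) * nome (- of_int k * of_real x))) (at (of_real x))"
        by (rule DERIV_cong[OF DERIV_mult]) (simp add: mult.commute)
      then show "((\<lambda>x. g (of_real x) * ?E (of_real x)) has_vector_derivative (deriv g (of_real x) * ?E (of_real x)
          + g (of_real x) * nome (- of_int k * of_real x))) (at x within ?I)"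
        by (rule has_vector_derivative_real_field)
    qed simp
    have J: "((\<lambda>x. deriv g (of_real x) * ?E (of_real x)) has_integral ?J) ?I"
      by (intro integrable_integral integrable_continuous_real continuous_intros cdg cE) (use c in auto)
    have "((\<lambda>x. g (of_real x) * nome (- of_int k * of_real x)) has_integral
        g (of_real (1/2)) * ?E (of_real (1/2)) - g (of_real (-1/2)) * ?E (of_real (-1/2)) - ?J) ?I"
      using has_integral_diff[OF P J] by (simp only: add_diff_cancel_left')
    then have eq: "integral ?I (\<lambda>x. g (of_real x) * nome (- of_int k * of_real x)) =
        g (of_real (1/2)) * ?E (of_real (1/2)) - g (of_real (-1/2)) * ?E (of_real (-1/2)) - ?J"
      by (rule integral_unique)
    have "norm ?J \<le> B' * (1 / (2 * pi * \<bar>k\<bar>)) * (1/2 - (-1/2))"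
    proof (rule integral_bound)
      show "continuous_on ?I (\<lambda>x. deriv g (of_real x) * ?E (of_real x))"
        by (intro continuous_intros cdg) (use c in auto)
      show "norm (deriv g (of_real x) * ?E (of_real x)) \<le> B' * (1 / (2 * pi * \<bar>k\<bar>))" if "x \<in> ?I" for x
        unfolding norm_mult nE using B'[OF that] by (intro mult_right_mono) auto
    qed simp
    moreover have "norm (g (of_real x) * ?E (of_real x)) \<le> B * (1 / (2 * pi * \<bar>k\<bar>))" if "x \<in> ?I" for x
      unfolding norm_mult nE using B[OF that] by (intro mult_right_mono) auto
    from this[of "1/2"] this[of "-1/2"]
    have "norm (g (of_real (1/2)) * ?E (of_real (1/2))) \<le> B * (1 / (2 * pi * \<bar>k\<bar>))"
      "norm (g (of_real (-1/2)) * ?E (of_real (-1/2))) \<le> B * (1 / (2 * pi * \<bar>k\<bar>))" by auto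
    ultimately have "norm (integral ?I (\<lambda>x. g (of_real x) * nome (- of_int k * of_real x))) \<le>
        B * (1 / (2 * pi * \<bar>k\<bar>)) + B * (1 / (2 * pi * \<bar>k\<bar>)) + B' * (1 / (2 * pi * \<bar>k\<bar>)) * (1/2 - (-1/2))"
      unfolding eq by (smt (verit) norm_triangle_ineq4)
    also have "\<dots> = ((2 * B + B') / (2 * pi)) / \<bar>k\<bar>"
      using that by (simp add: field_simps)
    finally show ?thesis .
  qed
  then show ?thesis by (rule that)
qed

text \<open>Chernoff's argument: if \<open>F x - F 0 = g x (nome x - 1)\<close>, then the Fourier coefficients of
  \<open>F - F 0\<close> are differences of consecutive coefficients of \<open>g\<close>, and their sum telescopes.\<close>

lemma fourier_partial_sums_tendsto:
  assumes F: "F holomorphic_on UNIV"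
  shows "(\<lambda>K. \<Sum>k=-int K..int K. integral {-1/2..1/2}
      (\<lambda>x::real. F (of_real x) * nome (- of_int k * of_real x))) \<longlonglongrightarrow> F 0"
proof -
  let ?I = "{-1/2..1/2::real}"
  \<comment> \<open>Both difference quotients are entire, so \<open>u / v\<close> is
    \<open>(F z - F 0) / (nome z - 1)\<close> with its singularity at 0 removed; the other zeros of
    the denominator are the nonzero integers, which lie outside the open unit disc.\<close>
  define u where "u = (\<lambda>z. if z = 0 then deriv F 0 else (F z - F 0) / (z - 0))"
  define v where "v = (\<lambda>z. if z = 0 then deriv nome 0 else (nome z - nome 0) / (z - 0))"
  have u: "u holomorphic_on UNIV"
    unfolding u_def by (rule pole_lemma) (use F in auto)
  have v: "v holomorphic_on UNIV"
    unfolding v_def by (rule pole_lemma) (auto intro!: holomorphic_intros)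
  have v0: "v z \<noteq> 0" if "z \<in> ball 0 1" for z
  proof (cases "z = 0")
    case True
    then show ?thesis using DERIV_imp_deriv[OF has_field_derivative_nome[of 0 UNIV]]
      by (simp add: v_def)
  next
    case False
    have "z \<notin> \<int>"
    proof
      assume "z \<in> \<int>"
      then obtain n :: int where n: "z = of_int n" by (auto elim: Ints_cases)
      then have "\<bar>n\<bar> < 1" using that by (simp add: norm_of_int flip: of_int_abs)
      then show False using False n by simp
    qed
    then show ?thesis using False by (simp add: v_def nome_eq_1_iff)
  qed
  define g where "g = (\<lambda>z. u z / v z)"
  have g: "g holomorphic_on ball 0 1"
    unfolding g_def using u v v0 by (intro holomorphic_intros) (auto intro: holomorphic_on_subset)
  have Fg: "F z = g z * nome z - g z + F 0" if "z \<in> ball 0 1" for z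
  proof (cases "z = 0")
    case False
    then have "nome z - 1 \<noteq> 0" "g z = (F z - F 0) / (nome z - 1)"
      using v0[OF that] by (auto simp: g_def u_def v_def)
    then have "g z * (nome z - 1) = F z - F 0" by simp
    then show ?thesis by (simp add: algebra_simps)
  qed simp
  have sub: "of_real ` ?I \<subseteq> ball (0::complex) 1" by auto
  define G where "G k = integral ?I (\<lambda>x. g (of_real x) * nome (- of_int k * of_real x))" for k :: int
  have cg: "continuous_on ?I (\<lambda>x. g (of_real x))"
    by (rule continuous_on_compose2[OF holomorphic_on_imp_continuous_on[OF g]])
       (use sub in \<open>auto intro!: continuous_intros\<close>)
  have coeff: "integral ?I (\<lambda>x. F (of_real x) * nome (- of_int k * of_real x)) =
      G (k - 1) - G k + F 0 * (if k = 0 then 1 else 0)" for k :: int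
  proof -
    have e1: "integral ?I (\<lambda>x. F (of_real x) * nome (- of_int k * of_real x)) =
      integral ?I (\<lambda>x. g (of_real x) * nome (- of_int (k - 1) * of_real x)
        - g (of_real x) * nome (- of_int k * of_real x) + F 0 * nome (- of_int k * of_real x))"
    proof (rule integral_cong)
      fix x assume "x \<in> ?I"
      then have F1: "F (of_real x) = g (of_real x) * nome (of_real x) - g (of_real x) + F 0"
        using sub by (intro Fg) auto
      have N1: "nome (- of_int (k - 1) * of_real x) = nome (of_real x) * nome (- of_int k * of_real x)"
        by (simp flip: nome_add add: algebra_simps)
      show "F (of_real x) * nome (- of_int k * of_real x) =
        g (of_real x) * nome (- of_int (k - 1) * of_real x)
        - g (of_real x) * nome (- of_int k * of_real x) + F 0 * nome (- of_int k * of_real x)"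
        unfolding F1 N1 by (simp only: algebra_simps)
    qed
    have e2: "\<dots> = G (k - 1) - G k + integral ?I (\<lambda>x. F 0 * nome (- of_int k * of_real x))"
      unfolding G_def
      by (intro integral_unique has_integral_add has_integral_diff integrable_integral
          integrable_continuous_real continuous_intros cg)
    have e3: "integral ?I (\<lambda>x. F 0 * nome (- of_int k * of_real x)) =
        F 0 * (if k = 0 then 1 else 0)"
      unfolding integral_nome_character[of k, symmetric] by (rule integral_mult_right)
    show ?thesis by (rule trans[OF e1 e2[unfolded e3]])
  qed
  have sum: "(\<Sum>k=-int K..int K. G (k - 1) - G k + F 0 * (if k = 0 then 1 else 0)) =
      G (- int K - 1) - G (int K) + F 0" for K
  proof (induction K)
    case (Suc K)
    have "{-int (Suc K)..int (Suc K)} = insert (- int (Suc K)) (insert (int (Suc K)) {-int K..int K})"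
      by auto
    moreover have m: "- int K - 1 = -1 - int K" for K by simp
    ultimately show ?case using Suc unfolding m by (simp add: algebra_simps)
  qed simp
  obtain C where C: "\<And>k::int. k \<noteq> 0 \<Longrightarrow> norm (G k) \<le> C / \<bar>k\<bar>"
    by (rule fourier_coefficient_decay[OF open_ball g sub, folded G_def]) (rule that, auto)
  \<comment> \<open>The decay bound is available only for \<open>k \<noteq> 0\<close>; the shift to
    \<open>Suc K\<close> avoids that index.\<close>
  have "(\<lambda>K. G (int (Suc K))) \<longlonglongrightarrow> 0"
  proof (rule Lim_null_comparison)
    show "\<forall>\<^sub>F K in sequentially. norm (G (int (Suc K))) \<le> C / real (Suc K)"
    proof (intro always_eventually allI)
      fix K show "norm (G (int (Suc K))) \<le> C / real (Suc K)" using C[of "int (Suc K)"] by simp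
    qed
    show "(\<lambda>K. C / real (Suc K)) \<longlonglongrightarrow> 0"
      by (rule LIMSEQ_Suc[OF lim_const_over_n])
  qed
  then have G1: "(\<lambda>K. G (int K)) \<longlonglongrightarrow> 0" by (rule LIMSEQ_imp_Suc)
  have G2: "(\<lambda>K. G (- int K - 1)) \<longlonglongrightarrow> 0"
  proof (rule Lim_null_comparison)
    show "\<forall>\<^sub>F K in sequentially. norm (G (- int K - 1)) \<le> C / real (Suc K)"
    proof (intro always_eventually allI)
      fix K show "norm (G (- int K - 1)) \<le> C / real (Suc K)"
        using C[of "- int K - 1"] by (simp add: abs_if add.commute)
    qed
    show "(\<lambda>K. C / real (Suc K)) \<longlonglongrightarrow> 0"
      by (rule LIMSEQ_Suc[OF lim_const_over_n])
  qed
  show ?thesis unfolding coeff sum using tendsto_add[OF tendsto_diff[OF G2 G1] tendsto_const[of "F 0"]]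
    by simp
qed

section \<open>Majorants for Gaussian sums over the integers\<close>

lemma summable_on_exp_minus_abs_int:
  assumes "c > 0"
  shows "(\<lambda>n::int. exp (- c * \<bar>real_of_int n\<bar>)) summable_on UNIV"
proof -
  have "(\<lambda>n. exp (- c) ^ n) summable_on (UNIV :: nat set)"
    using assms by (subst summable_on_UNIV_nonneg_real_iff) (auto intro: summable_geometric)
  then have s: "(\<lambda>n::nat. exp (- c * real n)) summable_on UNIV"
    by (simp add: mult.commute flip: exp_of_nat_mult)
  have "(\<lambda>n::int. exp (- c * \<bar>real_of_int n\<bar>)) summable_on range int"
    using s by (subst summable_on_reindex) (auto simp: o_def)
  moreover have "(\<lambda>n::int. exp (- c * \<bar>real_of_int n\<bar>)) summable_on range (\<lambda>n. - int n)"
    using s by (subst summable_on_reindex) (auto simp: o_def inj_on_def)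
  moreover have "(UNIV :: int set) = range int \<union> range (\<lambda>n. - int n)"
    by (auto intro: int_cases2)
  ultimately show ?thesis by (metis summable_on_union)
qed

text \<open>From \<open>a (y - 1 / (2 a))^2 \<ge> 0\<close> with
  \<open>y = \<bar>m + x\<bar>\<close>, that is \<open>a y^2 \<ge> y - 1 / (4 a)\<close>. The
  constant depends on \<open>x\<close> only through \<open>\<bar>x\<bar>\<close>, which makes the
  majorant uniform on discs later.\<close>

lemma exp_minus_shifted_square_le:
  fixes a m x :: real
  assumes "a > 0"
  shows "exp (- a * (m + x)^2) \<le> exp (1 / (4 * a) + \<bar>x\<bar>) * exp (- 1 * \<bar>m\<bar>)"
proof -
  have "a * (\<bar>m + x\<bar> - 1 / (2 * a))^2 \<ge> 0" using assms by simp
  then have "a * (m + x)^2 - \<bar>m + x\<bar> + 1 / (4 * a) \<ge> 0"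
  proof -
    have "a * (\<bar>m + x\<bar> - 1 / (2 * a))^2 = a * \<bar>m + x\<bar>^2 - \<bar>m + x\<bar> * (a * (2 / (2 * a))) + a * (1 / (2 * a))^2"
      by (simp only: power2_diff) (simp add: algebra_simps)
    also have "\<dots> = a * (m + x)^2 - \<bar>m + x\<bar> + 1 / (4 * a)"
      using assms by (simp add: power2_eq_square)
    finally show ?thesis using \<open>a * (\<bar>m + x\<bar> - 1 / (2 * a))^2 \<ge> 0\<close> by simp
  qed
  moreover have "\<bar>m + x\<bar> \<ge> \<bar>m\<bar> - \<bar>x\<bar>" by linarith
  ultimately have "- a * (m + x)^2 \<le> (1 / (4 * a) + \<bar>x\<bar>) + (- 1 * \<bar>m\<bar>)" by linarith
  then show ?thesis by (simp flip: exp_add)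
qed

lemma summable_on_exp_minus_shifted_square:
  fixes a x :: real
  assumes "a > 0"
  shows "(\<lambda>n::int. exp (- a * (of_int n + x)^2)) summable_on UNIV"
proof (rule summable_on_comparison_test)
  show "(\<lambda>n::int. exp (1 / (4 * a) + \<bar>x\<bar>) * exp (- 1 * \<bar>real_of_int n\<bar>)) summable_on UNIV"
    by (intro summable_on_cmult_right summable_on_exp_minus_abs_int) simp
qed (use exp_minus_shifted_square_le[OF assms] in auto)

text \<open>Rescaled from the characteristic function of the standard normal distribution.\<close>

lemma has_bochner_integral_gaussian_nome:
  assumes s: "s > 0"
  shows "has_bochner_integral lborel
    (\<lambda>x. of_real (exp (- pi * s * x^2)) * nome (of_real (- \<xi> * x)))
    (of_real (exp (- pi * \<xi>^2 / s) / sqrt s))"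
proof -
  define c where "c = sqrt (2 * pi * s)"
  define t where "t = - 2 * pi * \<xi> / c"
  have c: "c > 0" "c^2 = 2 * pi * s" using s by (auto simp: c_def)
  have tc: "t * c = - 2 * pi * \<xi>" using c by (simp add: t_def)
  define f where "f = (\<lambda>x. std_normal_density x *\<^sub>R exp (\<i> * of_real (t * x)))"
  interpret real_distribution std_normal_distribution
    by (rule real_dist_normal_dist)
  have int: "integrable lborel f"
  proof -
    have "integrable std_normal_distribution (\<lambda>x. exp (\<i> * of_real (t * x)))"
      using integrable_iexp[of "\<lambda>x. of_real (t * x)"] by simp
    then show ?thesis
      unfolding f_def by (subst (asm) integrable_density) (auto simp: normal_density_nonneg)
  qed
  have "integral\<^sup>L lborel f = char std_normal_distribution t"
    unfolding char_def f_def by (subst integral_density) (auto simp: normal_density_nonneg)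
  also have "\<dots> = of_real (exp (- (t^2) / 2))"
    by (simp add: char_std_normal_distribution)
  also have "- (t^2) / 2 = - pi * \<xi>^2 / s"
  proof -
    have "t^2 / 2 = (2 * pi * \<xi>)^2 / (2 * pi * s) / 2" by (simp add: t_def power_divide c)
    then show ?thesis using s by (simp add: power2_eq_square)
  qed
  finally have I: "integral\<^sup>L lborel f = of_real (exp (- pi * \<xi>^2 / s))"
    by (simp add: algebra_simps)
  have fc: "f (c * x) = of_real (1 / sqrt (2 * pi)) * (of_real (exp (- pi * s * x^2)) * nome (of_real (- \<xi> * x)))" for x
  proof -
    have "(c * x)^2 / 2 = pi * s * x^2" by (simp add: power_mult_distrib c)
    moreover have "exp (\<i> * of_real (t * (c * x))) = nome (of_real (- \<xi> * x))"
      using tc unfolding nome_def by (simp flip: mult.assoc) (simp add: mult_ac)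
    ultimately show ?thesis
      by (simp add: f_def std_normal_density_def scaleR_conv_of_real mult.assoc)
  qed
  have "has_bochner_integral lborel (\<lambda>x. f (c * x)) (of_real (exp (- pi * \<xi>^2 / s) / c))"
    using lborel_has_bochner_integral_real_affine_iff[of c f "of_real (exp (- pi * \<xi>^2 / s))" 0] c int I
    by (simp add: has_bochner_integral_iff scaleR_conv_of_real field_simps)
  then have "has_bochner_integral lborel
      (\<lambda>x. of_real (sqrt (2 * pi)) * f (c * x)) (of_real (sqrt (2 * pi)) * of_real (exp (- pi * \<xi>^2 / s) / c))"
    by (rule has_bochner_integral_mult_right)
  moreover have "sqrt (2 * pi) * (exp (- pi * \<xi>^2 / s) / c) = exp (- pi * \<xi>^2 / s) / sqrt s"
    using s by (simp add: c_def real_sqrt_mult)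
  moreover have "of_real (sqrt (2 * pi)) * f (c * x) = of_real (exp (- pi * s * x^2)) * nome (of_real (- \<xi> * x))" for x
    unfolding fc by simp
  ultimately show ?thesis by (simp only: of_real_mult[symmetric])
qed

section \<open>Poisson summation in one variable\<close>

lemma sum_integral_unit_intervals:
  fixes \<psi> :: "real \<Rightarrow> complex"
  assumes "continuous_on UNIV \<psi>"
  shows "(\<Sum>n=-int N..int N. integral {-1/2..1/2} (\<lambda>x. \<psi> (of_int n + x))) =
    integral {- real N - 1/2..real N + 1/2} \<psi>"
proof -
  have int: "\<psi> integrable_on {a..b}" for a b
    by (intro integrable_continuous_real continuous_on_subset[OF assms]) auto
  have shift: "integral {-1/2..1/2} (\<lambda>x. \<psi> (of_int n + x)) = integral {of_int n - 1/2..of_int n + 1/2} \<psi>"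
    for n :: int
    using integral_shift_Icc_real[of "-1/2" "1/2" \<psi> "of_int n"] by (simp add: o_def add.commute)
  show ?thesis
    unfolding shift
  proof (induction N)
    case (Suc N)
    have "{-int (Suc N)..int (Suc N)} = insert (- int (Suc N)) (insert (int (Suc N)) {-int N..int N})"
      by auto
    then have "(\<Sum>n=-int (Suc N)..int (Suc N). integral {of_int n - 1/2..of_int n + 1/2} \<psi>) =
        integral {of_int (- int (Suc N)) - 1/2..of_int (- int (Suc N)) + 1/2} \<psi> +
        (integral {of_int (int (Suc N)) - 1/2..of_int (int (Suc N)) + 1/2} \<psi> +
         integral {- real N - 1/2..real N + 1/2} \<psi>)"
      by (simp only: Suc) (subst sum.insert; simp add: Suc)+
    also have "of_int (- int (Suc N)) - 1/2 = - real (Suc N) - 1/2" by simp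
    also have "of_int (- int (Suc N)) + 1/2 = - real N - 1/2" by simp
    also have "of_int (int (Suc N)) - 1/2 = real N + 1/2" by simp
    also have "of_int (int (Suc N)) + 1/2 = real (Suc N) + 1/2" by simp
    also have "integral {real N + 1/2..real (Suc N) + 1/2} \<psi> + integral {- real N - 1/2..real N + 1/2} \<psi> =
        integral {- real N - 1/2..real (Suc N) + 1/2} \<psi>"
      by (subst add.commute, rule Henstock_Kurzweil_Integration.integral_combine) (auto simp: int)
    also have "integral {- real (Suc N) - 1/2..- real N - 1/2} \<psi> + \<dots> =
        integral {- real (Suc N) - 1/2..real (Suc N) + 1/2} \<psi>"
      by (rule Henstock_Kurzweil_Integration.integral_combine) (auto simp: int)
    finally show ?case .
  qed simp
qed

lemma integral_expanding_intervals_tendsto: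
  fixes \<psi> :: "real \<Rightarrow> complex"
  assumes "has_bochner_integral lborel \<psi> I"
  shows "(\<lambda>N. integral {- real N - 1/2..real N + 1/2} \<psi>) \<longlonglongrightarrow> I"
proof -
  have int: "integrable lborel \<psi>" and I: "integral\<^sup>L lborel \<psi> = I"
    using assms by (auto simp: has_bochner_integral_iff)
  have "integral {- real N - 1/2..real N + 1/2} \<psi> =
      (LINT x|lborel. indicator {- real N - 1/2..real N + 1/2} x *\<^sub>R \<psi> x)" for N
  proof -
    have "set_integrable lborel {- real N - 1/2..real N + 1/2} \<psi>"
      unfolding set_integrable_def using int by (intro integrable_mult_indicator) auto
    from set_borel_integral_eq_integral(2)[OF this] show ?thesis
      by (simp add: set_lebesgue_integral_def)
  qed
  moreover have "(\<lambda>N. (LINT x|lborel. indicator {- real N - 1/2..real N + 1/2} x *\<^sub>R \<psi> x)) \<longlonglongrightarrow>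
      (LINT x|lborel. \<psi> x)"
  proof (rule integral_dominated_convergence)
    show "integrable lborel (\<lambda>x. norm (\<psi> x))" using int by simp
    show "\<psi> \<in> borel_measurable lborel" using int by simp
    then show "(\<lambda>x. indicator {- real N - 1/2..real N + 1/2} x *\<^sub>R \<psi> x) \<in> borel_measurable lborel" for N
      by measurable
    show "AE x in lborel. (\<lambda>N. indicator {- real N - 1/2..real N + 1/2} x *\<^sub>R \<psi> x) \<longlonglongrightarrow> \<psi> x"
    proof (rule AE_I2)
      fix x :: real
      obtain M :: nat where M: "\<bar>x\<bar> \<le> real M" using real_arch_simple by blast
      have "indicator {- real N - 1/2..real N + 1/2} x *\<^sub>R \<psi> x = \<psi> x" if "N \<ge> M" for N
        using M that by (auto simp: indicator_def)
      then show "(\<lambda>N. indicator {- real N - 1/2..real N + 1/2} x *\<^sub>R \<psi> x) \<longlonglongrightarrow> \<psi> x"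
        by (intro tendsto_eventually eventually_sequentiallyI)
    qed
    show "AE x in lborel. norm (indicator {- real N - 1/2..real N + 1/2} x *\<^sub>R \<psi> x) \<le> norm (\<psi> x)" for N
      by (intro AE_I2) (auto simp: indicator_def)
  qed
  ultimately show ?thesis by (simp add: I)
qed

text \<open>Unordered sums may thus be evaluated along symmetric partial sums, the form in which
  both the Fourier inversion and the unfolding of the period integral are available.\<close>

lemma filterlim_symmetric_intervals:
  "filterlim (\<lambda>N. {-int N..int N}) (finite_subsets_at_top UNIV) sequentially"
  unfolding filterlim_finite_subsets_at_top
proof safe
  fix X :: "int set" assume "finite X"
  then have M: "\<bar>x\<bar> \<le> Max (abs ` X)" if "x \<in> X" for x
    using that by (intro Max_ge) auto
  show "\<forall>\<^sub>F N in sequentially. finite {-int N..int N} \<and> X \<subseteq> {-int N..int N} \<and> {-int N..int N} \<subseteq> UNIV"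
    using eventually_ge_at_top[of "nat (Max (abs ` X))"] by eventually_elim (use M in force)
qed

text \<open>Both parameters are needed in two variables: the shift \<open>\<beta>\<close> produces
  cosets of a sublattice, and the frequency \<open>\<omega>\<close> absorbs the mixed term left by
  completing the square. The periodization \<open>F\<close> is entire, so Fourier inversion at 0
  applies to it.\<close>

theorem poisson_gaussian:
  fixes s \<beta> \<omega> :: real
  assumes s: "s > 0"
  shows "(\<Sum>\<^sub>\<infinity>n::int. of_real (exp (- pi * s * (of_int n + \<beta>)^2)) * nome (of_real (\<omega> * (of_int n + \<beta>)))) =
    of_real (1 / sqrt s) *
    (\<Sum>\<^sub>\<infinity>n::int. of_real (exp (- pi * (of_int n - \<omega>)^2 / s)) * nome (of_real (of_int n * \<beta>)))"
proof -
  define \<phi> where "\<phi> = (\<lambda>z::complex. exp (- of_real (pi * s) * z^2) * nome (of_real \<omega> * z))"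
  define F where "F = (\<lambda>z. \<Sum>\<^sub>\<infinity>n::int. \<phi> (of_int n + of_real \<beta> + z))"
  have \<phi>_real: "\<phi> (of_real x) = of_real (exp (- pi * s * x^2)) * nome (of_real (\<omega> * x))" for x
    by (simp add: \<phi>_def flip: exp_of_real)
  have hol: "(\<lambda>z. \<phi> (c + z)) holomorphic_on A" for c A
    unfolding \<phi>_def by (intro holomorphic_intros)
  \<comment> \<open>The first factor bounds the growth caused by \<open>Im z\<close>, the second one
    the shift of the real part by \<open>\<beta> + Re z\<close>.\<close>
  define C where "C R = exp (pi * s * R^2 + 2 * pi * \<bar>\<omega>\<bar> * R) * exp (1 / (4 * (pi * s)) + (\<bar>\<beta>\<bar> + R))" for R :: real
  have bound: "norm (\<phi> (of_int n + of_real \<beta> + z)) \<le> C R * exp (- 1 * \<bar>real_of_int n\<bar>)"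
    if z: "norm z \<le> R" for n :: int and z R
  proof -
    have im: "\<bar>Im z\<bar> \<le> R" and re: "\<bar>Re z\<bar> \<le> R"
      using abs_Im_le_cmod[of z] abs_Re_le_cmod[of z] z by linarith+
    have "(Im z)^2 \<le> R^2" using power_mono[OF im, of 2] by simp
    then have 1: "pi * s * (Im z)^2 \<le> pi * s * R^2" using s by simp
    have "- \<omega> * Im z \<le> \<bar>\<omega>\<bar> * \<bar>Im z\<bar>" by (metis abs_ge_minus_self abs_mult mult_minus_left)
    also have "\<dots> \<le> \<bar>\<omega>\<bar> * R" using im by (intro mult_left_mono) auto
    finally have 2: "- 2 * pi * (\<omega> * Im z) \<le> 2 * pi * \<bar>\<omega>\<bar> * R"
      using mult_left_mono[of "- \<omega> * Im z" "\<bar>\<omega>\<bar> * R" "2 * pi"] by (simp add: mult_ac)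
    have 3: "pi * s * (Im z)^2 - 2 * pi * (\<omega> * Im z) \<le> pi * s * R^2 + 2 * pi * \<bar>\<omega>\<bar> * R"
      using 1 2 by linarith
    have "norm (\<phi> (of_int n + of_real \<beta> + z)) =
      exp (- (pi * s) * ((of_int n + (\<beta> + Re z))^2) + (pi * s * (Im z)^2 - 2 * pi * (\<omega> * Im z)))"
      unfolding \<phi>_def norm_mult norm_nome norm_exp_eq_Re
      by (simp add: power2_eq_square algebra_simps flip: exp_add)
    also have "\<dots> = exp (- (pi * s) * ((of_int n + (\<beta> + Re z))^2)) * exp (pi * s * (Im z)^2 - 2 * pi * (\<omega> * Im z))"
      by (rule exp_add)
    also have "\<dots> \<le> (exp (1 / (4 * (pi * s)) + \<bar>\<beta> + Re z\<bar>) * exp (- 1 * \<bar>real_of_int n\<bar>)) * exp (pi * s * R^2 + 2 * pi * \<bar>\<omega>\<bar> * R)"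
      by (intro mult_mono exp_minus_shifted_square_le) (use s 3 in auto)
    also have "\<dots> \<le> (exp (1 / (4 * (pi * s)) + (\<bar>\<beta>\<bar> + R)) * exp (- 1 * \<bar>real_of_int n\<bar>)) * exp (pi * s * R^2 + 2 * pi * \<bar>\<omega>\<bar> * R)"
      by (intro mult_right_mono) (use re in auto)
    finally show ?thesis by (simp add: C_def mult_ac)
  qed
  have unif: "uniform_limit (cball 0 R) (\<lambda>X z. \<Sum>n\<in>X. \<phi> (of_int n + of_real \<beta> + z)) F (finite_subsets_at_top UNIV)" for R
    unfolding F_def
    by (rule Weierstrass_m_test_general[where M = "\<lambda>n::int. C R * exp (- 1 * \<bar>real_of_int n\<bar>)"])
       (use bound in \<open>auto intro!: summable_on_cmult_right summable_on_exp_minus_abs_int[of 1, simplified]\<close>)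
  have F: "F holomorphic_on UNIV"
  proof -
    have hb: "F holomorphic_on ball 0 R" for R
    proof -
      have "continuous_on (cball 0 R) F \<and> F holomorphic_on ball 0 R"
        by (rule holomorphic_uniform_limit[OF _ unif])
           (auto intro!: always_eventually holomorphic_intros hol holomorphic_on_imp_continuous_on[OF holomorphic_on_sum])
      then show ?thesis by simp
    qed
    have "F field_differentiable (at z)" for z
      using holomorphic_on_imp_differentiable_at[OF hb[of "norm z + 1"] open_ball, of z] by simp
    then show ?thesis by (simp add: holomorphic_on_def)
  qed
  define \<psi> where "\<psi> k x = \<phi> (of_real (\<beta> + x)) * nome (- of_int k * of_real x)" for k :: int and x :: real
  define I where "I k = of_real (1 / sqrt s) * (of_real (exp (- pi * (of_int k - \<omega>)^2 / s)) * nome (of_real (of_int k * \<beta>)))" for k :: int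
  \<comment> \<open>One sequence of integrals over growing intervals has two limits: the period
    integral of \<open>F\<close>, by uniform convergence, and the Fourier transform of the Gaussian,
    by dominated convergence.\<close>
  have coeff: "integral {-1/2..1/2} (\<lambda>x. F (of_real x) * nome (- of_int k * of_real x)) = I k" for k
  proof (rule LIMSEQ_unique)
    let ?g = "\<lambda>n x. \<phi> (of_int n + of_real \<beta> + of_real x) * nome (- of_int k * of_real x)"
    have nk: "norm (nome (- of_int k * of_real x)) = 1" for x
      using norm_nome_of_real[of "- of_int k * x"] by simp
    have "uniform_limit {-1/2..1/2} (\<lambda>X x. \<Sum>n\<in>X. ?g n x) (\<lambda>x. \<Sum>\<^sub>\<infinity>n. ?g n x) (finite_subsets_at_top UNIV)"
    proof (rule Weierstrass_m_test_general[where M = "\<lambda>n::int. C 1 * exp (- 1 * \<bar>real_of_int n\<bar>)"])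
      show "norm (?g n x) \<le> C 1 * exp (- 1 * \<bar>real_of_int n\<bar>)" if "x \<in> {-1/2..1/2}" for n x
        unfolding norm_mult nk using bound[of "of_real x" 1 n] that by auto
    qed (intro summable_on_cmult_right summable_on_exp_minus_abs_int, simp)
    from filterlim_compose[OF this filterlim_symmetric_intervals]
    have u: "uniform_limit {-1/2..1/2} (\<lambda>N x. \<Sum>n=-int N..int N. ?g n x) (\<lambda>x. \<Sum>\<^sub>\<infinity>n. ?g n x) sequentially" .
    have cont: "continuous_on UNIV (\<psi> k)"
      unfolding \<psi>_def \<phi>_def by (intro continuous_intros)
    have cont_g: "continuous_on S (?g n)" for n S
      unfolding \<phi>_def by (intro continuous_intros)
    obtain J1 J2 where J: "\<And>N. ((\<lambda>x. \<Sum>n=-int N..int N. ?g n x) has_integral J1 N) {-1/2..1/2}"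
        "((\<lambda>x. \<Sum>\<^sub>\<infinity>n. ?g n x) has_integral J2) {-1/2..1/2}" "J1 \<longlonglongrightarrow> J2"
      by (rule uniform_limit_integral[OF u continuous_on_sum[OF cont_g]]) (rule sequentially_bot, rule that)
    have J1: "J1 N = integral {- real N - 1/2..real N + 1/2} (\<psi> k)" for N
    proof -
      have "((\<lambda>x. \<Sum>n=-int N..int N. ?g n x) has_integral
          (\<Sum>n=-int N..int N. integral {-1/2..1/2} (?g n))) {-1/2..1/2}"
        by (intro has_integral_sum integrable_integral integrable_continuous_real cont_g) simp
      from has_integral_unique[OF J(1) this]
      have J1: "J1 N = (\<Sum>n=-int N..int N. integral {-1/2..1/2} (?g n))" .
      have g: "?g n = (\<lambda>x. \<psi> k (of_int n + x))" for n
      proof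
        fix x
        have "nome (- of_int k * of_real (of_int n + x)) = nome (of_int (- k * n)) * nome (- of_int k * of_real x)"
          by (simp only: nome_add[symmetric]) (simp add: algebra_simps)
        then show "?g n x = \<psi> k (of_int n + x)"
          unfolding \<psi>_def by (simp only: nome_of_int of_real_add of_real_of_int_eq add_ac mult_1)
      qed
      show ?thesis
        unfolding J1 g by (rule sum_integral_unit_intervals[OF cont])
    qed
    have "(\<lambda>x. \<Sum>\<^sub>\<infinity>n. ?g n x) = (\<lambda>x. F (of_real x) * nome (- of_int k * of_real x))"
      by (simp add: F_def infsum_cmult_left')
    then show "(\<lambda>N. integral {- real N - 1/2..real N + 1/2} (\<psi> k)) \<longlonglongrightarrow>
        integral {-1/2..1/2} (\<lambda>x. F (of_real x) * nome (- of_int k * of_real x))"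
      using J(3) integral_unique[OF J(2)] ext[of J1, OF J1] by (simp only:)
    show "(\<lambda>N. integral {- real N - 1/2..real N + 1/2} (\<psi> k)) \<longlonglongrightarrow> I k"
    proof (rule integral_expanding_intervals_tendsto)
      let ?h = "\<lambda>y. of_real (exp (- pi * s * y^2)) * nome (of_real (- (of_int k - \<omega>) * y))"
      have "has_bochner_integral lborel (\<lambda>x. ?h (\<beta> + 1 * x))
          (of_real (exp (- pi * (of_int k - \<omega>)^2 / s) / sqrt s) /\<^sub>R \<bar>1\<bar>)"
        using has_bochner_integral_gaussian_nome[OF s, of "of_int k - \<omega>"]
        by (subst lborel_has_bochner_integral_real_affine_iff[symmetric]) auto
      then have "has_bochner_integral lborel (\<lambda>x. nome (of_real (of_int k * \<beta>)) * ?h (\<beta> + x))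
          (nome (of_real (of_int k * \<beta>)) * of_real (exp (- pi * (of_int k - \<omega>)^2 / s) / sqrt s))"
        by (intro has_bochner_integral_mult_right) simp
      moreover have "nome (of_real (of_int k * \<beta>)) * ?h (\<beta> + x) = \<psi> k x" for x
      proof -
        have "nome (of_real (of_int k * \<beta>)) * nome (of_real (- (of_int k - \<omega>) * (\<beta> + x))) =
            nome (of_real (\<omega> * (\<beta> + x))) * nome (- of_int k * of_real x)"
          by (simp only: nome_add[symmetric]) (simp add: algebra_simps)
        then have "nome (of_real (of_int k * \<beta>)) * (E * nome (of_real (- (of_int k - \<omega>) * (\<beta> + x)))) =
            E * nome (of_real (\<omega> * (\<beta> + x))) * nome (- of_int k * of_real x)" for E
          by (simp only: mult.assoc mult.left_commute[of "nome (of_real (of_int k * \<beta>))" E])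
        then show ?thesis unfolding \<psi>_def \<phi>_real by blast
      qed
      ultimately show "has_bochner_integral lborel (\<psi> k) (I k)"
        by (simp add: I_def mult_ac)
    qed
  qed
  have "(\<lambda>K. \<Sum>k=-int K..int K. I k) \<longlonglongrightarrow> F 0"
    using fourier_partial_sums_tendsto[OF F] by (simp only: coeff)
  moreover have "(\<lambda>K. \<Sum>k=-int K..int K. I k) \<longlonglongrightarrow> (\<Sum>\<^sub>\<infinity>k. I k)"
  proof -
    have "(\<lambda>k. norm (I k)) summable_on UNIV"
      unfolding I_def norm_mult norm_nome_of_real norm_of_real
      using summable_on_cmult_right[OF summable_on_exp_minus_shifted_square[of "pi / s" "- \<omega>"], of "1 / sqrt s"] s
      by simp
    then have "I summable_on UNIV" by (rule abs_summable_summable)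
    then have "(sum I \<longlongrightarrow> (\<Sum>\<^sub>\<infinity>k. I k)) (finite_subsets_at_top UNIV)"
      by (rule infsum_tendsto)
    from filterlim_compose[OF this filterlim_symmetric_intervals] show ?thesis .
  qed
  ultimately have A: "F 0 = (\<Sum>\<^sub>\<infinity>k. I k)" by (rule LIMSEQ_unique)
  have B: "F 0 = (\<Sum>\<^sub>\<infinity>n::int. \<phi> (of_real (of_int n + \<beta>)))"
    by (simp add: F_def)
  have C: "(\<Sum>\<^sub>\<infinity>k. I k) = of_real (1 / sqrt s) *
      (\<Sum>\<^sub>\<infinity>n::int. of_real (exp (- pi * (of_int n - \<omega>)^2 / s)) * nome (of_real (of_int n * \<beta>)))"
    unfolding I_def by (rule infsum_cmult_right')
  show ?thesis
    using trans[OF trans[OF B[symmetric] A] C] unfolding \<phi>_real .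
qed

section \<open>Poisson summation in two variables\<close>

lemma summable_on_product_nonneg:
  fixes f :: "'a \<Rightarrow> real" and g :: "'b \<Rightarrow> real"
  assumes "f summable_on UNIV" "g summable_on UNIV" "\<And>x. f x \<ge> 0" "\<And>y. g y \<ge> 0"
  shows "(\<lambda>(x, y). f x * g y) summable_on UNIV"
proof -
  have "(\<lambda>(x, y). f x * g y) summable_on UNIV \<times> UNIV"
  proof (rule summable_on_SigmaI)
    show "((\<lambda>y. case (x, y) of (x, y) \<Rightarrow> f x * g y) has_sum f x * infsum g UNIV) UNIV" for x
      using assms(2) by (simp add: has_sum_cmult_right)
    show "(\<lambda>x. f x * infsum g UNIV) summable_on UNIV"
      using assms(1) by (rule summable_on_cmult_left)
  qed (use assms in auto)
  then show ?thesis by simp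
qed

lemma pos_def_form_last_coeff_pos:
  fixes A B C :: real
  assumes "A > 0" "4 * A * C - B^2 > 0"
  shows "C > 0"
proof -
  have "0 < 4 * A * C" using assms(2) zero_le_power2[of B] by linarith
  then show ?thesis using assms(1) by (simp add: zero_less_mult_iff)
qed

text \<open>The constant is determinant over trace of the matrix of the form, hence at most its
  smaller eigenvalue; the proof adds the two ways of completing the square.\<close>

lemma pos_def_form_lower_bound:
  fixes A B C X Y :: real
  assumes "A > 0" "4 * A * C - B^2 > 0"
  shows "(4 * A * C - B^2) / (4 * (A + C)) * (X^2 + Y^2) \<le> A * X^2 + B * X * Y + C * Y^2"
proof -
  have C: "C > 0" by (rule pos_def_form_last_coeff_pos[OF assms])
  have "4 * A * (A * X^2 + B * X * Y + C * Y^2) = (2 * A * X + B * Y)^2 + (4 * A * C - B^2) * Y^2"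
    by (simp add: power2_eq_square algebra_simps)
  then have 1: "(4 * A * C - B^2) * Y^2 \<le> 4 * A * (A * X^2 + B * X * Y + C * Y^2)" by simp
  have "4 * C * (A * X^2 + B * X * Y + C * Y^2) = (2 * C * Y + B * X)^2 + (4 * A * C - B^2) * X^2"
    by (simp add: power2_eq_square algebra_simps)
  then have 2: "(4 * A * C - B^2) * X^2 \<le> 4 * C * (A * X^2 + B * X * Y + C * Y^2)" by simp
  have "(4 * A * C - B^2) * (X^2 + Y^2) \<le> (A * X^2 + B * X * Y + C * Y^2) * (4 * (A + C))"
    using 1 2 by (simp add: algebra_simps)
  then show ?thesis using assms(1) C by (simp add: pos_divide_le_eq)
qed

lemma summable_on_exp_minus_pos_def_form:
  fixes A B C a \<alpha> \<beta> :: real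
  assumes "A > 0" "4 * A * C - B^2 > 0" "a > 0"
  shows "(\<lambda>(x::int, y::int). exp (- a * (A * (x + \<alpha>)^2 + B * (x + \<alpha>) * (y + \<beta>) + C * (y + \<beta>)^2)))
    summable_on UNIV"
proof -
  define \<delta> where "\<delta> = (4 * A * C - B^2) / (4 * (A + C))"
  have "C > 0" by (rule pos_def_form_last_coeff_pos[OF assms(1,2)])
  then have \<delta>: "a * \<delta> > 0" using assms by (simp add: \<delta>_def)
  have "(\<lambda>(x::int, y::int). exp (- (a * \<delta>) * (x + \<alpha>)^2) * exp (- (a * \<delta>) * (y + \<beta>)^2)) summable_on UNIV"
    by (intro summable_on_product_nonneg summable_on_exp_minus_shifted_square \<delta>) auto
  then show ?thesis
  proof (rule summable_on_comparison_test)
    fix p :: "int \<times> int"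
    obtain x y where p: "p = (x, y)" by (cases p)
    have "a * (\<delta> * ((x + \<alpha>)^2 + (y + \<beta>)^2)) \<le> a * (A * (x + \<alpha>)^2 + B * (x + \<alpha>) * (y + \<beta>) + C * (y + \<beta>)^2)"
      unfolding \<delta>_def using assms by (intro mult_left_mono pos_def_form_lower_bound) auto
    then show "(case p of (x, y) \<Rightarrow> exp (- a * (A * (x + \<alpha>)^2 + B * (x + \<alpha>) * (y + \<beta>) + C * (y + \<beta>)^2)))
      \<le> (case p of (x, y) \<Rightarrow> exp (- (a * \<delta>) * (x + \<alpha>)^2) * exp (- (a * \<delta>) * (y + \<beta>)^2))"
      by (simp add: p algebra_simps flip: exp_add)
  qed auto
qed

text \<open>One-dimensional summation in \<open>x\<close> for fixed \<open>y\<close>, after completing the square, followed by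
  summation in \<open>y\<close>.\<close>

theorem poisson_gaussian_2d:
  fixes A B C t \<alpha> \<beta> :: real
  defines "\<Delta> \<equiv> 4 * A * C - B^2"
  assumes A: "A > 0" and \<Delta>: "\<Delta> > 0" and t: "t > 0"
  shows "(\<Sum>\<^sub>\<infinity>(x::int, y::int). complex_of_real (exp (- (2 * pi * t) *
      (A * (of_int x + \<alpha>)^2 + B * (of_int x + \<alpha>) * (of_int y + \<beta>) + C * (of_int y + \<beta>)^2)))) =
    of_real (1 / (t * sqrt \<Delta>)) *
    (\<Sum>\<^sub>\<infinity>(m::int, n::int). of_real (exp (- (2 * pi / (t * \<Delta>)) * (A * (of_int n)^2 - B * of_int n * of_int m + C * (of_int m)^2))) *
      nome (of_real (of_int m * \<alpha> + of_int n * \<beta>)))"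
proof -
  \<comment> \<open>The parameters of the Gaussians in \<open>x\<close> and in \<open>y\<close>
    after completing the square. Their product \<open>t^2 \<Delta>\<close> accounts for the factor
    in front of the dual sum.\<close>
  define s1 where "s1 = 2 * t * A"
  define s2 where "s2 = t * \<Delta> / (2 * A)"
  have s1: "s1 > 0" and s2: "s2 > 0" using A \<Delta> t by (auto simp: s1_def s2_def)
  define E where "E x y = complex_of_real (exp (- (2 * pi * t) *
      (A * (of_int x + \<alpha>)^2 + B * (of_int x + \<alpha>) * (of_int y + \<beta>) + C * (of_int y + \<beta>)^2)))" for x y :: int
  define b where "b y = \<alpha> + B * (of_int y + \<beta>) / (2 * A)" for y :: int
  define G1 where "G1 m = complex_of_real (exp (- pi * (of_int m)^2 / s1)) * nome (of_real (of_int m * \<alpha>))" for m :: int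
  define G2 where "G2 y = complex_of_real (exp (- pi * s2 * (of_int y + \<beta>)^2))" for y :: int
  define \<omega> where "\<omega> m = of_int m * B / (2 * A)" for m :: int
  define R where "R m n = of_real (exp (- (2 * pi / (t * \<Delta>)) * (A * (of_int n)^2 - B * of_int n * of_int m + C * (of_int m)^2))) *
      nome (of_real (of_int m * \<alpha> + of_int n * \<beta>))" for m n :: int
  have sumE: "(\<lambda>(x, y). E x y) summable_on UNIV"
  proof (rule abs_summable_summable)
    have "(\<lambda>p. norm (case p of (x, y) \<Rightarrow> E x y)) = (\<lambda>(x, y). exp (- (2 * pi * t) *
      (A * (of_int x + \<alpha>)^2 + B * (of_int x + \<alpha>) * (of_int y + \<beta>) + C * (of_int y + \<beta>)^2)))"
      by (rule ext) (simp only: case_prod_unfold E_def norm_of_real abs_exp_cancel)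
    moreover have "2 * pi * t > 0" using t by simp
    ultimately show "(\<lambda>p. norm (case p of (x, y) \<Rightarrow> E x y)) summable_on UNIV"
      using summable_on_exp_minus_pos_def_form[OF A \<Delta>[unfolded \<Delta>_def], of "2 * pi * t" \<alpha> \<beta>]
      by (simp only:)
  qed
  have sumR: "(\<lambda>(m, n). R m n) summable_on UNIV"
  proof (rule abs_summable_summable)
    have C: "C > 0" using pos_def_form_last_coeff_pos A \<Delta> unfolding \<Delta>_def by blast
    have "4 * C * A - (- B)^2 > 0" using \<Delta> by (simp add: \<Delta>_def algebra_simps)
    note * = summable_on_exp_minus_pos_def_form[OF C this, of "2 * pi / (t * \<Delta>)" 0 0]
    have "norm (R m n) = exp (- (2 * pi / (t * \<Delta>)) * (A * (of_int n)^2 - B * of_int n * of_int m + C * (of_int m)^2))" for m n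
      unfolding R_def norm_mult norm_nome_of_real by simp
    then have "(\<lambda>p. norm (case p of (m, n) \<Rightarrow> R m n)) = (\<lambda>(m, n). exp (- (2 * pi / (t * \<Delta>)) *
      (C * (of_int m + 0)^2 + - B * (of_int m + 0) * (of_int n + 0) + A * (of_int n + 0)^2)))"
      by (auto simp: fun_eq_iff algebra_simps)
    then show "(\<lambda>p. norm (case p of (m, n) \<Rightarrow> R m n)) summable_on UNIV"
      using * t \<Delta> by simp
  qed
  have E: "E x y = G2 y * of_real (exp (- pi * s1 * (of_int x + b y)^2))" for x y
  proof -
    have "A * (of_int x + \<alpha>)^2 + B * (of_int x + \<alpha>) * (of_int y + \<beta>) + C * (of_int y + \<beta>)^2 =
        A * (of_int x + b y)^2 + \<Delta> / (4 * A) * (of_int y + \<beta>)^2"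
      using A unfolding \<Delta>_def b_def by (simp add: field_simps power2_eq_square)
    note q = this
    have "- (2 * pi * t) * (A * (of_int x + \<alpha>)^2 + B * (of_int x + \<alpha>) * (of_int y + \<beta>) + C * (of_int y + \<beta>)^2) =
        - pi * s2 * (of_int y + \<beta>)^2 + - pi * s1 * (of_int x + b y)^2"
      unfolding q using A by (simp add: s1_def s2_def field_simps)
    then show ?thesis unfolding E_def G2_def by (simp only: exp_add of_real_mult)
  qed
  have sumx: "(\<Sum>\<^sub>\<infinity>x. E x y) = of_real (1 / sqrt s1) * (\<Sum>\<^sub>\<infinity>m. G2 y * G1 m * nome (of_real (\<omega> m * (of_int y + \<beta>))))" for y
  proof -
    have 1: "(\<Sum>\<^sub>\<infinity>x. E x y) = G2 y * (\<Sum>\<^sub>\<infinity>x::int. of_real (exp (- pi * s1 * (of_int x + b y)^2)))"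
      unfolding E by (rule infsum_cmult_right')
    have 2: "(\<Sum>\<^sub>\<infinity>x::int. of_real (exp (- pi * s1 * (of_int x + b y)^2))) = of_real (1 / sqrt s1) *
       (\<Sum>\<^sub>\<infinity>m::int. of_real (exp (- pi * (of_int m)^2 / s1)) * nome (of_real (of_int m * b y)))"
      using poisson_gaussian[OF s1, of "b y" 0] by simp
    have 3: "of_real (exp (- pi * (of_int m)^2 / s1)) * nome (of_real (of_int m * b y)) =
        G1 m * nome (of_real (\<omega> m * (of_int y + \<beta>)))" for m :: int
    proof -
      have "of_int m * b y = of_int m * \<alpha> + \<omega> m * (of_int y + \<beta>)" by (simp add: b_def \<omega>_def algebra_simps)
      then show ?thesis unfolding G1_def by (simp only: of_real_add nome_add mult.assoc)
    qed
    have 4: "(\<Sum>\<^sub>\<infinity>m. G2 y * G1 m * nome (of_real (\<omega> m * (of_int y + \<beta>)))) =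
        G2 y * (\<Sum>\<^sub>\<infinity>m. G1 m * nome (of_real (\<omega> m * (of_int y + \<beta>))))"
      unfolding mult.assoc by (rule infsum_cmult_right')
    show ?thesis unfolding 1 2 3 4 by (simp only: mult.left_commute)
  qed
  \<comment> \<open>The mixed sum, Poisson-transformed in one variable only, is absolutely
    convergent as a product of two Gaussians, the remaining factor having norm 1. This justifies the
    exchange of summations.\<close>
  have sumH: "(\<lambda>(y, m). G2 y * G1 m * nome (of_real (\<omega> m * (of_int y + \<beta>)))) summable_on UNIV \<times> UNIV"
  proof (rule abs_summable_summable)
    have "(\<lambda>(y::int, m::int). exp (- (pi * s2) * (of_int y + \<beta>)^2) * exp (- (pi / s1) * (of_int m + 0)^2)) summable_on UNIV"
      by (intro summable_on_product_nonneg summable_on_exp_minus_shifted_square) (use s1 s2 in auto)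
    then show "(\<lambda>x. norm (case x of (y, m) \<Rightarrow> G2 y * G1 m * nome (of_real (\<omega> m * (of_int y + \<beta>))))) summable_on UNIV \<times> UNIV"
      by (simp add: case_prod_unfold norm_mult G1_def G2_def flip: of_real_mult)
  qed
  have sumy: "(\<Sum>\<^sub>\<infinity>y. G2 y * G1 m * nome (of_real (\<omega> m * (of_int y + \<beta>)))) = of_real (1 / sqrt s2) * (\<Sum>\<^sub>\<infinity>n. R m n)" for m
  proof -
    have 1: "(\<Sum>\<^sub>\<infinity>y. G2 y * G1 m * nome (of_real (\<omega> m * (of_int y + \<beta>)))) =
       G1 m * (\<Sum>\<^sub>\<infinity>y::int. of_real (exp (- pi * s2 * (of_int y + \<beta>)^2)) * nome (of_real (\<omega> m * (of_int y + \<beta>))))"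
      unfolding G2_def mult.commute[of _ "G1 m"] mult.assoc by (rule infsum_cmult_right')
    have 2: "G1 m * (of_real (exp (- pi * (of_int n - \<omega> m)^2 / s2)) * nome (of_real (of_int n * \<beta>))) = R m n" for n :: int
    proof -
      have "(of_int m)^2 / s1 + (of_int n - \<omega> m)^2 / s2 = (2 / (t * \<Delta>)) * (\<Delta> * (of_int m)^2 / (4 * A) + A * (of_int n - \<omega> m)^2)"
        using A \<Delta> t by (simp add: s1_def s2_def field_simps)
      also have "\<Delta> * (of_int m)^2 / (4 * A) + A * (of_int n - \<omega> m)^2 = A * (of_int n)^2 - B * of_int n * of_int m + C * (of_int m)^2"
        using A unfolding \<omega>_def \<Delta>_def by (simp add: field_simps power2_eq_square)
      finally have q: "(of_int m)^2 / s1 + (of_int n - \<omega> m)^2 / s2 =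
          (2 / (t * \<Delta>)) * (A * (of_int n)^2 - B * of_int n * of_int m + C * (of_int m)^2)" .
      have "- pi * (of_int m)^2 / s1 + - pi * (of_int n - \<omega> m)^2 / s2 =
          - pi * ((of_int m)^2 / s1 + (of_int n - \<omega> m)^2 / s2)"
        by (simp add: algebra_simps)
      also have "\<dots> = - (2 * pi / (t * \<Delta>)) * (A * (of_int n)^2 - B * of_int n * of_int m + C * (of_int m)^2)"
        unfolding q by simp
      finally have q2: "- pi * (of_int m)^2 / s1 + - pi * (of_int n - \<omega> m)^2 / s2 =
          - (2 * pi / (t * \<Delta>)) * (A * (of_int n)^2 - B * of_int n * of_int m + C * (of_int m)^2)" .
      have e: "exp (- (2 * pi / (t * \<Delta>)) * (A * (of_int n)^2 - B * of_int n * of_int m + C * (of_int m)^2)) =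
          exp (- pi * (of_int m)^2 / s1) * exp (- pi * (of_int n - \<omega> m)^2 / s2)"
        by (simp only: q2[symmetric] exp_add)
      show ?thesis
        unfolding R_def G1_def e of_real_mult[of "exp _"] of_real_add[of "of_int m * \<alpha>"] nome_add
        by (simp only: mult_ac)
    qed
    show ?thesis
      unfolding 1 poisson_gaussian[OF s2] mult.left_commute[of "G1 m"]
      by (subst infsum_cmult_right'[symmetric]) (simp only: 2)
  qed
  have "(\<Sum>\<^sub>\<infinity>(x, y). E x y) = (\<Sum>\<^sub>\<infinity>x. \<Sum>\<^sub>\<infinity>y. E x y)"
    using infsum_Sigma'_banach[of E UNIV "\<lambda>_. UNIV"] sumE by simp
  also have "\<dots> = (\<Sum>\<^sub>\<infinity>y. \<Sum>\<^sub>\<infinity>x. E x y)"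
    by (rule infsum_swap_banach) (use sumE in simp)
  also have "\<dots> = of_real (1 / sqrt s1) * (\<Sum>\<^sub>\<infinity>y. \<Sum>\<^sub>\<infinity>m. G2 y * G1 m * nome (of_real (\<omega> m * (of_int y + \<beta>))))"
    unfolding sumx by (rule infsum_cmult_right')
  also have "(\<Sum>\<^sub>\<infinity>y. \<Sum>\<^sub>\<infinity>m. G2 y * G1 m * nome (of_real (\<omega> m * (of_int y + \<beta>)))) =
      (\<Sum>\<^sub>\<infinity>m. \<Sum>\<^sub>\<infinity>y. G2 y * G1 m * nome (of_real (\<omega> m * (of_int y + \<beta>))))"
    by (rule infsum_swap_banach[OF sumH])
  also have "\<dots> = of_real (1 / sqrt s2) * (\<Sum>\<^sub>\<infinity>m. \<Sum>\<^sub>\<infinity>n. R m n)"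
    unfolding sumy by (rule infsum_cmult_right')
  also have "(\<Sum>\<^sub>\<infinity>m. \<Sum>\<^sub>\<infinity>n. R m n) = (\<Sum>\<^sub>\<infinity>(m, n). R m n)"
    using infsum_Sigma'_banach[of R UNIV "\<lambda>_. UNIV"] sumR by simp
  also have "complex_of_real (1 / sqrt s1) * (of_real (1 / sqrt s2) * X) = of_real (1 / (t * sqrt \<Delta>)) * X" for X
  proof -
    have "sqrt s1 * sqrt s2 = sqrt (t^2 * \<Delta>)"
      unfolding real_sqrt_mult[symmetric] s1_def s2_def using A by (simp add: power2_eq_square)
    also have "\<dots> = t * sqrt \<Delta>" using t by (simp add: real_sqrt_mult)
    finally have "1 / sqrt s1 * (1 / sqrt s2) = 1 / (t * sqrt \<Delta>)" by simp
    then show ?thesis by (simp only: mult.assoc[symmetric] of_real_mult[symmetric])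
  qed
  finally show ?thesis unfolding E_def R_def .
qed

section \<open>Weighted theta series\<close>

text \<open>The weight accommodates both the indicator of a coset of \<open>d \<int>^2\<close> and
  the additive characters modulo \<open>d\<close>, which inversion exchanges.\<close>

definition weighted_theta :: "(int \<Rightarrow> int \<Rightarrow> complex) \<Rightarrow> bqf \<Rightarrow> complex \<Rightarrow> complex" where
  "weighted_theta \<psi> Q z = (\<Sum>\<^sub>\<infinity>(x, y). \<psi> x y * nome (of_int (bqf_eval Q x y) * z))"

lemma theta_eq_weighted_theta: "theta Q z = weighted_theta (\<lambda>_ _. 1) Q z"
  by (simp add: theta_def weighted_theta_def nome_of_int_mult)

lemma of_int_bqf_eval:
  "of_int (bqf_eval Q x y) = of_int (coeff_a Q) * (of_int x)^2 + of_int (coeff_b Q) * of_int x * of_int y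
    + of_int (coeff_c Q) * (of_int y)^2"
  by (simp add: bqf_eval_def)

lemma of_int_bqf_disc:
  "4 * of_int (coeff_a Q) * of_int (coeff_c Q) - (of_int (coeff_b Q))^2 = - (of_int (bqf_disc Q) :: real)"
  by (simp add: bqf_disc_def)

lemma summable_on_exp_minus_bqf:
  fixes a :: real
  assumes "coeff_a Q > 0" "bqf_disc Q < 0" "a > 0"
  shows "(\<lambda>(x, y). exp (- a * of_int (bqf_eval Q x y))) summable_on UNIV"
  using summable_on_exp_minus_pos_def_form[of "of_int (coeff_a Q)" "of_int (coeff_c Q)" "of_int (coeff_b Q)" a 0 0] assms
  unfolding of_int_bqf_eval of_int_bqf_disc by simp

lemma bqf_eval_nonneg:
  assumes "coeff_a Q > 0" "bqf_disc Q < 0"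
  shows "bqf_eval Q x y \<ge> 0"
proof -
  have "4 * coeff_a Q * bqf_eval Q x y = (2 * coeff_a Q * x + coeff_b Q * y)^2 + (- bqf_disc Q) * y^2"
    by (simp add: bqf_eval_def bqf_disc_def power2_eq_square algebra_simps)
  also have "\<dots> \<ge> 0"
    using assms(2) by (intro add_nonneg_nonneg mult_nonneg_nonneg) auto
  finally show ?thesis using assms(1) by (simp add: zero_le_mult_iff)
qed

lemma weighted_theta_term_bound:
  assumes "coeff_a Q > 0" "bqf_disc Q < 0" "norm (\<psi> x y) \<le> 1" "Im z \<ge> \<epsilon>"
  shows "norm (\<psi> x y * nome (of_int (bqf_eval Q x y) * z)) \<le> exp (- (2 * pi * \<epsilon>) * of_int (bqf_eval Q x y))"
proof -
  have "norm (\<psi> x y * nome (of_int (bqf_eval Q x y) * z)) \<le> 1 * exp (- 2 * pi * (of_int (bqf_eval Q x y) * Im z))"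
    unfolding norm_mult norm_nome using assms(3) by (intro mult_mono) auto
  also have "\<dots> \<le> exp (- (2 * pi * \<epsilon>) * of_int (bqf_eval Q x y))"
  proof -
    have "of_int (bqf_eval Q x y) * \<epsilon> \<le> of_int (bqf_eval Q x y) * Im z"
      using bqf_eval_nonneg[OF assms(1,2)] assms(4) by (intro mult_left_mono) auto
    from mult_left_mono[OF this, of "2 * pi"] show ?thesis by (simp add: mult_ac)
  qed
  finally show ?thesis .
qed

lemma summable_on_weighted_theta:
  assumes "coeff_a Q > 0" "bqf_disc Q < 0" "\<And>x y. norm (\<psi> x y) \<le> 1" "Im z > 0"
  shows "(\<lambda>(x, y). norm (\<psi> x y * nome (of_int (bqf_eval Q x y) * z))) summable_on UNIV"
proof (rule summable_on_comparison_test)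
  show "(\<lambda>(x, y). exp (- (2 * pi * Im z) * of_int (bqf_eval Q x y))) summable_on UNIV"
    using assms by (intro summable_on_exp_minus_bqf) auto
qed (use weighted_theta_term_bound[where \<psi> = \<psi>, OF assms(1,2,3)] in auto)

lemma upper_half_plane_open: "open upper_half_plane"
  unfolding upper_half_plane_def by (rule open_halfspace_Im_gt)

lemma upper_half_plane_convex: "convex upper_half_plane"
  unfolding upper_half_plane_def by (rule convex_halfspace_Im_gt)

text \<open>On the closed disc of radius \<open>Im z / 2\<close> around \<open>z\<close> the
  imaginary part is at least \<open>Im z / 2\<close>, which gives a common majorant and hence
  uniform convergence.\<close>

lemma holomorphic_weighted_theta:
  assumes Q: "coeff_a Q > 0" "bqf_disc Q < 0" and \<psi>: "\<And>x y. norm (\<psi> x y) \<le> 1"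
  shows "weighted_theta \<psi> Q holomorphic_on upper_half_plane"
proof -
  have "weighted_theta \<psi> Q field_differentiable (at z)" if "z \<in> upper_half_plane" for z
  proof -
    define \<epsilon> where "\<epsilon> = Im z / 2"
    have \<epsilon>: "\<epsilon> > 0" using that by (simp add: \<epsilon>_def upper_half_plane_def)
    have Im: "Im u \<ge> \<epsilon>" if "u \<in> cball z \<epsilon>" for u
      using that abs_Im_le_cmod[of "z - u"] by (auto simp: dist_norm \<epsilon>_def)
    have "uniform_limit (cball z \<epsilon>)
      (\<lambda>X u. \<Sum>p\<in>X. case p of (x, y) \<Rightarrow> \<psi> x y * nome (of_int (bqf_eval Q x y) * u))
      (\<lambda>u. \<Sum>\<^sub>\<infinity>p. case p of (x, y) \<Rightarrow> \<psi> x y * nome (of_int (bqf_eval Q x y) * u)) (finite_subsets_at_top UNIV)"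
    proof (rule Weierstrass_m_test_general)
      show "(\<lambda>(x, y). exp (- (2 * pi * \<epsilon>) * of_int (bqf_eval Q x y))) summable_on UNIV"
        using Q \<epsilon> by (intro summable_on_exp_minus_bqf) auto
    qed (use weighted_theta_term_bound[where \<psi> = \<psi>, OF Q \<psi>] Im in \<open>auto split: prod.splits\<close>)
    then have u: "uniform_limit (cball z \<epsilon>)
      (\<lambda>X u. \<Sum>p\<in>X. case p of (x, y) \<Rightarrow> \<psi> x y * nome (of_int (bqf_eval Q x y) * u))
      (weighted_theta \<psi> Q) (finite_subsets_at_top UNIV)"
      unfolding weighted_theta_def[abs_def] .
    have hol: "(\<lambda>u. case p of (x, y) \<Rightarrow> \<psi> x y * nome (of_int (bqf_eval Q x y) * u)) holomorphic_on S" for p S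
      by (cases p) (auto intro!: holomorphic_intros)
    have "\<forall>\<^sub>F X in finite_subsets_at_top UNIV.
      continuous_on (cball z \<epsilon>) (\<lambda>u. \<Sum>p\<in>X. case p of (x, y) \<Rightarrow> \<psi> x y * nome (of_int (bqf_eval Q x y) * u)) \<and>
      (\<lambda>u. \<Sum>p\<in>X. case p of (x, y) \<Rightarrow> \<psi> x y * nome (of_int (bqf_eval Q x y) * u)) holomorphic_on ball z \<epsilon>"
      by (intro always_eventually allI conjI holomorphic_on_imp_continuous_on[OF holomorphic_on_sum] holomorphic_on_sum hol)
    from holomorphic_uniform_limit[OF this u finite_subsets_at_top_neq_bot]
    have "weighted_theta \<psi> Q holomorphic_on ball z \<epsilon>" by blast
    then show ?thesis
      using \<epsilon> by (intro holomorphic_on_imp_differentiable_at[of _ "ball z \<epsilon>"]) auto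
  qed
  then show ?thesis
    by (auto simp: holomorphic_on_def intro: field_differentiable_at_within)
qed

text \<open>Poisson summation was shown for real Gaussian parameters, that is on the imaginary axis;
  the identity theorem carries the formulas to the half-plane.\<close>

lemma holomorphic_eq_on_upper_half_plane:
  assumes "f holomorphic_on upper_half_plane" "g holomorphic_on upper_half_plane"
    and eq: "\<And>t. t > 0 \<Longrightarrow> f (\<i> * of_real t) = g (\<i> * of_real t)"
    and "z \<in> upper_half_plane"
  shows "f z = g z"
proof -
  have lim: "\<i> islimpt (\<lambda>t. \<i> * of_real t) ` {0<..}"
    unfolding islimpt_approachable
  proof (intro allI impI)
    fix e :: real assume "e > 0"
    then show "\<exists>x'\<in>(\<lambda>t. \<i> * of_real t) ` {0<..}. x' \<noteq> \<i> \<and> dist x' \<i> < e"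
      by (intro bexI[of _ "\<i> * of_real (1 + e / 2)"])
         (auto simp: dist_norm complex_eq_iff cmod_def algebra_simps)
  qed
  have "f z - g z = 0"
  proof (rule analytic_continuation[of "\<lambda>z. f z - g z" upper_half_plane "(\<lambda>t. \<i> * of_real t) ` {0<..}" \<i>])
    show "(\<lambda>z. f z - g z) holomorphic_on upper_half_plane"
      using assms by (intro holomorphic_intros)
    show "connected upper_half_plane" by (rule convex_connected[OF upper_half_plane_convex])
  qed (use assms(3,4) lim in \<open>auto simp: upper_half_plane_open, auto simp: upper_half_plane_def\<close>)
  then show ?thesis by simp
qed

text \<open>The coset is \<open>d\<close> times a lattice shifted by
  \<open>(g1 / d, g2 / d)\<close>. The dual sum involves the adjugate form, which the rotation
  \<open>(m, n) \<mapsto> (n, - m)\<close> turns back into \<open>Q\<close>; this is why the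
  character carries the alternating pairing \<open>x g2 - y g1\<close>.\<close>

lemma weighted_theta_coset_inversion_imaginary:
  fixes d g1 g2 :: int and t :: real
  assumes Q: "coeff_a Q > 0" and D: "bqf_disc Q = - D" "D > 0" and d: "d > 0" and t: "t > 0"
  shows "weighted_theta (\<lambda>x y. of_bool (d dvd x - g1 \<and> d dvd y - g2)) Q (\<i> * of_real t) =
    of_real (1 / (t * of_int (d^2) * sqrt (of_int D))) *
    weighted_theta (\<lambda>x y. nome (of_real (of_int (x * g2 - y * g1) / of_int d))) Q
      (\<i> / of_real (of_int (d^2) * of_int D * t))"
proof -
  let ?A = "of_int (coeff_a Q) :: real" and ?B = "of_int (coeff_b Q) :: real" and ?C = "of_int (coeff_c Q) :: real"
  let ?\<alpha> = "of_int g1 / of_int d :: real" and ?\<beta> = "of_int g2 / of_int d :: real"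
  define t' where "t' = t * (of_int d)^2"
  have t': "t' > 0" using t d by (simp add: t'_def)
  have disc: "4 * ?A * ?C - ?B^2 = of_int D"
    using D by (simp add: of_int_bqf_disc)
  let ?h = "\<lambda>(x, y). (g1 + d * x, g2 + d * y)"
  have inj: "inj ?h" using d by (auto simp: inj_on_def)
  have "weighted_theta (\<lambda>x y. of_bool (d dvd x - g1 \<and> d dvd y - g2)) Q (\<i> * of_real t) =
    (\<Sum>\<^sub>\<infinity>(x, y)\<in>range ?h. nome (of_int (bqf_eval Q x y) * (\<i> * of_real t)))"
    unfolding weighted_theta_def
  proof (rule infsum_cong_neutral)
    fix p assume "p \<in> range ?h - UNIV" then show "(case p of (x, y) \<Rightarrow> nome (of_int (bqf_eval Q x y) * (\<i> * of_real t))) = 0" by auto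
  next
    fix p assume "p \<in> UNIV - range ?h"
    moreover obtain x y where p: "p = (x, y)" by (cases p)
    moreover have "(x, y) \<in> range ?h" if "d dvd x - g1" "d dvd y - g2"
    proof -
      obtain u v where "x - g1 = d * u" "y - g2 = d * v" using \<open>d dvd x - g1\<close> \<open>d dvd y - g2\<close> by (auto elim!: dvdE)
      then have "(x, y) = ?h (u, v)" by auto
      then show ?thesis by (rule range_eqI)
    qed
    ultimately show "(case p of (x, y) \<Rightarrow> of_bool (d dvd x - g1 \<and> d dvd y - g2) * nome (of_int (bqf_eval Q x y) * (\<i> * of_real t))) = 0"
      by auto
  qed auto
  also have "\<dots> = (\<Sum>\<^sub>\<infinity>(x, y). nome (of_int (bqf_eval Q (g1 + d * x) (g2 + d * y)) * (\<i> * of_real t)))"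
    by (subst infsum_reindex[OF inj]) (simp add: o_def case_prod_unfold)
  also have "\<dots> = (\<Sum>\<^sub>\<infinity>(x::int, y::int). complex_of_real (exp (- (2 * pi * t') *
      (?A * (of_int x + ?\<alpha>)^2 + ?B * (of_int x + ?\<alpha>) * (of_int y + ?\<beta>) + ?C * (of_int y + ?\<beta>)^2))))"
  proof (intro infsum_cong, safe)
    fix x y :: int
    have 1: "of_int (g1 + d * x) = of_int d * (of_int x + ?\<alpha>)" "of_int (g2 + d * y) = of_int d * (of_int y + ?\<beta>)"
      using d by (simp_all add: field_simps)
    have "of_int (bqf_eval Q (g1 + d * x) (g2 + d * y)) * t = t' *
      (?A * (of_int x + ?\<alpha>)^2 + ?B * (of_int x + ?\<alpha>) * (of_int y + ?\<beta>) + ?C * (of_int y + ?\<beta>)^2)"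
    proof -
      have "(?A * (of_int d * X)^2 + ?B * (of_int d * X) * (of_int d * Y) + ?C * (of_int d * Y)^2) * t =
          t * (of_int d)^2 * (?A * X^2 + ?B * X * Y + ?C * Y^2)" for X Y
        by (simp add: algebra_simps power2_eq_square)
      then show ?thesis unfolding of_int_bqf_eval 1 t'_def .
    qed
    moreover have "nome (of_int n * (\<i> * of_real t)) = complex_of_real (exp (- (2 * pi) * (of_int n * t)))" for n
      unfolding nome_def exp_of_real[symmetric] by (simp add: mult_ac)
    ultimately show "nome (of_int (bqf_eval Q (g1 + d * x) (g2 + d * y)) * (\<i> * of_real t)) = complex_of_real (exp (- (2 * pi * t') *
      (?A * (of_int x + ?\<alpha>)^2 + ?B * (of_int x + ?\<alpha>) * (of_int y + ?\<beta>) + ?C * (of_int y + ?\<beta>)^2)))"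
      by (simp only: mult.assoc mult_minus_left)
  qed
  also have "\<dots> = of_real (1 / (t' * sqrt (of_int D))) *
    (\<Sum>\<^sub>\<infinity>(m::int, n::int). of_real (exp (- (2 * pi / (t' * of_int D)) * (?A * (of_int n)^2 - ?B * of_int n * of_int m + ?C * (of_int m)^2))) *
      nome (of_real (of_int m * ?\<alpha> + of_int n * ?\<beta>)))"
    using poisson_gaussian_2d[of ?A ?C ?B t' ?\<alpha> ?\<beta>] Q D t' unfolding disc by simp
  also have "(\<Sum>\<^sub>\<infinity>(m::int, n::int). of_real (exp (- (2 * pi / (t' * of_int D)) * (?A * (of_int n)^2 - ?B * of_int n * of_int m + ?C * (of_int m)^2))) *
      nome (of_real (of_int m * ?\<alpha> + of_int n * ?\<beta>))) =
      weighted_theta (\<lambda>x y. nome (of_real (of_int (x * g2 - y * g1) / of_int d))) Q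
      (\<i> / of_real (of_int (d^2) * of_int D * t))"
    unfolding weighted_theta_def
  proof (rule infsum_reindex_bij_witness[where i = "\<lambda>(x, y). (- y, x)" and j = "\<lambda>(m, n). (n, - m)"])
    fix p :: "int \<times> int"
    obtain m n where p: "p = (m, n)" by (cases p)
    have 1: "of_int m * ?\<alpha> + of_int n * ?\<beta> = of_int (n * g2 - (- m) * g1) / of_int d"
      using d by (simp add: field_simps)
    have 2: "nome (of_int k * (\<i> / of_real (of_int (d^2) * of_int D * t))) = of_real (exp (- (2 * pi / (t' * of_int D)) * of_int k))" for k
      unfolding nome_def exp_of_real[symmetric] t'_def by (simp add: mult_ac)
    have 3: "?A * (of_int n)^2 - ?B * of_int n * of_int m + ?C * (of_int m)^2 = of_int (bqf_eval Q n (- m))"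
      by (simp add: of_int_bqf_eval)
    show "(case (case p of (m, n) \<Rightarrow> (n, - m)) of (x, y) \<Rightarrow> nome (of_real (of_int (x * g2 - y * g1) / of_int d)) *
        nome (of_int (bqf_eval Q x y) * (\<i> / of_real (of_int (d^2) * of_int D * t)))) =
      (case p of (m, n) \<Rightarrow> of_real (exp (- (2 * pi / (t' * of_int D)) * (?A * (of_int n)^2 - ?B * of_int n * of_int m + ?C * (of_int m)^2))) *
      nome (of_real (of_int m * ?\<alpha> + of_int n * ?\<beta>)))"
      unfolding p prod.case 1 2 3 by (rule mult.commute)
  qed auto
  finally show ?thesis by (simp add: t'_def)
qed

theorem weighted_theta_coset_inversion:
  fixes d g1 g2 :: int
  assumes Q: "coeff_a Q > 0" and D: "bqf_disc Q = - D" "D > 0" and d: "d > 0" and z: "z \<in> upper_half_plane"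
  shows "weighted_theta (\<lambda>x y. of_bool (d dvd x - g1 \<and> d dvd y - g2)) Q z =
    \<i> / (z * of_int (d^2) * of_real (sqrt (of_int D))) *
    weighted_theta (\<lambda>x y. nome (of_real (of_int (x * g2 - y * g1) / of_int d))) Q (- 1 / (of_int (d^2 * D) * z))"
    (is "?f z = ?g z")
proof (rule holomorphic_eq_on_upper_half_plane[OF _ _ _ z])
  have Q2: "bqf_disc Q < 0" using D by simp
  show "?f holomorphic_on upper_half_plane"
    by (rule holomorphic_weighted_theta[OF Q Q2]) simp
  have nz: "z \<noteq> 0" if "z \<in> upper_half_plane" for z
    using that by (auto simp: upper_half_plane_def)
  have c: "(of_int (d^2 * D) :: complex) \<noteq> 0" "real_of_int (d^2 * D) > 0" using d D by auto
  have "(\<lambda>z. weighted_theta (\<lambda>x y. nome (of_real (of_int (x * g2 - y * g1) / of_int d))) Q (- 1 / (of_int (d^2 * D) * z)))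
      holomorphic_on upper_half_plane"
  proof (rule holomorphic_on_compose_gen[OF _ holomorphic_weighted_theta[OF Q Q2], unfolded o_def])
    show "(\<lambda>z. - 1 / (of_int (d^2 * D) * z)) holomorphic_on upper_half_plane"
      using nz c by (intro holomorphic_intros) auto
    have "Im (- 1 / (of_real r * z)) > 0" if "r > 0" "Im z > 0" for r z
    proof -
      have "z \<noteq> 0" using that by auto
      then show ?thesis using that by (simp add: Im_divide')
    qed
    then show "(\<lambda>z. - 1 / (of_int (d^2 * D) * z)) ` upper_half_plane \<subseteq> upper_half_plane"
      using c(2) unfolding upper_half_plane_def by (metis (no_types, lifting) image_subsetI mem_Collect_eq of_real_of_int_eq)
  qed (simp only: norm_nome_of_real order_refl)
  then show "?g holomorphic_on upper_half_plane"
    using nz d D by (intro holomorphic_intros) auto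
  show "?f (\<i> * of_real t) = ?g (\<i> * of_real t)" if "t > 0" for t
  proof -
    have "- 1 / (of_int (d^2 * D) * (\<i> * of_real t)) = \<i> / of_real (of_int (d^2) * of_int D * t)"
      using c that by (simp add: field_simps)
    moreover have "\<i> / (\<i> * of_real t * of_int (d^2) * of_real (sqrt (of_int D))) = of_real (1 / (t * of_int (d^2) * sqrt (of_int D)))"
      using c that by (simp add: field_simps)
    ultimately show ?thesis
      using weighted_theta_coset_inversion_imaginary[OF Q D d that, of g1 g2] by (simp only:)
  qed
qed

section \<open>Gauss sums\<close>

definition root_of_unity :: "int \<Rightarrow> int \<Rightarrow> complex" where
  "root_of_unity d n = nome (of_real (of_int n / of_int d))"

lemma root_of_unity_0 [simp]: "root_of_unity d 0 = 1"
  by (simp add: root_of_unity_def)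

lemma root_of_unity_add: "root_of_unity d (m + n) = root_of_unity d m * root_of_unity d n"
  by (simp add: root_of_unity_def add_divide_distrib nome_add)

lemma norm_root_of_unity [simp]: "norm (root_of_unity d n) = 1"
  unfolding root_of_unity_def by (rule norm_nome_of_real)

lemma root_of_unity_multiple: "d \<noteq> 0 \<Longrightarrow> root_of_unity d (d * n) = 1"
  by (simp add: root_of_unity_def)

lemma root_of_unity_cong:
  assumes "d \<noteq> 0" "[m = n] (mod d)"
  shows "root_of_unity d m = root_of_unity d n"
proof -
  from assms(2) obtain k where "m = n + d * k"
    by (metis cong_iff_lin cong_sym)
  then show ?thesis using root_of_unity_multiple[OF assms(1)] by (simp add: root_of_unity_add)
qed

abbreviation residue_box :: "int \<Rightarrow> (int \<times> int) set" where
  "residue_box d \<equiv> {0..<d} \<times> {0..<d}"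

text \<open>On a finite box injectivity modulo \<open>d\<close> already makes the substitution a
  permutation, so no inverse has to be exhibited in its applications.\<close>

lemma sum_residue_box_reindex:
  fixes f :: "int \<Rightarrow> int \<Rightarrow> 'a::comm_monoid_add"
  assumes d: "d > 0" and per: "\<And>x y. f (x mod d) (y mod d) = f x y"
    and inj: "\<And>x y x' y'. \<lbrakk>[S x y = S x' y'] (mod d); [T x y = T x' y'] (mod d)\<rbrakk>
      \<Longrightarrow> [x = x'] (mod d) \<and> [y = y'] (mod d)"
  shows "(\<Sum>(x, y)\<in>residue_box d. f (S x y) (T x y)) = (\<Sum>(x, y)\<in>residue_box d. f x y)"
proof -
  define h where "h = (\<lambda>(x, y). (S x y mod d, T x y mod d))"
  have "inj_on h (residue_box d)"
  proof (rule inj_onI, safe)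
    fix x y x' y' assume "x \<in> {0..<d}" "y \<in> {0..<d}" "x' \<in> {0..<d}" "y' \<in> {0..<d}" "h (x, y) = h (x', y')"
    then have "[x = x'] (mod d) \<and> [y = y'] (mod d)"
      by (intro inj) (auto simp: h_def cong_def)
    then show "x = x'" "y = y'"
      using \<open>x \<in> {0..<d}\<close> \<open>y \<in> {0..<d}\<close> \<open>x' \<in> {0..<d}\<close> \<open>y' \<in> {0..<d}\<close> by (auto simp: cong_def)
  qed
  moreover have "h ` residue_box d \<subseteq> residue_box d"
    using d by (auto simp: h_def)
  ultimately have "bij_betw h (residue_box d) (residue_box d)"
    by (intro bij_betw_imageI endo_inj_surj) auto
  from sum.reindex_bij_betw[OF this, of "\<lambda>(x, y). f x y"] show ?thesis
    by (simp add: h_def case_prod_unfold per)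
qed

definition form_gauss_sum :: "bqf \<Rightarrow> int \<Rightarrow> int \<Rightarrow> complex" where
  "form_gauss_sum Q b d = (\<Sum>(x, y)\<in>residue_box d. root_of_unity d (b * bqf_eval Q x y))"

lemma bqf_eval_cong:
  "[x = x'] (mod d) \<Longrightarrow> [y = y'] (mod d) \<Longrightarrow> [bqf_eval Q x y = bqf_eval Q x' y'] (mod d)"
  unfolding bqf_eval_def by (intro cong_add cong_mult cong_pow cong_refl)

lemma root_of_unity_bqf_eval_mod:
  "d > 0 \<Longrightarrow> root_of_unity d (b * bqf_eval Q (x mod d) (y mod d)) = root_of_unity d (b * bqf_eval Q x y)"
  by (intro root_of_unity_cong cong_mult cong_refl bqf_eval_cong) (auto simp: cong_def)

text \<open>Completing the square modulo \<open>d\<close>: the shift is \<open>-c'\<close> times the adjugate of the Gram matrix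
  applied to \<open>(-y, x)\<close>.\<close>

lemma form_gauss_sum_linear_term:
  assumes d: "d > 0" and det: "a * d - b * (c' * D) = 1" and D: "bqf_disc Q = - D"
  shows "(\<Sum>(g1, g2)\<in>residue_box d. root_of_unity d (b * bqf_eval Q g1 g2 + (x * g2 - y * g1))) =
    root_of_unity d (c' * bqf_eval Q x y) * form_gauss_sum Q b d"
proof -
  obtain A B C where Q: "Q = BQF A B C" by (cases Q)
  define s where "s = c' * (2 * C * y + B * x)"
  define r where "r = - c' * (B * y + 2 * A * x)"
  have eq: "[b * bqf_eval Q g1 g2 + (x * g2 - y * g1) = c' * bqf_eval Q x y + b * bqf_eval Q (g1 + s) (g2 + r)] (mod d)"
    for g1 g2
  proof -
    have D': "D = 4 * A * C - B^2" using D by (simp add: Q bqf_disc_def)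
    have "bqf_eval Q (g1 + s) (g2 + r) - bqf_eval Q g1 g2 =
        c' * D * (c' * bqf_eval Q x y - (x * g2 - y * g1))"
      unfolding Q bqf_eval_def s_def r_def D' by (simp add: algebra_simps power2_eq_square)
    \<comment> \<open>Multiplication by \<open>b\<close> turns the factor \<open>c' D\<close> into
      \<open>b c' D = a d - 1\<close>, which is \<open>-1\<close> modulo \<open>d\<close>.\<close>
    then have "b * (bqf_eval Q (g1 + s) (g2 + r) - bqf_eval Q g1 g2) =
        (b * (c' * D)) * (c' * bqf_eval Q x y - (x * g2 - y * g1))" by simp
    also have "b * (c' * D) = a * d - 1" using det by simp
    finally have "b * bqf_eval Q g1 g2 + (x * g2 - y * g1) - (c' * bqf_eval Q x y + b * bqf_eval Q (g1 + s) (g2 + r)) =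
        d * (- a * (c' * bqf_eval Q x y - (x * g2 - y * g1)))"
      by (simp add: algebra_simps)
    then show ?thesis unfolding cong_iff_dvd_diff by (metis dvd_triv_left)
  qed
  have "(\<Sum>(g1, g2)\<in>residue_box d. root_of_unity d (b * bqf_eval Q g1 g2 + (x * g2 - y * g1))) =
    (\<Sum>(g1, g2)\<in>residue_box d. root_of_unity d (c' * bqf_eval Q x y) * root_of_unity d (b * bqf_eval Q (g1 + s) (g2 + r)))"
    by (intro sum.cong refl, clarify, subst root_of_unity_add[symmetric], rule root_of_unity_cong)
       (use d eq in auto)
  also have "\<dots> = root_of_unity d (c' * bqf_eval Q x y) *
      (\<Sum>(g1, g2)\<in>residue_box d. root_of_unity d (b * bqf_eval Q (g1 + s) (g2 + r)))"
    by (simp add: sum_distrib_left case_prod_unfold)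
  also have "(\<Sum>(g1, g2)\<in>residue_box d. root_of_unity d (b * bqf_eval Q (g1 + s) (g2 + r))) = form_gauss_sum Q b d"
    unfolding form_gauss_sum_def
    by (rule sum_residue_box_reindex[OF d]) (auto simp: root_of_unity_bqf_eval_mod d cong_add_rcancel)
  finally show ?thesis .
qed

section \<open>Transformation of theta series under \<open>\<Gamma>\<^sub>0(D)\<close>\<close>

lemma infsum_sum_swap:
  fixes f :: "'i \<Rightarrow> 'a \<Rightarrow> 'b::{topological_comm_monoid_add, t2_space}"
  assumes "finite I" "\<And>i. i \<in> I \<Longrightarrow> f i summable_on A"
  shows "(\<Sum>\<^sub>\<infinity>x\<in>A. \<Sum>i\<in>I. f i x) = (\<Sum>i\<in>I. \<Sum>\<^sub>\<infinity>x\<in>A. f i x)"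
    and "(\<lambda>x. \<Sum>i\<in>I. f i x) summable_on A"
proof -
  have *: "((\<lambda>x. \<Sum>i\<in>I. f i x) has_sum (\<Sum>i\<in>I. \<Sum>\<^sub>\<infinity>x\<in>A. f i x)) A"
    using assms
  proof (induction I rule: finite_induct)
    case (insert i I)
    have "(f i has_sum (\<Sum>\<^sub>\<infinity>x\<in>A. f i x)) A"
      using insert.prems by (intro has_sum_infsum) simp
    from has_sum_add[OF this insert.IH] insert show ?case by simp
  qed simp
  show "(\<Sum>\<^sub>\<infinity>x\<in>A. \<Sum>i\<in>I. f i x) = (\<Sum>i\<in>I. \<Sum>\<^sub>\<infinity>x\<in>A. f i x)"
    by (rule infsumI[OF *])
  show "(\<lambda>x. \<Sum>i\<in>I. f i x) summable_on A"
    by (rule has_sum_imp_summable[OF *])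
qed

lemma weighted_theta_sum:
  assumes Q: "coeff_a Q > 0" "bqf_disc Q < 0" and "finite I" and z: "z \<in> upper_half_plane"
    and \<psi>: "\<And>i x y. i \<in> I \<Longrightarrow> norm (\<psi> i x y) \<le> 1"
  shows "(\<Sum>i\<in>I. c i * weighted_theta (\<psi> i) Q z) = weighted_theta (\<lambda>x y. \<Sum>i\<in>I. c i * \<psi> i x y) Q z"
proof -
  have sm: "(\<lambda>(x, y). \<psi> i x y * nome (of_int (bqf_eval Q x y) * z)) summable_on UNIV" if "i \<in> I" for i
  proof (rule abs_summable_summable)
    have "(\<lambda>p. norm (case p of (x, y) \<Rightarrow> \<psi> i x y * nome (of_int (bqf_eval Q x y) * z))) =
        (\<lambda>(x, y). norm (\<psi> i x y * nome (of_int (bqf_eval Q x y) * z)))" by auto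
    then show "(\<lambda>p. norm (case p of (x, y) \<Rightarrow> \<psi> i x y * nome (of_int (bqf_eval Q x y) * z))) summable_on UNIV"
      using summable_on_weighted_theta[where \<psi> = "\<psi> i", OF Q \<psi>[OF that]] z
      by (simp only: upper_half_plane_def mem_Collect_eq)
  qed
  have "(\<Sum>i\<in>I. c i * weighted_theta (\<psi> i) Q z) =
      (\<Sum>i\<in>I. \<Sum>\<^sub>\<infinity>p. c i * (case p of (x, y) \<Rightarrow> \<psi> i x y * nome (of_int (bqf_eval Q x y) * z)))"
    unfolding weighted_theta_def by (simp only: infsum_cmult_right')
  also have "\<dots> = (\<Sum>\<^sub>\<infinity>p. \<Sum>i\<in>I. c i * (case p of (x, y) \<Rightarrow> \<psi> i x y * nome (of_int (bqf_eval Q x y) * z)))"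
    by (rule infsum_sum_swap(1)[symmetric]) (intro assms(3) summable_on_cmult_right sm)+
  also have "\<dots> = weighted_theta (\<lambda>x y. \<Sum>i\<in>I. c i * \<psi> i x y) Q z"
    unfolding weighted_theta_def
    by (intro infsum_cong) (simp add: case_prod_unfold sum_distrib_right mult.assoc)
  finally show ?thesis .
qed

lemma theta_inversion:
  assumes Q: "coeff_a Q > 0" and D: "bqf_disc Q = - D" "D > 0" and z: "z \<in> upper_half_plane"
  shows "theta Q z = \<i> / (z * of_real (sqrt (of_int D))) * theta Q (- 1 / (of_int D * z))"
  using weighted_theta_coset_inversion[OF Q D _ z, of 1 0 0] by (simp add: theta_eq_weighted_theta)

lemma moebius_in_upper_half_plane:
  fixes a b c d :: int
  assumes "a * d - b * c = 1" "z \<in> upper_half_plane"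
  shows "(of_int a * z + of_int b) / (of_int c * z + of_int d) \<in> upper_half_plane"
    and "of_int c * z + of_int d \<noteq> 0"
proof -
  have Im: "Im z > 0" using assms(2) by (simp add: upper_half_plane_def)
  show nz: "of_int c * z + of_int d \<noteq> 0"
  proof
    assume *: "of_int c * z + of_int d = 0"
    from arg_cong[OF this, of Im] have "of_int c * Im z = 0" by simp
    then have "c = 0" using Im by simp
    then show False using * assms(1) by simp
  qed
  have "Im ((of_int a * z + of_int b) / (of_int c * z + of_int d)) =
      (of_int (a * d - b * c) * Im z) / (cmod (of_int c * z + of_int d))^2"
    by (simp add: Im_divide' algebra_simps)
  also have "\<dots> > 0" using assms(1) Im nz by simp
  finally show "(of_int a * z + of_int b) / (of_int c * z + of_int d) \<in> upper_half_plane"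
    by (simp add: upper_half_plane_def)
qed

theorem theta_transformation_Gauss:
  fixes a b c c' d D :: int
  assumes Q: "coeff_a Q > 0" and D: "bqf_disc Q = - D" "D > 0" and z: "z \<in> upper_half_plane"
    and det: "a * d - b * c = 1" and c: "c = c' * D" and d: "d > 0"
  shows "theta Q ((of_int a * z + of_int b) / (of_int c * z + of_int d)) =
    (of_int c * z + of_int d) * (form_gauss_sum Q b d / of_int d) * theta Q z"
proof -
  have Q2: "bqf_disc Q < 0" using D by simp
  define J where "J = of_int c * z + of_int d"
  have J: "J \<noteq> 0" unfolding J_def by (rule moebius_in_upper_half_plane[OF det z])
  have z0: "z \<noteq> 0" using z by (auto simp: upper_half_plane_def)
  define \<tau> where "\<tau> = z / (of_int d * J)"
  have detC: "of_int a * of_int d = 1 + of_int b * (of_int c :: complex)"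
    using det by (metis add.commute diff_add_cancel of_int_1 of_int_add of_int_mult)
  have split: "(of_int a * z + of_int b) / J = of_int b / of_int d + \<tau>"
  proof -
    have "of_int b / of_int d + \<tau> = (of_int b * J + z) / (of_int d * J)"
      using J d by (simp add: \<tau>_def field_simps)
    also have "of_int b * J + z = of_int d * (of_int a * z + of_int b)"
      using detC unfolding J_def by (simp add: algebra_simps)
    finally show ?thesis using d by simp
  qed
  have \<tau>: "\<tau> \<in> upper_half_plane"
  proof -
    have "Im ((of_int a * z + of_int b) / J) > 0"
      using moebius_in_upper_half_plane(1)[OF det z] by (simp add: J_def upper_half_plane_def)
    moreover have "Im (of_int b / of_int d) = 0"
      by (metis Im_complex_of_real of_real_divide of_real_of_int_eq)
    ultimately show ?thesis unfolding split by (simp add: upper_half_plane_def)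
  qed
  \<comment> \<open>The point that coset inversion assigns to \<open>\<tau>\<close>. It is
    \<open>- 1 / (D z)\<close> translated by \<open>- c' / d\<close>, and the phase of this
    translation cancels the one produced by completing the square in the Gauss sum.\<close>
  define u where "u = - 1 / (of_int (d^2 * D) * \<tau>)"
  have u: "u = - (of_int c' / of_int d) + - 1 / (of_int D * z)"
    unfolding u_def \<tau>_def J_def c using d z0 D by (simp add: field_simps power2_eq_square)
  have u_in: "u \<in> upper_half_plane"
  proof -
    have "Im (- 1 / (of_int D * z)) > 0"
      using z D(2) z0 by (simp add: Im_divide' upper_half_plane_def)
    moreover have "Im (- (of_int c' / of_int d)) = 0"
      by (metis Im_complex_of_real of_real_divide of_real_of_int_eq of_real_minus)
    ultimately show ?thesis unfolding u by (simp add: upper_half_plane_def)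
  qed
  define \<kappa> where "\<kappa> = \<i> / (\<tau> * of_int (d^2) * of_real (sqrt (of_int D)))"
  have nome_b: "nome (of_int k * (of_int m / of_int d + v)) = root_of_unity d (m * k) * nome (of_int k * v)" for k m v
    by (simp add: root_of_unity_def distrib_left nome_add mult.commute)
  let ?I = "residue_box d"
  \<comment> \<open>The phase caused by the translation by \<open>b / d\<close> depends only on
    \<open>(x, y)\<close> modulo \<open>d\<close>, so the series splits into cosets.\<close>
  have "theta Q ((of_int a * z + of_int b) / J) =
      weighted_theta (\<lambda>x y. \<Sum>(g1, g2)\<in>?I. root_of_unity d (b * bqf_eval Q g1 g2) * of_bool (d dvd x - g1 \<and> d dvd y - g2)) Q \<tau>"
    unfolding split theta_eq_weighted_theta weighted_theta_def nome_b
  proof (intro infsum_cong, clarify)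
    fix x y
    have "(\<Sum>(g1, g2)\<in>?I. root_of_unity d (b * bqf_eval Q g1 g2) * of_bool (d dvd x - g1 \<and> d dvd y - g2)) =
      (\<Sum>(g1, g2)\<in>{(x mod d, y mod d)}. root_of_unity d (b * bqf_eval Q g1 g2))"
    proof (rule sum.mono_neutral_cong_right)
      show "\<forall>i\<in>?I - {(x mod d, y mod d)}.
        (case i of (g1, g2) \<Rightarrow> root_of_unity d (b * bqf_eval Q g1 g2) * of_bool (d dvd x - g1 \<and> d dvd y - g2)) = 0"
        by (auto simp: mod_eq_dvd_iff[symmetric])
    qed (use d in \<open>auto simp: mod_eq_dvd_iff[symmetric]\<close>)
    also have "\<dots> = root_of_unity d (b * bqf_eval Q x y)"
      using d by (simp add: root_of_unity_bqf_eval_mod)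
    finally show "1 * (root_of_unity d (b * bqf_eval Q x y) * nome (of_int (bqf_eval Q x y) * \<tau>)) =
      (\<Sum>(g1, g2)\<in>?I. root_of_unity d (b * bqf_eval Q g1 g2) * of_bool (d dvd x - g1 \<and> d dvd y - g2)) *
        nome (of_int (bqf_eval Q x y) * \<tau>)" by simp
  qed
  also have "\<dots> = (\<Sum>g\<in>?I. root_of_unity d (b * bqf_eval Q (fst g) (snd g)) *
      weighted_theta (\<lambda>x y. of_bool (d dvd x - fst g \<and> d dvd y - snd g)) Q \<tau>)"
    by (subst weighted_theta_sum[OF Q Q2 _ \<tau>]) (auto simp: case_prod_unfold)
  also have "\<dots> = (\<Sum>g\<in>?I. \<kappa> * (root_of_unity d (b * bqf_eval Q (fst g) (snd g)) *
      weighted_theta (\<lambda>x y. root_of_unity d (x * snd g - y * fst g)) Q u))"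
    unfolding weighted_theta_coset_inversion[OF Q D d \<tau>] \<kappa>_def[symmetric] u_def[symmetric] root_of_unity_def[symmetric]
    by (simp only: mult.left_commute)
  also have "\<dots> = \<kappa> * weighted_theta (\<lambda>x y. \<Sum>g\<in>?I. root_of_unity d (b * bqf_eval Q (fst g) (snd g)) *
      root_of_unity d (x * snd g - y * fst g)) Q u"
    unfolding sum_distrib_left[symmetric]
    by (subst weighted_theta_sum[OF Q Q2 _ u_in]) auto
  also have "weighted_theta (\<lambda>x y. \<Sum>g\<in>?I. root_of_unity d (b * bqf_eval Q (fst g) (snd g)) *
      root_of_unity d (x * snd g - y * fst g)) Q u = form_gauss_sum Q b d * theta Q (- 1 / (of_int D * z))"
  proof -
    have 1: "(\<Sum>g\<in>?I. root_of_unity d (b * bqf_eval Q (fst g) (snd g)) * root_of_unity d (x * snd g - y * fst g)) =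
        root_of_unity d (c' * bqf_eval Q x y) * form_gauss_sum Q b d" for x y
      using form_gauss_sum_linear_term[OF d det[unfolded c] D(1), of x y]
      by (simp add: case_prod_unfold root_of_unity_add)
    have 2: "root_of_unity d (c' * bqf_eval Q x y) * form_gauss_sum Q b d * nome (of_int (bqf_eval Q x y) * u) =
        form_gauss_sum Q b d * (1 * nome (of_int (bqf_eval Q x y) * (- 1 / (of_int D * z))))" for x y
    proof -
      have "u = of_int (- c') / of_int d + - 1 / (of_int D * z)" unfolding u by simp
      then have "nome (of_int (bqf_eval Q x y) * u) = root_of_unity d (- c' * bqf_eval Q x y) * nome (of_int (bqf_eval Q x y) * (- 1 / (of_int D * z)))"
        by (simp only: nome_b)
      moreover have "root_of_unity d (c' * bqf_eval Q x y) * root_of_unity d (- c' * bqf_eval Q x y) = 1"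
        by (simp flip: root_of_unity_add)
      ultimately show ?thesis by (simp only: mult.left_commute mult.assoc) (simp add: mult.assoc[symmetric])
    qed
    show ?thesis
      unfolding weighted_theta_def theta_eq_weighted_theta 1 2
      by (simp only: infsum_cmult_right'[symmetric] case_prod_unfold)
  qed
  also have "\<kappa> * (form_gauss_sum Q b d * theta Q (- 1 / (of_int D * z))) =
      J * (form_gauss_sum Q b d / of_int d) * (\<i> / (z * of_real (sqrt (of_int D))) * theta Q (- 1 / (of_int D * z)))"
    unfolding \<kappa>_def \<tau>_def using d D z0 J by (simp add: field_simps power2_eq_square)
  \<comment> \<open>A second inversion, now of the whole lattice, returns from
    \<open>- 1 / (D z)\<close> to \<open>z\<close>.\<close>
  also have "\<i> / (z * of_real (sqrt (of_int D))) * theta Q (- 1 / (of_int D * z)) = theta Q z"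
    using theta_inversion[OF Q D z] by simp
  finally show ?thesis unfolding J_def .
qed

section \<open>The Kronecker symbol\<close>

lemma kronecker_1 [simp]: "kronecker a 1 = 1"
  by (simp add: kronecker_def)

lemma kronecker_pos:
  "n > 0 \<Longrightarrow> kronecker a n = (\<Prod>p\<in>prime_factors n. kronecker_prime a p ^ multiplicity p n)"
  by (simp add: kronecker_def)

lemma kronecker_mult_pos:
  assumes "m > 0" "n > 0"
  shows "kronecker a (m * n) = kronecker a m * kronecker a n"
proof -
  let ?P = "prime_factors m \<union> prime_factors n"
  have ext: "(\<Prod>p\<in>prime_factors k. kronecker_prime a p ^ multiplicity p k) =
      (\<Prod>p\<in>?P. kronecker_prime a p ^ multiplicity p k)" if "k \<in> {m, n}" for k
    using that assms
    by (intro prod.mono_neutral_left) (auto simp: in_prime_factors_iff not_dvd_imp_multiplicity_0)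
  have mn: "m * n > 0" using assms by simp
  have "kronecker a (m * n) = (\<Prod>p\<in>?P. kronecker_prime a p ^ multiplicity p (m * n))"
    using assms kronecker_pos[OF mn] by (simp add: prime_factors_product)
  also have "\<dots> = (\<Prod>p\<in>?P. kronecker_prime a p ^ multiplicity p m * kronecker_prime a p ^ multiplicity p n)"
    using assms by (intro prod.cong refl) (auto simp: prime_elem_multiplicity_mult_distrib power_add in_prime_factors_iff)
  also have "\<dots> = kronecker a m * kronecker a n"
    unfolding prod.distrib using assms ext[of m] ext[of n] by (simp add: kronecker_def)
  finally show ?thesis .
qed

lemma kronecker_prime_eq:
  assumes "prime p"
  shows "kronecker a p = kronecker_prime a p"
proof -
  have "prime_factors p = {p}" using assms by (simp add: prime_prime_factors)
  moreover have "p > 0" using assms by (rule prime_gt_0_int)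
  ultimately show ?thesis using assms by (simp add: kronecker_def)
qed

text \<open>Needed to replace a matrix by its negative: in weight one the automorphy factor changes
  sign, so the character has to be odd.\<close>

lemma kronecker_neg:
  assumes "n > 0" "a < 0"
  shows "kronecker a (- n) = - kronecker a n"
proof -
  have "prime_factors (- n) = prime_factors n" "\<And>p. multiplicity p (- n) = multiplicity p n"
    by (auto simp: in_prime_factors_iff)
  then show ?thesis using assms by (simp add: kronecker_def)
qed

lemma kronecker_prime_square:
  assumes "prime p" "\<not> p dvd a"
  shows "kronecker_prime a p * kronecker_prime a p = 1"
proof -
  have "[a = 0] (mod p) \<longleftrightarrow> p dvd a" by (rule cong_0_iff)
  then show ?thesis using assms by (auto simp: kronecker_prime_def Legendre_def)
qed

section \<open>Evaluation of the Gauss sums\<close>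

lemma root_of_unity_eq_1_iff:
  assumes "d \<noteq> 0"
  shows "root_of_unity d n = 1 \<longleftrightarrow> d dvd n"
proof
  assume "root_of_unity d n = 1"
  then obtain k where "complex_of_real (of_int n / of_int d) = of_int k"
    by (auto simp: root_of_unity_def nome_eq_1_iff elim: Ints_cases)
  then have "real_of_int n / of_int d = of_int k"
    by (metis of_real_eq_iff of_real_of_int_eq)
  then have "real_of_int n = of_int (d * k)" using assms by (simp add: field_simps)
  then have "n = d * k" by (simp only: of_int_eq_iff)
  then show "d dvd n" by simp
qed (use assms in \<open>auto simp: root_of_unity_multiple elim: dvdE\<close>)

lemma sum_root_of_unity:
  assumes "d > 0"
  shows "(\<Sum>h\<in>{0..<d}. root_of_unity d (h * n)) = (if d dvd n then of_int d else 0)"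
proof -
  have "root_of_unity d (int k * n) = root_of_unity d n ^ k" for k
    by (induction k) (auto simp: root_of_unity_add algebra_simps)
  moreover have "{0..<d} = int ` {..<nat d}"
    using assms by (auto simp: image_iff intro!: bexI[of _ "nat _"])
  ultimately have eq: "(\<Sum>h\<in>{0..<d}. root_of_unity d (h * n)) = (\<Sum>k<nat d. root_of_unity d n ^ k)"
    by (simp add: sum.reindex)
  have "root_of_unity d n ^ nat d = 1"
    using root_of_unity_multiple[of d n] assms
      \<open>root_of_unity d (int (nat d) * n) = root_of_unity d n ^ nat d\<close> by simp
  then show ?thesis
    unfolding eq using assms root_of_unity_eq_1_iff[of d n]
    by (cases "root_of_unity d n = 1") (auto simp: geometric_sum)
qed

section \<open>Gauss sums: reduction to prime moduli\<close>

lemma root_of_unity_cancel: "k \<noteq> 0 \<Longrightarrow> root_of_unity (d * k) (n * k) = root_of_unity d n"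
  by (simp add: root_of_unity_def)

lemma form_gauss_sum_1 [simp]: "form_gauss_sum Q b 1 = 1"
proof -
  have "residue_box 1 = {(0, 0)}" by auto
  then show ?thesis by (simp add: form_gauss_sum_def bqf_eval_def)
qed

lemma form_gauss_sum_cong:
  assumes "d > 0" "[b = b'] (mod d)"
  shows "form_gauss_sum Q b d = form_gauss_sum Q b' d"
  unfolding form_gauss_sum_def using assms
  by (intro sum.cong refl) (auto intro!: root_of_unity_cong cong_mult)

lemma bqf_eval_scale: "bqf_eval Q (k * x) (k * y) = k^2 * bqf_eval Q x y"
  by (simp add: bqf_eval_def algebra_simps power2_eq_square)

lemma bqf_eval_add:
  "bqf_eval Q (x + u) (y + v) = bqf_eval Q x y + bqf_eval Q u v +
    (u * (2 * coeff_a Q * x + coeff_b Q * y) + v * (coeff_b Q * x + 2 * coeff_c Q * y))"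
  by (simp add: bqf_eval_def algebra_simps power2_eq_square)

text \<open>The Gram matrix has determinant \<open>D\<close>.\<close>

lemma bqf_gradient_dvd_iff:
  assumes "bqf_disc Q = - D" "coprime q D"
  shows "q dvd 2 * coeff_a Q * x + coeff_b Q * y \<and> q dvd coeff_b Q * x + 2 * coeff_c Q * y \<longleftrightarrow> q dvd x \<and> q dvd y"
proof
  assume *: "q dvd 2 * coeff_a Q * x + coeff_b Q * y \<and> q dvd coeff_b Q * x + 2 * coeff_c Q * y"
  have D: "D = 4 * coeff_a Q * coeff_c Q - (coeff_b Q)^2" using assms(1) by (simp add: bqf_disc_def)
  have "2 * coeff_c Q * (2 * coeff_a Q * x + coeff_b Q * y) - coeff_b Q * (coeff_b Q * x + 2 * coeff_c Q * y) = D * x"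
    "2 * coeff_a Q * (coeff_b Q * x + 2 * coeff_c Q * y) - coeff_b Q * (2 * coeff_a Q * x + coeff_b Q * y) = D * y"
    unfolding D by (simp_all add: algebra_simps power2_eq_square)
  then have "q dvd D * x" "q dvd D * y" using * by (metis dvd_diff dvd_mult)+
  then show "q dvd x \<and> q dvd y" using assms(2) by (auto simp: coprime_dvd_mult_right_iff)
qed auto

lemma sum_residue_split:
  fixes f :: "int \<Rightarrow> 'a::comm_monoid_add"
  assumes "m > 0" "q > 0"
  shows "(\<Sum>x\<in>{0..<m * q}. f x) = (\<Sum>x\<in>{0..<m}. \<Sum>h\<in>{0..<q}. f (x + m * h))"
proof -
  have "(\<Sum>x\<in>{0..<m}. \<Sum>h\<in>{0..<q}. f (x + m * h)) = (\<Sum>(x, h)\<in>{0..<m} \<times> {0..<q}. f (x + m * h))"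
    by (simp add: sum.cartesian_product)
  also have "\<dots> = (\<Sum>x\<in>{0..<m * q}. f x)"
  proof (rule sum.reindex_bij_witness[where i = "\<lambda>x. (x mod m, x div m)" and j = "\<lambda>(x, h). x + m * h"])
    fix p assume p: "p \<in> {0..<m} \<times> {0..<q}"
    then obtain x h where xh: "p = (x, h)" "0 \<le> x" "x < m" "0 \<le> h" "h < q" by auto
    show "(case p of (x, h) \<Rightarrow> x + m * h) \<in> {0..<m * q}"
    proof -
      have "m * h \<le> m * (q - 1)" using xh assms by (intro mult_left_mono) auto
      then show ?thesis using xh by (simp add: algebra_simps)
    qed
    show "((case p of (x, h) \<Rightarrow> x + m * h) mod m, (case p of (x, h) \<Rightarrow> x + m * h) div m) = p"
      using xh assms by simp
  next
    fix x assume x: "x \<in> {0..<m * q}"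
    show "(x mod m, x div m) \<in> {0..<m} \<times> {0..<q}"
    proof -
      have "x div m < q"
      proof (rule ccontr)
        assume "\<not> x div m < q"
        then have "m * q \<le> m * (x div m)" using assms by (intro mult_left_mono) auto
        also have "\<dots> \<le> x" using assms mult_div_mod_eq[of m x] pos_mod_sign[of m x] by linarith
        finally show False using x by simp
      qed
      then show ?thesis using x assms by (auto simp: pos_imp_zdiv_nonneg_iff)
    qed
  qed auto
  finally show ?thesis ..
qed

text \<open>Write the residues modulo \<open>n q\<close>, where \<open>n = m q\<close>, as
  \<open>x + n h\<close> and \<open>y + n k\<close>. Since \<open>q\<close> divides
  \<open>n\<close>, the phase is linear in \<open>h\<close> and \<open>k\<close>, and summing over
  them forces both partial derivatives to vanish modulo \<open>q\<close>. As \<open>q\<close> is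
  prime to \<open>D\<close>, only multiples of \<open>q\<close> survive. Common factors of
  \<open>q\<close> and \<open>m\<close> are harmless.\<close>

lemma form_gauss_sum_square:
  assumes D: "bqf_disc Q = - D" and q: "q > 0" "coprime q (b * D)" and m: "m > 0"
  shows "form_gauss_sum Q b (q^2 * m) = of_int (q^2) * form_gauss_sum Q b m"
proof -
  define n where "n = m * q"
  have n: "n > 0" "q^2 * m = n * q" using q m by (auto simp: n_def power2_eq_square)
  have cop: "coprime q b" "coprime q D" using q by auto
  have nz: "n \<noteq> 0" "q \<noteq> 0" using n q by auto
  let ?u = "\<lambda>x y. 2 * coeff_a Q * x + coeff_b Q * y" and ?v = "\<lambda>x y. coeff_b Q * x + 2 * coeff_c Q * y"
  have "form_gauss_sum Q b (n * q) = (\<Sum>x\<in>{0..<n}. \<Sum>h\<in>{0..<q}. \<Sum>y\<in>{0..<n}. \<Sum>k\<in>{0..<q}.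
      root_of_unity (n * q) (b * bqf_eval Q (x + n * h) (y + n * k)))"
    unfolding form_gauss_sum_def sum.cartesian_product[symmetric]
    by (simp only: sum_residue_split[OF n(1) q(1)])
  also have "\<dots> = (\<Sum>x\<in>{0..<n}. \<Sum>y\<in>{0..<n}. \<Sum>h\<in>{0..<q}. \<Sum>k\<in>{0..<q}.
      root_of_unity (n * q) (b * bqf_eval Q (x + n * h) (y + n * k)))"
    by (intro sum.cong refl sum.swap)
  also have "\<dots> = (\<Sum>x\<in>{0..<n}. \<Sum>y\<in>{0..<n}. root_of_unity (n * q) (b * bqf_eval Q x y) *
      ((\<Sum>h\<in>{0..<q}. root_of_unity q (h * (b * ?u x y))) * (\<Sum>k\<in>{0..<q}. root_of_unity q (k * (b * ?v x y)))))"
  proof (intro sum.cong refl)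
    fix x y
    have "root_of_unity (n * q) (b * bqf_eval Q (x + n * h) (y + n * k)) =
      root_of_unity (n * q) (b * bqf_eval Q x y) * (root_of_unity q (h * (b * ?u x y)) * root_of_unity q (k * (b * ?v x y)))" for h k
    proof -
      have eq: "b * bqf_eval Q (x + n * h) (y + n * k) = b * bqf_eval Q x y + ((h * (b * ?u x y)) * n + ((k * (b * ?v x y)) * n
          + (n * q) * (m * b * bqf_eval Q h k)))"
        unfolding bqf_eval_add bqf_eval_scale by (simp add: n_def algebra_simps power2_eq_square)
      have 1: "root_of_unity (n * q) (X * n) = root_of_unity q X" for X
        using root_of_unity_cancel[OF nz(1), of q X] by (simp only: mult.commute)
      have 2: "root_of_unity (n * q) ((n * q) * X) = 1" for X
        using nz by (intro root_of_unity_multiple) simp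
      show ?thesis
        unfolding eq root_of_unity_add[of "n * q"] 1 2 mult_1_right ..
    qed
    then show "(\<Sum>h\<in>{0..<q}. \<Sum>k\<in>{0..<q}. root_of_unity (n * q) (b * bqf_eval Q (x + n * h) (y + n * k))) =
      root_of_unity (n * q) (b * bqf_eval Q x y) *
      ((\<Sum>h\<in>{0..<q}. root_of_unity q (h * (b * ?u x y))) * (\<Sum>k\<in>{0..<q}. root_of_unity q (k * (b * ?v x y))))"
      by (simp only: sum_product) (simp only: sum_distrib_left)
  qed
  also have "\<dots> = (\<Sum>x\<in>{0..<n}. \<Sum>y\<in>{0..<n}. root_of_unity (n * q) (b * bqf_eval Q x y) * (of_int (q^2) * of_bool (q dvd x \<and> q dvd y)))"
    unfolding sum_root_of_unity[OF q(1)] coprime_dvd_mult_right_iff[OF cop(1)]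
    using bqf_gradient_dvd_iff[OF D cop(2)] by (intro sum.cong refl) (auto simp: power2_eq_square)
  also have "\<dots> = (\<Sum>(x, y)\<in>residue_box n. root_of_unity (n * q) (b * bqf_eval Q x y) * (of_int (q^2) * of_bool (q dvd x \<and> q dvd y)))"
    by (simp add: sum.cartesian_product)
  also have "\<dots> = (\<Sum>(x, y)\<in>residue_box m. of_int (q^2) * root_of_unity m (b * bqf_eval Q x y))"
  proof (rule sum.reindex_bij_witness_not_neutral[symmetric, where S' = "{}"
        and T' = "{(x, y)\<in>residue_box n. \<not> (q dvd x \<and> q dvd y)}"
        and i = "\<lambda>(x, y). (x div q, y div q)" and j = "\<lambda>(x, y). (q * x, q * y)"])
    fix p assume "p \<in> residue_box m - {}"
    then obtain x y where p: "p = (x, y)" "0 \<le> x" "x < m" "0 \<le> y" "y < m" by auto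
    show "(case p of (x, y) \<Rightarrow> (q * x, q * y)) \<in> residue_box n - {(x, y)\<in>residue_box n. \<not> (q dvd x \<and> q dvd y)}"
      using p q by (auto simp: n_def mult.commute)
    show "(case (case p of (x, y) \<Rightarrow> (q * x, q * y)) of (x, y) \<Rightarrow> (x div q, y div q)) = p"
      using p q by simp
  next
    fix p assume "p \<in> residue_box m"
    obtain x y where p: "p = (x, y)" by (cases p)
    have eq: "b * bqf_eval Q (q * x) (q * y) = (b * bqf_eval Q x y) * q^2"
      by (simp add: bqf_eval_scale)
    have nq: "n * q = m * q^2" by (simp add: n_def power2_eq_square)
    have "root_of_unity (n * q) (b * bqf_eval Q (q * x) (q * y)) = root_of_unity m (b * bqf_eval Q x y)"
      unfolding eq nq by (rule root_of_unity_cancel) (use q in simp)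
    then show "(case (case p of (x, y) \<Rightarrow> (q * x, q * y)) of (x, y) \<Rightarrow> root_of_unity (n * q) (b * bqf_eval Q x y) * (of_int (q^2) * of_bool (q dvd x \<and> q dvd y))) =
        (case p of (x, y) \<Rightarrow> of_int (q^2) * root_of_unity m (b * bqf_eval Q x y))"
      by (simp add: p)
  next
    fix p assume "p \<in> residue_box n - {(x, y)\<in>residue_box n. \<not> (q dvd x \<and> q dvd y)}"
    then obtain x' y' where p': "p = (x', y')" "q dvd x'" "q dvd y'" "0 \<le> x'" "x' < q * m" "0 \<le> y'" "y' < q * m"
      by (auto simp: n_def mult.commute)
    then obtain x y where "x' = q * x" "y' = q * y" by (auto elim!: dvdE)
    with p' have p: "p = (q * x, q * y)" "0 \<le> q * x" "q * x < q * m" "0 \<le> q * y" "q * y < q * m"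
      by auto
    then have "0 \<le> x" "x < m" "0 \<le> y" "y < m" using q by (auto simp: zero_le_mult_iff)
    then show "(case p of (x, y) \<Rightarrow> (x div q, y div q)) \<in> residue_box m - {}"
      "(case (case p of (x, y) \<Rightarrow> (x div q, y div q)) of (x, y) \<Rightarrow> (q * x, q * y)) = p"
      using q by (auto simp: p)
  qed (auto intro: finite_subset[of _ "residue_box n"])
  also have "\<dots> = of_int (q^2) * form_gauss_sum Q b m"
    by (simp add: form_gauss_sum_def sum_distrib_left case_prod_unfold)
  finally show ?thesis by (simp add: n)
qed

text \<open>The parametrization \<open>n u + m v\<close> avoids modular inverses: substituted into a
  quadratic form it gives \<open>n^2\<close> times the value in the \<open>u\<close> variables plus
  \<open>m^2\<close> times the value in the \<open>v\<close> variables, up to multiples of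
  \<open>m n\<close>.\<close>

lemma sum_residue_crt:
  fixes f :: "int \<Rightarrow> 'a::comm_monoid_add"
  assumes "m > 0" "n > 0" "coprime m n" and per: "\<And>x. f (x mod (m * n)) = f x"
  shows "(\<Sum>x\<in>{0..<m * n}. f x) = (\<Sum>u\<in>{0..<m}. \<Sum>v\<in>{0..<n}. f (n * u + m * v))"
proof -
  define h where "h = (\<lambda>(u, v). (n * u + m * v) mod (m * n))"
  have inj: "inj_on h ({0..<m} \<times> {0..<n})"
  proof (rule inj_onI, safe)
    fix u v u' v'
    assume uv: "u \<in> {0..<m}" "v \<in> {0..<n}" "u' \<in> {0..<m}" "v' \<in> {0..<n}" and "h (u, v) = h (u', v')"
    then have *: "[n * u + m * v = n * u' + m * v'] (mod m * n)" by (simp add: h_def cong_def)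
    have "[n * u = n * u'] (mod m)"
      using cong_modulus_mult[OF *] by (simp add: cong_def mod_add_eq[symmetric] mod_mult_self2_is_0)
    then have "[u = u'] (mod m)" using assms(3) by (metis cong_mult_lcancel coprime_commute)
    then show "u = u'" using uv by (auto simp: cong_def)
    have "[n * u + m * v = n * u' + m * v'] (mod n)"
      using * by (metis cong_modulus_mult mult.commute)
    then have "[m * v = m * v'] (mod n)"
      by (simp add: cong_def)
    then have "[v = v'] (mod n)" using assms(3) by (metis cong_mult_lcancel)
    then show "v = v'" using uv by (auto simp: cong_def)
  qed
  have "h ` ({0..<m} \<times> {0..<n}) = {0..<m * n}"
  proof (rule card_subset_eq)
    show "h ` ({0..<m} \<times> {0..<n}) \<subseteq> {0..<m * n}" using assms by (auto simp: h_def)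
    show "card (h ` ({0..<m} \<times> {0..<n})) = card {0..<m * n}"
      using assms by (simp add: card_image[OF inj] nat_mult_distrib)
  qed simp
  then have "(\<Sum>x\<in>{0..<m * n}. f x) = (\<Sum>p\<in>{0..<m} \<times> {0..<n}. f (h p))"
    using sum.reindex[OF inj, of f] by simp
  then show ?thesis
    by (simp add: h_def per case_prod_unfold sum.cartesian_product)
qed

lemma form_gauss_sum_mult_coprime:
  assumes m: "m > 0" and n: "n > 0" and cop: "coprime m n"
  shows "form_gauss_sum Q b (m * n) = form_gauss_sum Q (b * n) m * form_gauss_sum Q (b * m) n"
proof -
  have mn: "m * n > 0" using m n by simp
  have "form_gauss_sum Q b (m * n) = (\<Sum>u\<in>{0..<m}. \<Sum>v\<in>{0..<n}. \<Sum>y\<in>{0..<m * n}.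
      root_of_unity (m * n) (b * bqf_eval Q (n * u + m * v) y))"
    unfolding form_gauss_sum_def sum.cartesian_product[symmetric]
    by (rule sum_residue_crt[OF m n cop])
       (intro sum.cong refl root_of_unity_cong cong_mult bqf_eval_cong, use mn in auto)
  also have "\<dots> = (\<Sum>u\<in>{0..<m}. \<Sum>v\<in>{0..<n}. \<Sum>s\<in>{0..<m}. \<Sum>t\<in>{0..<n}.
      root_of_unity (m * n) (b * bqf_eval Q (n * u + m * v) (n * s + m * t)))"
    by (intro sum.cong refl sum_residue_crt[OF m n cop] root_of_unity_cong cong_mult bqf_eval_cong)
       (use mn in auto)
  also have "\<dots> = (\<Sum>u\<in>{0..<m}. \<Sum>v\<in>{0..<n}. \<Sum>s\<in>{0..<m}. \<Sum>t\<in>{0..<n}.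
      root_of_unity m (b * n * bqf_eval Q u s) * root_of_unity n (b * m * bqf_eval Q v t))"
  proof (intro sum.cong refl)
    fix u v s t
    have eq: "b * bqf_eval Q (n * u + m * v) (n * s + m * t) =
        (b * n * bqf_eval Q u s) * n + ((b * m * bqf_eval Q v t) * m +
        (m * n) * (b * (v * (2 * coeff_a Q * u + coeff_b Q * s) + t * (coeff_b Q * u + 2 * coeff_c Q * s))))"
      unfolding bqf_eval_def by (simp add: algebra_simps power2_eq_square)
    have 1: "root_of_unity (m * n) (X * n) = root_of_unity m X" for X
      using n by (intro root_of_unity_cancel) simp
    have 2: "root_of_unity (m * n) (X * m) = root_of_unity n X" for X
      using m root_of_unity_cancel[of m n X] by (simp add: mult.commute)
    have 3: "root_of_unity (m * n) ((m * n) * X) = 1" for X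
      using m n by (intro root_of_unity_multiple) simp
    show "root_of_unity (m * n) (b * bqf_eval Q (n * u + m * v) (n * s + m * t)) =
        root_of_unity m (b * n * bqf_eval Q u s) * root_of_unity n (b * m * bqf_eval Q v t)"
      unfolding eq root_of_unity_add[of "m * n"] 1 2 3 mult_1_right ..
  qed
  also have "\<dots> = (\<Sum>u\<in>{0..<m}. \<Sum>s\<in>{0..<m}. root_of_unity m (b * n * bqf_eval Q u s)) *
      (\<Sum>v\<in>{0..<n}. \<Sum>t\<in>{0..<n}. root_of_unity n (b * m * bqf_eval Q v t))"
    unfolding sum_product ..
  also have "\<dots> = form_gauss_sum Q (b * n) m * form_gauss_sum Q (b * m) n"
    by (simp add: form_gauss_sum_def sum.cartesian_product)
  finally show ?thesis .
qed

text \<open>Multiplying by the norm \<open>t\<^sup>2 + D u\<^sup>2\<close> of \<open>t + u \<surd>(-D)\<close> permutes the residues.\<close>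

lemma form_gauss_sum_mult_norm:
  assumes D: "bqf_disc Q = - D" and d: "d > 0" and cop: "coprime d (t^2 + D * u^2)"
  shows "form_gauss_sum Q (b * (t^2 + D * u^2)) d = form_gauss_sum Q b d"
proof -
  obtain A B C where Q: "Q = BQF A B C" by (cases Q)
  have D': "D = 4 * A * C - B^2" using D by (simp add: Q bqf_disc_def)
  define S where "S x y = (t - B * u) * x - 2 * C * u * y" for x y
  define T where "T x y = 2 * A * u * x + (t + B * u) * y" for x y
  have "form_gauss_sum Q b d = (\<Sum>(x, y)\<in>residue_box d. root_of_unity d (b * bqf_eval Q (S x y) (T x y)))"
    unfolding form_gauss_sum_def
  proof (rule sum_residue_box_reindex[OF d, symmetric])
    fix x y x' y' assume *: "[S x y = S x' y'] (mod d)" "[T x y = T x' y'] (mod d)"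
    have "(t + B * u) * S x y + 2 * C * u * T x y = (t^2 + D * u^2) * x"
      "(t - B * u) * T x y - 2 * A * u * S x y = (t^2 + D * u^2) * y" for x y
      unfolding S_def T_def D' by (simp_all add: algebra_simps power2_eq_square)
    then have "[(t^2 + D * u^2) * x = (t^2 + D * u^2) * x'] (mod d)" "[(t^2 + D * u^2) * y = (t^2 + D * u^2) * y'] (mod d)"
      using * by (metis cong_add cong_diff cong_scalar_left)+
    then show "[x = x'] (mod d) \<and> [y = y'] (mod d)"
      using cop by (metis cong_mult_lcancel coprime_commute)
  qed (simp add: root_of_unity_bqf_eval_mod d)
  moreover have "bqf_eval Q (S x y) (T x y) = (t^2 + D * u^2) * bqf_eval Q x y" for x y
    unfolding Q bqf_eval_def S_def T_def D' by (simp add: algebra_simps power2_eq_square)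
  ultimately show ?thesis by (simp add: form_gauss_sum_def mult.assoc)
qed

section \<open>Gauss sums modulo an unramified prime\<close>

lemma Legendre_mult_nonresidues:
  assumes q: "prime q" "q > 2" and "Legendre a q = -1" "Legendre b q = -1"
  shows "Legendre (a * b) q = 1"
proof -
  define p where "p = nat q"
  have p: "int p = q" "prime p" "2 < p" using q by (auto simp: p_def)
  have e: "[Legendre x q = x ^ ((p - 1) div 2)] (mod q)" for x
    using euler_criterion[of p x] p by simp
  have "[Legendre (a * b) q = (a * b) ^ ((p - 1) div 2)] (mod q)" by (rule e)
  also have "(a * b) ^ ((p - 1) div 2) = a ^ ((p - 1) div 2) * b ^ ((p - 1) div 2)" by (rule power_mult_distrib)
  also have "[\<dots> = Legendre a q * Legendre b q] (mod q)" by (intro cong_mult cong_sym[OF e])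
  finally have "[Legendre (a * b) q = 1] (mod q)" using assms by simp
  then have "q dvd Legendre (a * b) q - 1" by (simp add: cong_iff_dvd_diff)
  moreover have "Legendre (a * b) q \<in> {-1, 0, 1}" by (simp add: Legendre_def)
  moreover have "\<not> q dvd 2" "\<not> q dvd 1" using q zdvd_imp_le[of q 2] zdvd_imp_le[of q 1] by auto
  ultimately show ?thesis by auto
qed

lemma Legendre_eq_1E:
  assumes "Legendre a q = 1"
  obtains t where "[a = t^2] (mod q)"
  using assms by (auto simp: Legendre_def QuadRes_def split: if_splits dest: cong_sym)

lemma Legendre_square:
  assumes "prime q" "\<not> q dvd t"
  shows "Legendre (t^2) q = 1"
proof -
  have "\<not> q dvd t^2" using assms prime_dvd_power by blast
  then show ?thesis by (auto simp: Legendre_def QuadRes_def cong_0_iff intro: exI[of _ t])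
qed

lemma Legendre_cong:
  assumes "[a = b] (mod q)"
  shows "Legendre a q = Legendre b q"
proof -
  have "[c = a] (mod q) \<longleftrightarrow> [c = b] (mod q)" for c
    using assms by (blast intro: cong_trans cong_sym)
  then show ?thesis by (simp add: Legendre_def QuadRes_def cong_sym_eq[of _ 0])
qed

text \<open>If \<open>D\<close> is a nonresidue, \<open>(0, 1)\<close> works. Otherwise
  \<open>D u^2\<close> can be made 1 modulo \<open>q\<close>, and the least positive nonresidue
  \<open>n\<close> is \<open>(n - 1) + 1\<close> with \<open>n - 1\<close> a square modulo
  \<open>q\<close>.\<close>

lemma exists_nonresidue_norm:
  assumes q: "prime q" "q > 2" "\<not> q dvd D"
  obtains t u where "Legendre (t^2 + D * u^2) q = -1"
proof (cases "Legendre D q = 1")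
  case False
  then have "Legendre D q = -1" using q by (auto simp: Legendre_def cong_0_iff)
  then show ?thesis using that[of 0 1] by simp
next
  case True
  then obtain e where e: "[D = e^2] (mod q)" by (rule Legendre_eq_1E)
  have cop: "coprime e q"
  proof -
    have "\<not> q dvd e"
    proof
      assume "q dvd e"
      then have "q dvd e^2" by (simp add: power2_eq_square)
      then show False using e q(3) by (simp add: cong_dvd_iff)
    qed
    then show ?thesis using q(1) by (metis coprime_commute prime_imp_coprime)
  qed
  then obtain u where u: "[e * u = 1] (mod q)" using cong_solve_coprime_int by blast
  have Du: "[D * u^2 = 1] (mod q)"
  proof -
    have "[D * u^2 = e^2 * u^2] (mod q)" by (intro cong_mult e cong_refl)
    also have "e^2 * u^2 = (e * u)^2" by (rule power_mult_distrib[symmetric])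
    also have "[(e * u)^2 = 1^2] (mod q)" by (intro cong_pow u)
    finally show ?thesis by simp
  qed
  \<comment> \<open>As \<open>r\<close> and \<open>q - r\<close> have the same square, all nonzero
    squares come from \<open>{1..(q - 1) div 2}\<close> and are too few to cover
    \<open>{1..<q}\<close>.\<close>
  have "\<exists>v. v \<ge> 1 \<and> v < q \<and> Legendre v q \<noteq> 1"
  proof (rule ccontr)
    assume "\<not> ?thesis"
    then have all: "\<And>v. 1 \<le> v \<Longrightarrow> v < q \<Longrightarrow> Legendre v q = 1" by blast
    have "{1..<q} \<subseteq> (\<lambda>t. t^2 mod q) ` {1..(q - 1) div 2}"
    proof
      fix v assume v: "v \<in> {1..<q}"
      then obtain t where t: "[v = t^2] (mod q)" using all by (auto elim: Legendre_eq_1E)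
      define r where "r = (if t mod q \<le> (q - 1) div 2 then t mod q else q - t mod q)"
      have tm: "0 \<le> t mod q" "t mod q < q" using q by auto
      have "[r^2 = t^2] (mod q)"
      proof (cases "t mod q \<le> (q - 1) div 2")
        case False
        have "[q - t mod q = - t] (mod q)" by (simp add: cong_def mod_diff_right_eq mod_minus_eq minus_mod_self1 minus_mod_int_eq)
        then have "[(q - t mod q)^2 = (- t)^2] (mod q)" by (rule cong_pow)
        then show ?thesis using False by (simp add: r_def)
      qed (simp add: r_def cong_def power_mod)
      then have "[v = r^2] (mod q)" using t by (metis cong_sym cong_trans)
      then have vr: "v = r^2 mod q" using v by (simp add: cong_def)
      moreover have "r \<noteq> 0" using v vr by auto
      then have "r \<in> {1..(q - 1) div 2}"
      proof -
        obtain k where k: "q = 2 * k + 1" using prime_odd_int[OF q(1,2)] by (elim oddE)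
        define w where "w = t mod q"
        have "0 \<le> w" "w < q" "r = (if w \<le> k then w else q - w)"
          using tm by (simp_all add: w_def r_def k)
        then show ?thesis using \<open>r \<noteq> 0\<close> by (auto simp: k split: if_splits)
      qed
      ultimately show "v \<in> (\<lambda>t. t^2 mod q) ` {1..(q - 1) div 2}" by blast
    qed
    from surj_card_le[OF _ this] q show False by simp
  qed
  then obtain v0 where "v0 \<ge> 1 \<and> v0 < q \<and> Legendre v0 q \<noteq> 1" by blast
  then have "\<exists>n. n \<ge> 1 \<and> int n < q \<and> Legendre (int n) q \<noteq> 1"
    by (intro exI[of _ "nat v0"]) auto
  then obtain n where n: "n \<ge> 1" "int n < q" "Legendre (int n) q \<noteq> 1"
    and min: "\<And>m. m < n \<Longrightarrow> \<not> (m \<ge> 1 \<and> int m < q \<and> Legendre (int m) q \<noteq> 1)"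
    using exists_least_iff[of "\<lambda>n. n \<ge> 1 \<and> int n < q \<and> Legendre (int n) q \<noteq> 1"] by blast
  have "n \<noteq> 1"
  proof
    assume "n = 1"
    moreover have "Legendre (1^2) q = 1" using q by (intro Legendre_square) auto
    ultimately show False using n by simp
  qed
  then have "Legendre (int (n - 1)) q = 1" using min[of "n - 1"] n by auto
  then obtain t where t: "[int (n - 1) = t^2] (mod q)" by (rule Legendre_eq_1E)
  have "[t^2 + D * u^2 = int (n - 1) + 1] (mod q)" by (intro cong_add cong_sym[OF t] Du)
  then have "Legendre (t^2 + D * u^2) q = Legendre (int n) q"
    using n by (intro Legendre_cong) (simp add: of_nat_diff)
  moreover have "\<not> q dvd int n" using n zdvd_not_zless[of "int n" q] by auto
  ultimately have "Legendre (t^2 + D * u^2) q = -1" using n by (auto simp: Legendre_def cong_0_iff)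
  then show ?thesis by (rule that)
qed

text \<open>A square is removed by the norm \<open>t^2\<close>, the case \<open>u = 0\<close>; a
  nonresidue first becomes a residue through multiplication by a norm that is a nonresidue.\<close>

lemma form_gauss_sum_prime_unit:
  assumes q: "prime q" "q > 2" "\<not> q dvd D" and D: "bqf_disc Q = - D" and b: "\<not> q dvd b"
  shows "form_gauss_sum Q b q = form_gauss_sum Q 1 q"
proof -
  have q0: "q > 0" using q by simp
  have sq: "form_gauss_sum Q x q = form_gauss_sum Q 1 q" if "Legendre x q = 1" for x
  proof -
    obtain t where t: "[x = t^2] (mod q)" using \<open>Legendre x q = 1\<close> by (rule Legendre_eq_1E)
    have "\<not> q dvd x" using that by (auto simp: Legendre_def cong_0_iff)
    then have "\<not> q dvd t^2" using t by (simp add: cong_dvd_iff)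
    then have "\<not> q dvd t" by (auto simp: power2_eq_square)
    then have "coprime q (t^2 + D * 0^2)" using q(1) by (simp add: prime_imp_coprime)
    from form_gauss_sum_mult_norm[OF D q0 this, of 1] show ?thesis
      using form_gauss_sum_cong[OF q0 t, of Q] by simp
  qed
  show ?thesis
  proof (cases "Legendre b q = 1")
    case False
    then have Lb: "Legendre b q = -1" using b by (auto simp: Legendre_def cong_0_iff)
    obtain t u where Ln: "Legendre (t^2 + D * u^2) q = -1" using q by (rule exists_nonresidue_norm)
    have "\<not> q dvd t^2 + D * u^2" using Ln by (auto simp: Legendre_def cong_0_iff)
    then have "coprime q (t^2 + D * u^2)" using q(1) by (simp add: prime_imp_coprime)
    from form_gauss_sum_mult_norm[OF D q0 this, of b] show ?thesis
      using sq[OF Legendre_mult_nonresidues[OF q(1,2) Lb Ln]] by simp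
  qed (rule sq)
qed

lemma sum_root_of_unity_hyperbolic:
  assumes "q > 0" "coprime q \<kappa>"
  shows "(\<Sum>(X, Y)\<in>residue_box q. root_of_unity q (\<kappa> * (X * Y))) = of_int q"
proof -
  have "(\<Sum>(X, Y)\<in>residue_box q. root_of_unity q (\<kappa> * (X * Y))) =
      (\<Sum>X\<in>{0..<q}. \<Sum>Y\<in>{0..<q}. root_of_unity q (Y * (\<kappa> * X)))"
    by (simp add: sum.cartesian_product mult_ac)
  also have "\<dots> = (\<Sum>X\<in>{0..<q}. if X = 0 then of_int q else 0)"
    unfolding sum_root_of_unity[OF assms(1)] coprime_dvd_mult_right_iff[OF assms(2)]
    by (intro sum.cong refl if_cong) (auto dest: zdvd_imp_le)
  also have "\<dots> = of_int q" using assms(1) by simp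
  finally show ?thesis .
qed

text \<open>Modulo \<open>q\<close> the form is a hyperbolic plane, up to a unit a product of two
  independent linear forms. If \<open>q\<close> divides \<open>A\<close>, one of them is
  \<open>y\<close>; otherwise a square root \<open>e\<close> of \<open>- D\<close> factors
  \<open>4 A Q = (2 A x + B y)^2 + D y^2\<close>.\<close>

lemma form_gauss_sum_prime_split:
  assumes q: "prime q" "q > 2" "\<not> q dvd D" and D: "bqf_disc Q = - D" and b: "\<not> q dvd b"
    and L: "Legendre (- D) q = 1"
  shows "form_gauss_sum Q b q = of_int q"
proof -
  obtain A B C where Q: "Q = BQF A B C" by (cases Q)
  have D': "D = 4 * A * C - B^2" using D by (simp add: Q bqf_disc_def)
  have q0: "q > 0" using q by simp
  have cop: "coprime q x" if "\<not> q dvd x" for x using that q(1) by (simp add: prime_imp_coprime)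
  have n2: "\<not> q dvd 2" using q zdvd_imp_le[of q 2] by auto
  have cancel: "[x = y] (mod q)" if "\<not> q dvd c" "[c * x = c * y] (mod q)" for c x y
    using that cop[of c] by (metis cong_mult_lcancel coprime_commute)
  show ?thesis
  proof (cases "q dvd A")
    case True
    have nB: "\<not> q dvd B"
    proof
      assume "q dvd B"
      then have "q dvd D" unfolding D' using True by (simp add: power2_eq_square)
      then show False using q(3) by simp
    qed
    have "form_gauss_sum Q b q = (\<Sum>(x, y)\<in>residue_box q. root_of_unity q (b * (y * (B * x + C * y))))"
      unfolding form_gauss_sum_def
    proof (intro sum.cong refl, clarify)
      fix x y
      have "bqf_eval Q x y - y * (B * x + C * y) = A * x^2"
        by (simp add: Q bqf_eval_def algebra_simps power2_eq_square)
      then have "[bqf_eval Q x y = y * (B * x + C * y)] (mod q)"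
        using True by (simp add: cong_iff_dvd_diff)
      then show "root_of_unity q (b * bqf_eval Q x y) = root_of_unity q (b * (y * (B * x + C * y)))"
        using q0 by (intro root_of_unity_cong cong_mult cong_refl) auto
    qed
    also have "\<dots> = (\<Sum>(X, Y)\<in>residue_box q. root_of_unity q (b * (X * Y)))"
    proof (rule sum_residue_box_reindex[OF q0])
      fix x y x' y' assume *: "[y = y'] (mod q)" "[B * x + C * y = B * x' + C * y'] (mod q)"
      then have "[B * x + C * y - C * y = B * x' + C * y' - C * y'] (mod q)"
        by (intro cong_diff cong_mult cong_refl)
      then have "[B * x = B * x'] (mod q)" by simp
      then show "[x = x'] (mod q) \<and> [y = y'] (mod q)" using cancel[OF nB] *(1) by blast
    qed (use q0 in \<open>auto intro!: root_of_unity_cong cong_mult simp: cong_def\<close>)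
    also have "\<dots> = of_int q" by (rule sum_root_of_unity_hyperbolic[OF q0 cop[OF b]])
    finally show ?thesis .
  next
    case False
    obtain e where e: "[- D = e^2] (mod q)" using L by (rule Legendre_eq_1E)
    have ne: "\<not> q dvd e"
    proof
      assume "q dvd e"
      then have "q dvd e^2" by (simp add: power2_eq_square)
      then show False using cong_dvd_iff[OF e] q(3) by simp
    qed
    have n4A: "\<not> q dvd 4 * A"
    proof
      assume "q dvd 4 * A"
      then have "q dvd 2 * 2 * A" by simp
      then show False using False n2 q(1) by (simp only: prime_dvd_mult_iff) auto
    qed
    obtain a' where a': "[4 * A * a' = 1] (mod q)"
      using cong_solve_coprime_int[of "4 * A" q] cop[OF n4A] by (auto simp: coprime_commute)
    have na': "\<not> q dvd a'"
    proof
      assume "q dvd a'"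
      then have "q dvd 4 * A * a'" by simp
      then have "q dvd 1" using a' by (simp add: cong_dvd_iff)
      then show False using q by auto
    qed
    define S where "S x y = 2 * A * x + (B - e) * y" for x y
    define T where "T x y = 2 * A * x + (B + e) * y" for x y
    have "form_gauss_sum Q b q = (\<Sum>(x, y)\<in>residue_box q. root_of_unity q (b * a' * (S x y * T x y)))"
      unfolding form_gauss_sum_def
    proof (intro sum.cong refl, clarify)
      fix x y
      have "S x y * T x y - 4 * A * bqf_eval Q x y = (- D - e^2) * y^2"
        by (simp add: Q bqf_eval_def S_def T_def D' algebra_simps power2_eq_square)
      moreover have "q dvd (- D - e^2) * y^2" using e by (simp add: cong_iff_dvd_diff)
      ultimately have "[4 * A * bqf_eval Q x y = S x y * T x y] (mod q)"
        by (simp add: cong_iff_dvd_diff dvd_diff_commute)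
      then have "[b * a' * (4 * A * bqf_eval Q x y) = b * a' * (S x y * T x y)] (mod q)"
        by (rule cong_scalar_left)
      moreover have "[(4 * A * a') * (b * bqf_eval Q x y) = 1 * (b * bqf_eval Q x y)] (mod q)"
        using a' by (rule cong_scalar_right)
      ultimately have "[b * bqf_eval Q x y = b * a' * (S x y * T x y)] (mod q)"
        by (simp add: mult_ac) (metis cong_sym cong_trans)
      then show "root_of_unity q (b * bqf_eval Q x y) = root_of_unity q (b * a' * (S x y * T x y))"
        using q0 by (intro root_of_unity_cong) auto
    qed
    also have "\<dots> = (\<Sum>(X, Y)\<in>residue_box q. root_of_unity q (b * a' * (X * Y)))"
    proof (rule sum_residue_box_reindex[OF q0])
      fix x y x' y' assume *: "[S x y = S x' y'] (mod q)" "[T x y = T x' y'] (mod q)"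
      then have "[T x y - S x y = T x' y' - S x' y'] (mod q)" by (intro cong_diff)
      moreover have "T u v - S u v = 2 * e * v" for u v by (simp add: S_def T_def algebra_simps)
      ultimately have "[2 * e * y = 2 * e * y'] (mod q)" by simp
      moreover have "\<not> q dvd 2 * e" using n2 ne q(1) by (simp add: prime_dvd_mult_iff)
      ultimately have y: "[y = y'] (mod q)" using cancel by blast
      have "[S x y - (B - e) * y = S x' y' - (B - e) * y'] (mod q)"
        by (intro cong_diff cong_mult cong_refl y *)
      then have "[2 * A * x = 2 * A * x'] (mod q)" by (simp add: S_def)
      moreover have "\<not> q dvd 2 * A" using n2 False q(1) by (simp add: prime_dvd_mult_iff)
      ultimately show "[x = x'] (mod q) \<and> [y = y'] (mod q)" using cancel y by blast
    qed (use q0 in \<open>auto intro!: root_of_unity_cong cong_mult simp: cong_def\<close>)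
    also have "\<dots> = of_int q"
      using b na' q(1) by (intro sum_root_of_unity_hyperbolic[OF q0] cop) (simp add: prime_dvd_mult_iff)
    finally show ?thesis .
  qed
qed

text \<open>In the inert case the form is anisotropic modulo \<open>q\<close>, so summing the Gauss sums over all
  \<open>b\<close> modulo \<open>q\<close> gives \<open>q\<close>.\<close>

lemma form_gauss_sum_prime_inert:
  assumes q: "prime q" "q > 2" "\<not> q dvd D" and D: "bqf_disc Q = - D" and b: "\<not> q dvd b"
    and L: "Legendre (- D) q = -1"
  shows "form_gauss_sum Q b q = - of_int q"
proof -
  obtain A B C where Q: "Q = BQF A B C" by (cases Q)
  have D': "- D = B^2 - 4 * A * C" using D by (simp add: Q bqf_disc_def)
  have q0: "q > 0" using q by simp
  have nosq: "\<not> [z^2 = - D] (mod q)" for z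
    using L by (auto simp: Legendre_def QuadRes_def split: if_splits)
  have cop: "coprime q x" if "\<not> q dvd x" for x using that q(1) by (simp add: prime_imp_coprime)
  have nA: "\<not> q dvd A"
  proof
    assume "q dvd A"
    then have "[B^2 = - D] (mod q)" unfolding D' by (simp add: cong_iff_dvd_diff)
    then show False using nosq by blast
  qed
  \<comment> \<open>A zero with \<open>y\<close> invertible would make
    \<open>(2 A x + B y) / y\<close> a square root of \<open>- D\<close> modulo
    \<open>q\<close>.\<close>
  have aniso: "q dvd bqf_eval Q x y \<longleftrightarrow> q dvd x \<and> q dvd y" for x y
  proof
    assume *: "q dvd bqf_eval Q x y"
    have eq: "4 * A * bqf_eval Q x y = (2 * A * x + B * y)^2 - (- D) * y^2"
      unfolding D' by (simp add: Q bqf_eval_def algebra_simps power2_eq_square)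
    have "q dvd y"
    proof (rule ccontr)
      assume "\<not> q dvd y"
      then obtain y' where y': "[y * y' = 1] (mod q)"
        using cong_solve_coprime_int[of y q] cop[of y] by (auto simp: coprime_commute)
      have "q dvd (2 * A * x + B * y)^2 - (- D) * y^2" unfolding eq[symmetric] using * by simp
      then have "[(2 * A * x + B * y)^2 = (- D) * y^2] (mod q)" by (simp add: cong_iff_dvd_diff)
      then have "[(2 * A * x + B * y)^2 * y'^2 = (- D) * y^2 * y'^2] (mod q)" by (rule cong_scalar_right)
      moreover have "[(- D) * (y * y')^2 = (- D) * 1^2] (mod q)" by (intro cong_mult cong_pow cong_refl y')
      ultimately have "[((2 * A * x + B * y) * y')^2 = - D] (mod q)"
        by (simp add: power_mult_distrib mult.assoc) (metis cong_trans)
      then show False using nosq by blast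
    qed
    moreover from this have "q dvd A * x^2"
      using * unfolding Q bqf_eval_def by (simp add: dvd_add_left_iff power2_eq_square)
    then have "q dvd x" using nA q(1) by (auto simp: prime_dvd_mult_iff dest: prime_dvd_power)
    ultimately show "q dvd x \<and> q dvd y" by simp
  qed (auto simp: Q bqf_eval_def power2_eq_square)
  have "(\<Sum>h\<in>{0..<q}. form_gauss_sum Q h q) = (\<Sum>(x, y)\<in>residue_box q. \<Sum>h\<in>{0..<q}. root_of_unity q (h * bqf_eval Q x y))"
    unfolding form_gauss_sum_def case_prod_unfold by (rule sum.swap)
  also have "\<dots> = (\<Sum>p\<in>residue_box q. if p = (0, 0) then of_int q else 0)"
    unfolding sum_root_of_unity[OF q0] aniso
  proof (intro sum.cong refl)
    fix p assume "p \<in> residue_box q"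
    then obtain x y where p: "p = (x, y)" "0 \<le> x" "x < q" "0 \<le> y" "y < q" by auto
    have "q dvd u \<longleftrightarrow> u = 0" if "0 \<le> u" "u < q" for u
      using that zdvd_imp_le[of q u] by (cases "u = 0") auto
    then have "q dvd x \<longleftrightarrow> x = 0" "q dvd y \<longleftrightarrow> y = 0" using p by blast+
    then show "(case p of (x, y) \<Rightarrow> if q dvd x \<and> q dvd y then of_int q else 0) =
        (if p = (0, 0) then of_int q else (0 :: complex))"
      by (simp add: p(1))
  qed
  also have "\<dots> = of_int q" using q0 by simp
  finally have 1: "(\<Sum>h\<in>{0..<q}. form_gauss_sum Q h q) = of_int q" .
  have "{0..<q} = insert 0 {1..<q}" using q0 by auto
  then have "(\<Sum>h\<in>{0..<q}. form_gauss_sum Q h q) = form_gauss_sum Q 0 q + (\<Sum>h\<in>{1..<q}. form_gauss_sum Q h q)"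
    by simp
  also have "form_gauss_sum Q 0 q = of_int (q^2)"
    using q0 by (simp add: form_gauss_sum_def power2_eq_square)
  \<comment> \<open>All units contribute the same value \<open>S\<close> and \<open>h = 0\<close>
    contributes \<open>q^2\<close>, so \<open>q^2 + (q - 1) S = q\<close>, which gives
    \<open>S = - q\<close>.\<close>
  also have "(\<Sum>h\<in>{1..<q}. form_gauss_sum Q h q) = (\<Sum>h\<in>{1..<q}. form_gauss_sum Q b q)"
  proof (rule sum.cong[OF refl])
    fix h assume "h \<in> {1..<q}"
    then have "\<not> q dvd h" using zdvd_imp_le[of q h] by auto
    then show "form_gauss_sum Q h q = form_gauss_sum Q b q"
      using form_gauss_sum_prime_unit[OF q D] b by metis
  qed
  also have "\<dots> = of_int (q - 1) * form_gauss_sum Q b q" using q0 by simp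
  finally have "of_int (q - 1) * form_gauss_sum Q b q = of_int (q - 1) * (- of_int q)"
    using 1 by (simp add: algebra_simps power2_eq_square)
  moreover have "of_int (q - 1) \<noteq> (0 :: complex)" using q by (simp del: of_int_diff)
  ultimately show ?thesis by (simp only: mult_cancel_left) simp
qed

text \<open>As \<open>B\<close> is odd, \<open>B^2\<close> is 1 modulo 8, so the parity of
  \<open>A C\<close>, which decides the sum of four terms, can be read off from \<open>- D\<close>
  modulo 8.\<close>

lemma form_gauss_sum_2:
  assumes D: "bqf_disc Q = - D" "odd D" and b: "odd b"
  shows "form_gauss_sum Q b 2 = 2 * of_int (kronecker_prime (- D) 2)"
proof -
  obtain A B C where Q: "Q = BQF A B C" by (cases Q)
  have D': "- D = B^2 - 4 * A * C" using D by (simp add: Q bqf_disc_def)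
  have B: "odd B" 
  proof -
    have "D = 2 * (2 * (A * C)) - B * B" using D' by (simp add: power2_eq_square)
    then show ?thesis using D(2) by simp
  qed
  have r: "root_of_unity 2 n = (if even n then 1 else -1)" for n
  proof (cases "even n")
    case False
    then obtain k where "n = 2 * k + 1" by (elim oddE)
    moreover have "root_of_unity 2 1 = -1"
      by (simp add: root_of_unity_def nome_def)
    ultimately show ?thesis
      using root_of_unity_multiple[of 2 k] by (simp add: root_of_unity_add)
  qed (auto simp: root_of_unity_multiple elim: evenE)
  have "residue_box 2 = {(0, 0), (0, 1), (1, 0), (1, 1)}" by force
  then have "form_gauss_sum Q b 2 = (if even (A * C) then 2 else -2)"
    using B b by (auto simp: form_gauss_sum_def r Q bqf_eval_def)
  moreover have "(- D) mod 8 = (if even (A * C) then 1 else 5)"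
  proof -
    obtain k where k: "B = 2 * k + 1" using B by (elim oddE)
    have "even (k * (k + 1))" by simp
    then obtain l where l: "k * (k + 1) = 2 * l" by (elim evenE)
    have "B^2 = 4 * (k * (k + 1)) + 1" unfolding k by (simp add: power2_eq_square algebra_simps)
    then have B2: "- D = 8 * l + 1 - 4 * (A * C)" unfolding D' l by simp
    show ?thesis
    proof (cases "even (A * C)")
      case True
      then obtain m where "A * C = 2 * m" by (elim evenE)
      then show ?thesis using True unfolding B2 by presburger
    next
      case False
      then obtain m where "A * C = 2 * m + 1" by (elim oddE)
      then show ?thesis using False unfolding B2 by presburger
    qed
  qed
  ultimately show ?thesis
    using D(2) by (simp add: kronecker_prime_def)
qed

lemma form_gauss_sum_prime:
  assumes q: "prime q" and D: "bqf_disc Q = - D" and cop: "\<not> q dvd D" "\<not> q dvd b"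
  shows "form_gauss_sum Q b q = of_int (q * kronecker_prime (- D) q)"
proof (cases "q = 2")
  case True
  then show ?thesis using form_gauss_sum_2[OF D] cop by simp
next
  case False
  then have q2: "q > 2" using prime_gt_1_int[OF q] by linarith
  have "\<not> [- D = 0] (mod q)" using cop by (simp add: cong_0_iff)
  then have "Legendre (- D) q = 1 \<or> Legendre (- D) q = -1" by (auto simp: Legendre_def)
  then show ?thesis
    using form_gauss_sum_prime_split[OF q q2 cop(1) D cop(2)]
      form_gauss_sum_prime_inert[OF q q2 cop(1) D cop(2)] False
    by (auto simp: kronecker_prime_def)
qed

text \<open>Induction on \<open>d\<close>, splitting off a prime \<open>q\<close>: a factor
  \<open>q^2\<close> by the rule for squares, a simple factor by coprime multiplicativity. The
  latter multiplies \<open>b\<close> by the complementary modulus, so \<open>b\<close> has to stay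
  arbitrary in the induction.\<close>

theorem form_gauss_sum_eq:
  assumes D: "bqf_disc Q = - D" and "d > 0" "coprime d (b * D)"
  shows "form_gauss_sum Q b d = of_int (d * kronecker (- D) d)"
proof -
  define n where "n = nat d"
  have "form_gauss_sum Q b (int n) = of_int (int n * kronecker (- D) (int n))"
    if "n > 0" "coprime (int n) (b * D)" for n b
    using that
  proof (induction n arbitrary: b rule: less_induct)
    case (less n)
    show ?case
    proof (cases "n = 1")
      case False
      then obtain p where p: "prime p" "p dvd n" using prime_factor_nat by blast
      define q where "q = int p"
      have q: "prime q" "q > 0" using p by (auto simp: q_def prime_gt_0_nat)
      obtain m where m: "n = p * m" using p(2) by (elim dvdE)
      have m0: "m > 0" "m < n" using less.prems(1) m p(1) prime_gt_1_nat[OF p(1)] by auto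
      have n: "int n = q * int m" by (simp add: m q_def)
      have cop: "coprime q (b * D)" "coprime (int m) (b * D)"
        using less.prems(2) unfolding n by (simp_all add: coprime_mult_left_iff)
      have nd: "\<not> q dvd D" "\<not> q dvd b"
        using cop(1) q(1) not_prime_unit[of q] by (auto simp: coprime_def intro: dvd_mult dvd_mult2)
      show ?thesis
      proof (cases "p dvd m")
        case True
        then obtain l where l: "m = p * l" by (elim dvdE)
        then have "l > 0" using m0 by simp
        moreover have "l \<le> m" unfolding l using prime_gt_0_nat[OF p(1)] by simp
        ultimately have l0: "l > 0" "l < n" using m0 by auto
        have copl: "coprime (int l) (b * D)" using cop(2) by (simp add: l coprime_mult_left_iff)
        have nl: "int n = q^2 * int l" by (simp add: n l q_def power2_eq_square)
        have "kronecker (- D) (int n) = kronecker (- D) q * kronecker (- D) q * kronecker (- D) (int l)"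
          using q(2) l0 unfolding nl power2_eq_square by (simp add: kronecker_mult_pos)
        also have "\<dots> = kronecker (- D) (int l)"
          using kronecker_prime_square[OF q(1), of "- D"] nd by (simp add: kronecker_prime_eq[OF q(1)])
        finally have k: "kronecker (- D) (int n) = kronecker (- D) (int l)" .
        have "form_gauss_sum Q b (int n) = of_int (q^2) * form_gauss_sum Q b (int l)"
          unfolding nl using l0 by (intro form_gauss_sum_square[OF D q(2) cop(1)]) simp
        then show ?thesis
          using less.IH[OF l0(2,1) copl] unfolding k by (simp add: nl)
      next
        case False
        then have "coprime p m" using p(1) by (simp add: prime_imp_coprime)
        then have qm: "coprime q (int m)" by (simp add: q_def)
        have "form_gauss_sum Q b (int n) = form_gauss_sum Q (b * int m) q * form_gauss_sum Q (b * q) (int m)"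
          unfolding n using q(2) m0 qm by (intro form_gauss_sum_mult_coprime) auto
        also have "form_gauss_sum Q (b * int m) q = of_int (q * kronecker (- D) q)"
          unfolding kronecker_prime_eq[OF q(1)]
        proof (rule form_gauss_sum_prime[OF q(1) D nd(1)])
          have "\<not> q dvd int m" using False by (simp add: q_def)
          then show "\<not> q dvd b * int m" using nd q(1) by (simp add: prime_dvd_mult_iff)
        qed
        also have "form_gauss_sum Q (b * q) (int m) = of_int (int m * kronecker (- D) (int m))"
          using cop(2) qm by (intro less.IH m0) (auto simp: coprime_mult_right_iff coprime_commute)
        finally show ?thesis
          using q(2) m0 by (simp add: n kronecker_mult_pos)
      qed
    qed simp
  qed
  from this[of n b] show ?thesis using assms by (simp add: n_def)
qed

theorem theta_transformation:
  fixes a b c d D :: int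
  assumes Q: "coeff_a Q > 0" and D: "bqf_disc Q = - D" "D > 1" and z: "z \<in> upper_half_plane"
    and det: "a * d - b * c = 1" and c: "D dvd c"
  shows "theta Q ((of_int a * z + of_int b) / (of_int c * z + of_int d)) =
    (of_int c * z + of_int d) * of_int (kronecker (- D) d) * theta Q z"
proof -
  have pos: "theta Q ((of_int a * z + of_int b) / (of_int c * z + of_int d)) =
    (of_int c * z + of_int d) * of_int (kronecker (- D) d) * theta Q z"
    if det: "a * d - b * c = 1" and c: "D dvd c" and d: "d > 0" for a b c d :: int
  proof -
    obtain c' where c': "c = c' * D" using c by (metis dvdE mult.commute)
    have "coprime d (b * D)"
    proof (rule coprimeI)
      fix e assume e: "e dvd d" "e dvd b * D"
      have "e dvd a * d - c' * (b * D)" by (rule dvd_diff[OF dvd_mult[OF e(1)] dvd_mult[OF e(2)]])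
      also have "a * d - c' * (b * D) = 1" using det c' by (simp add: mult_ac)
      finally show "is_unit e" .
    qed
    from form_gauss_sum_eq[OF D(1) d this] d
    have "form_gauss_sum Q b d / of_int d = of_int (kronecker (- D) d)" by simp
    then show ?thesis
      using theta_transformation_Gauss[OF Q D(1) _ z det c' d] D(2) by simp
  qed
  show ?thesis
  proof (cases "d > 0")
    case True
    then show ?thesis using pos[OF det c] by simp
  next
    case False
    \<comment> \<open>With \<open>d = 0\<close> the determinant condition would make
      \<open>c\<close>, and with it its divisor \<open>D\<close>, a unit; here \<open>D > 1\<close>
      enters.\<close>
    have "d \<noteq> 0"
    proof
      assume "d = 0"
      then have "D dvd 1" using det c by (metis diff_0 dvd_minus_iff dvd_mult mult_zero_right)
      then show False using D(2) by simp
    qed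
    then have d: "- d > 0" using False by simp
    have "theta Q ((of_int (- a) * z + of_int (- b)) / (of_int (- c) * z + of_int (- d))) =
      (of_int (- c) * z + of_int (- d)) * of_int (kronecker (- D) (- d)) * theta Q z"
      using det c d by (intro pos) auto
    moreover have "kronecker (- D) d = - kronecker (- D) (- d)"
      using kronecker_neg[OF d, of "- D"] D(2) by simp
    moreover have "(of_int (- a) * z + of_int (- b)) / (of_int (- c) * z + of_int (- d)) =
        (of_int a * z + of_int b) / (of_int c * z + of_int d)"
    proof -
      have "(of_int (- a) * z + of_int (- b)) / (of_int (- c) * z + of_int (- d)) =
        (- (of_int a * z + of_int b)) / (- (of_int c * z + of_int d))" by simp
      then show ?thesis by (simp only: minus_divide_divide)
    qed
    ultimately show ?thesis by (simp add: algebra_simps)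
  qed
qed

section \<open>Power series and behaviour at the cusps\<close>

lemma finite_bqf_representations:
  assumes "coeff_a Q > 0" "bqf_disc Q < 0"
  shows "finite {(x, y). bqf_eval Q x y = n}"
proof (cases "n \<ge> 0")
  case True
  obtain A B C where Q: "Q = BQF A B C" by (cases Q)
  have "A > 0" and D: "B^2 - 4 * A * C < 0" using assms by (auto simp: Q bqf_disc_def)
  have "0 < 4 * A * C" using D zero_le_power2[of B] by linarith
  then have C: "C > 0" using \<open>A > 0\<close> by (simp add: zero_less_mult_iff)
  \<comment> \<open>Completing the square gives \<open>y^2 \<le> 4 A n\<close> and
    \<open>x^2 \<le> 4 C n\<close>, because the integer \<open>4 A C - B^2\<close> is at least 1;
    \<open>M\<close> exceeds both bounds.\<close>
  define M where "M = 4 * (A + C) * n"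
  have M: "\<bar>x\<bar> \<le> M \<and> \<bar>y\<bar> \<le> M" if "bqf_eval Q x y = n" for x y
  proof -
    have "4 * A * n = (2 * A * x + B * y)^2 + (4 * A * C - B^2) * y^2"
      "4 * C * n = (2 * C * y + B * x)^2 + (4 * A * C - B^2) * x^2"
      unfolding that[symmetric] Q bqf_eval_def by (simp_all add: algebra_simps power2_eq_square)
    then have "(4 * A * C - B^2) * y^2 \<le> 4 * A * n" "(4 * A * C - B^2) * x^2 \<le> 4 * C * n" by simp_all
    moreover have "1 * y^2 \<le> (4 * A * C - B^2) * y^2" "1 * x^2 \<le> (4 * A * C - B^2) * x^2"
      using D by (intro mult_right_mono; simp)+
    moreover have "4 * A * n \<le> M" "4 * C * n \<le> M"
      using \<open>A > 0\<close> C True by (simp_all add: M_def algebra_simps)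
    ultimately have "y^2 \<le> M" "x^2 \<le> M" by linarith+
    moreover have "\<bar>z\<bar> \<le> z^2" for z :: int
    proof (cases "z = 0")
      case False
      then have "\<bar>z\<bar> * 1 \<le> \<bar>z\<bar> * \<bar>z\<bar>" by (intro mult_left_mono) auto
      then show ?thesis by (simp add: power2_eq_square)
    qed simp
    ultimately show ?thesis by (meson order_trans)
  qed
  have "{(x, y). bqf_eval Q x y = n} \<subseteq> {-M..M} \<times> {-M..M}"
    using M by (force simp: abs_le_iff)
  then show ?thesis by (rule finite_subset) simp
next
  case False
  then have "{(x, y). bqf_eval Q x y = n} = {}"
    using bqf_eval_nonneg[OF assms] by force
  then show ?thesis by simp
qed

text \<open>The level sets of the form partition the lattice, and absolute convergence permits
  summing over them one by one.\<close>

lemma theta_has_sum: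
  assumes Q: "coeff_a Q > 0" "bqf_disc Q < 0" and z: "z \<in> upper_half_plane"
  shows "((\<lambda>n. of_nat (num_reps n Q) * nome z ^ n) has_sum theta Q z) UNIV"
proof -
  let ?f = "\<lambda>(x, y). nome z powi bqf_eval Q x y"
  let ?B = "\<lambda>n. {(x, y). bqf_eval Q x y = int n}"
  have "?f summable_on UNIV"
  proof (rule abs_summable_summable)
    have "(\<lambda>(x, y). norm (1 * nome (of_int (bqf_eval Q x y) * z))) summable_on UNIV"
      using z by (intro summable_on_weighted_theta[OF Q, where \<psi> = "\<lambda>_ _. 1"]) (auto simp: upper_half_plane_def)
    then show "(\<lambda>p. norm (?f p)) summable_on UNIV"
      by (simp add: nome_of_int_mult case_prod_unfold)
  qed
  then have f: "(?f has_sum theta Q z) UNIV"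
    unfolding theta_def by (rule has_sum_infsum)
  have inj: "inj_on snd (SIGMA n:UNIV. ?B n)"
    by (auto simp: inj_on_def)
  have im: "snd ` (SIGMA n:UNIV. ?B n) = UNIV"
  proof (intro equalityI subsetI)
    fix p :: "int \<times> int"
    have "(nat (bqf_eval Q (fst p) (snd p)), p) \<in> (SIGMA n:UNIV. ?B n)"
      using bqf_eval_nonneg[OF Q] by (auto simp: case_prod_unfold)
    then show "p \<in> snd ` (SIGMA n:UNIV. ?B n)" by (rule rev_image_eqI) simp
  qed simp
  have "((?f \<circ> snd) has_sum theta Q z) (SIGMA n:UNIV. ?B n)"
    using f has_sum_reindex[OF inj, of ?f] unfolding im by simp
  then show ?thesis
  proof (rule has_sum_SigmaD)
    fix n :: nat
    have "((\<lambda>p. nome z ^ n) has_sum of_nat (num_reps n Q) * nome z ^ n) (?B n)"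
      using has_sum_finite[OF finite_bqf_representations[OF Q], of "\<lambda>p. nome z ^ n" "int n"]
      by (simp add: num_reps_def)
    then show "((\<lambda>p. (?f \<circ> snd) (n, p)) has_sum of_nat (num_reps n Q) * nome z ^ n) (?B n)"
      by (rule has_sum_cong[THEN iffD1, rotated]) auto
  qed
qed

lemma theta_sums:
  assumes "coeff_a Q > 0" "bqf_disc Q < 0" "z \<in> upper_half_plane"
  shows "(\<lambda>n. of_nat (num_reps n Q) * nome z ^ n) sums theta Q z"
  using theta_has_sum[OF assms] by (rule has_sum_imp_sums)

lemma num_reps_0:
  assumes "coeff_a Q > 0" "bqf_disc Q < 0"
  shows "num_reps 0 Q = 1"
proof -
  have *: "x = 0 \<and> y = 0" if "bqf_eval Q x y = 0" for x y
  proof -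
    have "0 = 4 * coeff_a Q * bqf_eval Q x y" using that by simp
    also have "\<dots> = (2 * coeff_a Q * x + coeff_b Q * y)^2 + (- bqf_disc Q) * y^2"
      by (simp add: bqf_eval_def bqf_disc_def power2_eq_square algebra_simps)
    finally have *: "(2 * coeff_a Q * x + coeff_b Q * y)^2 + (- bqf_disc Q) * y^2 = 0" by simp
    have "(- bqf_disc Q) * y^2 \<ge> 0" using assms by (intro mult_nonneg_nonneg) auto
    then have 1: "(- bqf_disc Q) * y^2 = 0" "(2 * coeff_a Q * x + coeff_b Q * y)^2 = 0"
      using * zero_le_power2[of "2 * coeff_a Q * x + coeff_b Q * y"] by linarith+
    then have "y = 0" using assms by auto
    then show ?thesis using 1(2) assms by simp
  qed
  have 0: "bqf_eval Q 0 0 = 0" by (simp add: bqf_eval_def)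
  have "{(x, y). bqf_eval Q x y = int 0} = {(0, 0)}"
    by (auto dest!: * simp: 0)
  then show ?thesis by (simp add: num_reps_def)
qed

text \<open>The expansion starts at index 1 since both constant terms count only the zero vector;
  this is what yields vanishing at infinity.\<close>

lemma theta_diff_sums:
  assumes Q: "coeff_a Q > 0" "bqf_disc Q < 0" and Q': "coeff_a Q' > 0" "bqf_disc Q' < 0"
    and z: "z \<in> upper_half_plane"
  shows "(\<lambda>n. (of_nat (num_reps (Suc n) Q) - of_nat (num_reps (Suc n) Q')) / 2 * nome z ^ Suc n) sums theta_diff Q Q' z"
proof -
  have "(\<lambda>n. (of_nat (num_reps n Q) * nome z ^ n - of_nat (num_reps n Q') * nome z ^ n) / 2) sums theta_diff Q Q' z"
    unfolding theta_diff_def by (intro sums_divide sums_diff theta_sums Q Q' z)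
  then have "(\<lambda>n. (of_nat (num_reps n Q) - of_nat (num_reps n Q')) / 2 * nome z ^ n) sums theta_diff Q Q' z"
    by (simp only: left_diff_distrib[symmetric] times_divide_eq_left)
  then show ?thesis
    by (subst sums_Suc_iff) (simp add: num_reps_0[OF Q] num_reps_0[OF Q'])
qed

lemma nome_image_upper_half_plane:
  assumes "w \<noteq> 0" "norm w < 1"
  obtains z where "z \<in> upper_half_plane" "nome z = w"
proof
  define z where "z = Ln w / (2 * of_real pi * \<i>)"
  show w: "nome z = w" using assms by (simp add: z_def nome_def)
  have "exp (- 2 * pi * Im z) < 1" using assms(2) unfolding w[symmetric] norm_nome .
  then show "z \<in> upper_half_plane" by (simp add: upper_half_plane_def zero_less_mult_iff)
qed

lemma nome_tendsto_0: "(nome \<longlongrightarrow> 0) (filtercomap Im at_top)"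
proof (rule tendsto_norm_zero_cancel)
  have "((\<lambda>y. exp (- 2 * pi * y)) \<longlongrightarrow> 0) at_top" by real_asymp
  from filterlim_compose[OF this filterlim_filtercomap]
  show "((\<lambda>z. norm (nome z)) \<longlongrightarrow> 0) (filtercomap Im at_top)" by (simp add: norm_nome)
qed

lemma eventually_upper_half_plane: "eventually (\<lambda>z. z \<in> upper_half_plane) (filtercomap Im at_top)"
  unfolding upper_half_plane_def mem_Collect_eq
  by (intro eventually_filtercomapI eventually_gt_at_top)

text \<open>Taking out one factor \<open>nome z\<close> leaves a power series in
  \<open>nome z\<close> that is continuous at 0, and \<open>nome z\<close> tends to 0 uniformly in
  the real part.\<close>

lemma theta_diff_tendsto_0:
  assumes Q: "coeff_a Q > 0" "bqf_disc Q < 0" and Q': "coeff_a Q' > 0" "bqf_disc Q' < 0"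
  shows "(theta_diff Q Q' \<longlongrightarrow> 0) (filtercomap Im at_top)"
proof -
  define t where "t n = (of_nat (num_reps (Suc n) Q) - of_nat (num_reps (Suc n) Q')) / (2 :: complex)" for n
  define g where "g w = (\<Sum>n. t n * w ^ n)" for w
  have sums: "(\<lambda>n. nome z * (t n * nome z ^ n)) sums theta_diff Q Q' z" if "z \<in> upper_half_plane" for z
    using theta_diff_sums[OF Q Q' that] by (simp add: t_def mult_ac)
  have i: "\<i> \<in> upper_half_plane" by (simp add: upper_half_plane_def)
  have sm: "summable (\<lambda>n. t n * nome z ^ n)" if "z \<in> upper_half_plane" for z
    using sums[OF that] summable_mult_D[of "nome z"] by (auto simp: sums_iff)
  have eq: "theta_diff Q Q' z = nome z * g (nome z)" if "z \<in> upper_half_plane" for z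
    using sums_unique2[OF sums[OF that] sums_mult[OF summable_sums[OF sm[OF that]]]] by (simp add: g_def)
  have "isCont g 0"
    unfolding g_def using isCont_powser[OF sm[OF i], of 0] by simp
  then have "((\<lambda>z. g (nome z)) \<longlongrightarrow> g 0) (filtercomap Im at_top)"
    by (rule isCont_tendsto_compose[OF _ nome_tendsto_0])
  from tendsto_mult[OF nome_tendsto_0 this]
  have "((\<lambda>z. nome z * g (nome z)) \<longlongrightarrow> 0) (filtercomap Im at_top)" by simp
  then show ?thesis
    by (rule Lim_transform_eventually) (use eventually_upper_half_plane eq in \<open>auto elim: eventually_mono\<close>)
qed

text \<open>The inversion formula at \<open>z / D\<close>, solved for the other side: the shape
  needed at the cusp 0.\<close>

lemma theta_at_minus_inverse:
  assumes Q: "coeff_a Q > 0" and D: "bqf_disc Q = - D" "D > 0" and z: "z \<in> upper_half_plane"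
  shows "theta Q (- 1 / z) = - \<i> * z / of_real (sqrt (of_int D)) * theta Q (z / of_int D)"
proof -
  have z0: "z \<noteq> 0" using z by (auto simp: upper_half_plane_def)
  have "z / of_int D \<in> upper_half_plane"
    using z D by (simp add: upper_half_plane_def)
  from theta_inversion[OF Q D this]
  have "theta Q (z / of_int D) = \<i> * of_int D / (z * of_real (sqrt (of_int D))) * theta Q (- 1 / z)"
    using D by simp
  moreover have "(of_int D :: complex) = of_real (sqrt (of_int D)) * of_real (sqrt (of_int D))"
    using D by (simp flip: of_real_mult)
  moreover have "of_real (sqrt (of_int D)) \<noteq> (0 :: complex)" using D by simp
  ultimately show ?thesis using z0 by (simp add: field_simps)
qed

text \<open>If \<open>D\<close> is prime, a matrix \<open>\<gamma>\<close> outside \<open>\<Gamma>\<^sub>0(D)\<close> is \<open>\<gamma>' S T\<^sup>j\<close> with \<open>\<gamma>'\<close> in \<open>\<Gamma>\<^sub>0(D)\<close>, and the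
  inversion formula reduces the cusp \<open>0\<close> to the cusp \<open>\<infinity>\<close>.\<close>

theorem theta_diff_cusp_form:
  fixes D :: nat
  assumes p: "prime D"
    and Q: "coeff_a Q > 0" "bqf_disc Q = - int D" and Q': "coeff_a Q' > 0" "bqf_disc Q' = - int D"
  shows "is_cusp_form 1 D (\<lambda>d. of_int (kronecker (- int D) d)) (theta_diff Q Q')"
proof -
  let ?f = "theta_diff Q Q'" and ?\<psi> = "\<lambda>d. of_int (kronecker (- int D) d) :: complex"
  have D: "int D > 1" "int D > 0" using prime_gt_1_nat[OF p] by simp_all
  have neg: "bqf_disc Q < 0" "bqf_disc Q' < 0" using Q Q' D by simp_all
  have hol: "?f holomorphic_on upper_half_plane"
    unfolding theta_diff_def[abs_def] theta_eq_weighted_theta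
    by (intro holomorphic_intros holomorphic_weighted_theta Q Q' neg) auto
  have trans: "?f ((of_int a * z + of_int b) / (of_int c * z + of_int d)) = (of_int c * z + of_int d) * ?\<psi> d * ?f z"
    if "a * d - b * c = 1" "int D dvd c" "z \<in> upper_half_plane" for a b c d z
    unfolding theta_diff_def
      theta_transformation[OF Q D(1) that(3,1,2)] theta_transformation[OF Q' D(1) that(3,1,2)]
    by (simp only: right_diff_distrib times_divide_eq_right)
  have slash_eq: "slash 1 (a, b, c, d) ?f z = ?\<psi> d * ?f z"
    if "a * d - b * c = 1" "int D dvd c" "z \<in> upper_half_plane" for a b c d z
    using moebius_in_upper_half_plane(2)[OF that(1,3)] unfolding slash_def trans[OF that] case_prod_conv
    by (simp add: power_int_minus)
  have tend: "(slash 1 \<gamma> ?f \<longlongrightarrow> 0) (filtercomap Im at_top)" if "\<gamma> \<in> SL2Z" for \<gamma>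
  proof -
    obtain a b c d where \<gamma>: "\<gamma> = (a, b, c, d)" by (cases \<gamma>)
    have det: "a * d - b * c = 1" using that by (simp add: \<gamma> SL2Z_def)
    note lim = theta_diff_tendsto_0[OF Q(1) neg(1) Q'(1) neg(2)]
    show ?thesis
    proof (cases "int D dvd c")
      case True
      have "((\<lambda>z. ?\<psi> d * ?f z) \<longlongrightarrow> 0) (filtercomap Im at_top)"
        using tendsto_mult[OF tendsto_const lim] by simp
      then show ?thesis
        by (rule Lim_transform_eventually)
           (use eventually_upper_half_plane slash_eq[OF det True] in \<open>auto simp: \<gamma> elim!: eventually_mono\<close>)
    next
      case False
      then have "coprime c (int D)" using p by (simp add: coprime_commute[of c] prime_imp_coprime)
      then obtain x where x: "[c * x = 1] (mod int D)" using cong_solve_coprime_int by blast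
      \<comment> \<open>Since \<open>c j\<close> is congruent to \<open>d\<close> modulo
        \<open>D\<close>, the matrix with rows \<open>(a j - b, a)\<close> and
        \<open>(c j - d, c)\<close> lies in \<open>Gamma0 D\<close>, and it takes
        \<open>- 1 / (z + j)\<close> to \<open>\<gamma> z\<close>.\<close>
      define j where "j = x * d"
      have "[c * x * d = 1 * d] (mod int D)" using x by (rule cong_scalar_right)
      then have j: "int D dvd c * j - d" by (simp add: j_def cong_iff_dvd_diff mult.assoc)
      have det': "(a * j - b) * c - a * (c * j - d) = 1" using det by (simp add: algebra_simps)
      have eq: "slash 1 \<gamma> ?f z = ?\<psi> c * (- \<i> / of_real (sqrt D)) * ?f ((z + of_int j) / of_int (int D))"
        if z: "z \<in> upper_half_plane" for z
      proof -
        define z1 where "z1 = z + of_int j"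
        have z1: "z1 \<in> upper_half_plane" "z1 \<noteq> 0"
          using z by (auto simp: z1_def upper_half_plane_def complex_eq_iff)
        have u: "- 1 / z1 \<in> upper_half_plane"
          using z1 by (simp add: upper_half_plane_def Im_divide')
        have J: "of_int c * z + of_int d \<noteq> 0" by (rule moebius_in_upper_half_plane(2)[OF det z])
        have J': "of_int (c * j - d) * (- 1 / z1) + of_int c = (of_int c * z + of_int d) / z1"
          using z1(2) by (simp add: z1_def field_simps)
        have N': "of_int (a * j - b) * (- 1 / z1) + of_int a = (of_int a * z + of_int b) / z1"
          using z1(2) by (simp add: z1_def field_simps)
        have "?f ((of_int a * z + of_int b) / (of_int c * z + of_int d)) =
            ?f ((of_int (a * j - b) * (- 1 / z1) + of_int a) / (of_int (c * j - d) * (- 1 / z1) + of_int c))"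
          unfolding J' N' using z1(2) by simp
        also have "\<dots> = (of_int c * z + of_int d) / z1 * ?\<psi> c * ?f (- 1 / z1)"
          by (subst trans[OF det' j u]) (simp only: J')
        \<comment> \<open>The factor \<open>z1\<close> of the inversion cancels the
          \<open>1 / z1\<close> of the automorphy factor, so the slashed function is a constant
          times \<open>?f\<close> at \<open>(z + j) / D\<close>.\<close>
        also have "?f (- 1 / z1) = (- \<i> * z1 / of_real (sqrt D)) * ?f (z1 / of_int (int D))"
          unfolding theta_diff_def
            theta_at_minus_inverse[OF Q D(2) z1(1)] theta_at_minus_inverse[OF Q' D(2) z1(1)]
          by (simp only: right_diff_distrib times_divide_eq_right of_int_of_nat_eq)
        finally show ?thesis
          unfolding \<gamma> slash_def case_prod_conv z1_def[symmetric]
          using J z1(2) by (simp add: power_int_minus)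
      qed
      have "filterlim (\<lambda>z. (z + of_int j) / of_int (int D)) (filtercomap Im at_top) (filtercomap Im at_top)"
        unfolding filterlim_filtercomap_iff
      proof -
        have "filterlim (\<lambda>y. y / real D) at_top at_top"
          using D by (intro filterlim_at_top_mult_tendsto_pos[where f = "\<lambda>_. 1 / real D" and c = "1 / real D", simplified] filterlim_ident) auto
        from filterlim_compose[OF this filterlim_filtercomap]
        show "filterlim (Im \<circ> (\<lambda>z. (z + of_int j) / of_int (int D))) at_top (filtercomap Im at_top)"
          by (simp add: o_def)
      qed
      from filterlim_compose[OF lim this]
      have "((\<lambda>z. ?\<psi> c * (- \<i> / of_real (sqrt D)) * ?f ((z + of_int j) / of_int (int D))) \<longlongrightarrow> 0) (filtercomap Im at_top)"
        by (intro tendsto_mult_right_zero)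
      then show ?thesis
        by (rule Lim_transform_eventually) (use eventually_upper_half_plane eq in \<open>auto elim!: eventually_mono\<close>)
    qed
  qed
  show ?thesis
    unfolding is_cusp_form_def
    using hol slash_eq tend by (auto simp: Gamma0_def SL2Z_def)
qed

section \<open>Reduction theory\<close>

definition bqf_act :: "bqf \<Rightarrow> int \<Rightarrow> int \<Rightarrow> int \<Rightarrow> int \<Rightarrow> bqf" where
  "bqf_act Q p q r s = BQF (bqf_eval Q p r)
     (2 * coeff_a Q * p * q + coeff_b Q * (p * s + q * r) + 2 * coeff_c Q * r * s) (bqf_eval Q q s)"

lemma bqf_eval_act: "bqf_eval (bqf_act Q p q r s) x y = bqf_eval Q (p * x + q * y) (r * x + s * y)"
  by (simp add: bqf_act_def bqf_eval_def algebra_simps power2_eq_square)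

lemma bqf_eqI:
  assumes "\<And>x y. bqf_eval Q x y = bqf_eval Q' x y"
  shows "Q = Q'"
  using assms[of 1 0] assms[of 0 1] assms[of 1 1]
  by (cases Q; cases Q') (simp add: bqf_eval_def)

lemma properly_equivalent_iff:
  "properly_equivalent Q1 Q2 \<longleftrightarrow> (\<exists>p q r s. p * s - q * r = 1 \<and> Q1 = bqf_act Q2 p q r s)"
  unfolding properly_equivalent_def by (metis bqf_eqI bqf_eval_act)

lemma bqf_disc_act: "bqf_disc (bqf_act Q p q r s) = (p * s - q * r)^2 * bqf_disc Q"
  by (simp add: bqf_act_def bqf_disc_def bqf_eval_def algebra_simps power2_eq_square)

lemma bqf_eval_pos:
  assumes "coeff_a Q > 0" "bqf_disc Q < 0" "(x, y) \<noteq> (0, 0)"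
  shows "bqf_eval Q x y > 0"
proof -
  have "4 * coeff_a Q * bqf_eval Q x y = (2 * coeff_a Q * x + coeff_b Q * y)^2 + (- bqf_disc Q) * y^2"
    by (simp add: bqf_eval_def bqf_disc_def power2_eq_square algebra_simps)
  also have "\<dots> > 0"
  proof (cases "y = 0")
    case True
    then show ?thesis using assms by simp
  next
    case False
    then have "(- bqf_disc Q) * y^2 > 0" using assms(2) by (intro mult_pos_pos) auto
    then show ?thesis using zero_le_power2[of "2 * coeff_a Q * x + coeff_b Q * y"] by linarith
  qed
  finally show ?thesis using assms(1) by (simp add: zero_less_mult_iff)
qed

text \<open>A common factor \<open>g\<close> of the coefficients gives the discriminant
  \<open>g^2 e\<close> with \<open>e\<close> again 0 or 1 modulo 4. The delicate case is even
  \<open>g\<close>: the quotient by 4 is squarefree, hence equal to \<open>e\<close>, but it is 2 or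
  3 modulo 4. Primitivity need not be tracked from here on.\<close>

lemma fundamental_discriminant_primitive:
  assumes "fundamental_discriminant (bqf_disc Q)"
  shows "bqf_primitive Q"
proof -
  obtain a b c where Q: "Q = BQF a b c" by (cases Q)
  define g where "g = Gcd {a, b, c}"
  have "g dvd x" if "x \<in> {a, b, c}" for x
    unfolding g_def using that by (rule Gcd_dvd)
  then have "g dvd a" "g dvd b" "g dvd c" by simp_all
  then obtain a' b' c' where abc: "a = g * a'" "b = g * b'" "c = g * c'" by (auto elim!: dvdE)
  define e where "e = b'^2 - 4 * a' * c'"
  have disc: "bqf_disc Q = g^2 * e"
    by (simp add: Q bqf_disc_def abc e_def algebra_simps power2_eq_square)
  have "is_unit g"
  proof (cases "bqf_disc Q mod 4 = 1")
    case True
    then have "squarefree (bqf_disc Q)"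
      using assms by (auto simp: fundamental_discriminant_def)
    moreover have "g^2 dvd bqf_disc Q" by (simp add: disc)
    ultimately show ?thesis by (auto simp: squarefree_def)
  next
    case False
    define m where "m = bqf_disc Q div 4"
    have m: "bqf_disc Q = 4 * m" "m mod 4 \<in> {2, 3}" "squarefree m"
      using assms False by (auto simp: fundamental_discriminant_def m_def)
    have e4: "e mod 4 \<in> {0, 1}"
    proof (cases "even b'")
      case True
      then obtain k where "b' = 2 * k" by (elim evenE)
      then have "e = 4 * (k^2 - a' * c')" by (simp add: e_def power2_eq_square)
      then show ?thesis by simp
    next
      case False
      then obtain k where "b' = 2 * k + 1" by (elim oddE)
      then have "\<exists>l. e = 1 + 4 * l"
        by (intro exI[of _ "k^2 + k - a' * c'"]) (simp add: e_def power2_eq_square algebra_simps)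
      then show ?thesis by auto
    qed
    show ?thesis
    proof (cases "even g")
      case True
      then obtain h where h: "g = 2 * h" by (elim evenE)
      have hm: "m = h^2 * e" using disc m(1) by (simp add: h power2_eq_square)
      then have "is_unit h" using m(3) by (auto simp: squarefree_def)
      then have "h^2 = 1" by (auto simp: zdvd1_eq abs_if power2_eq_square split: if_splits)
      then have "m = e" using hm by simp
      then show ?thesis using m(2) e4 by auto
    next
      case False
      then have "coprime (g^2) 4" by (metis coprime_power_left_iff coprime_power_right_iff coprime_right_2_iff_odd num_double numeral_mult power2_eq_square)
      moreover have "g^2 dvd 4 * m" using disc m(1) by (metis dvd_triv_left)
      ultimately have "g^2 dvd m" by (simp add: coprime_dvd_mult_right_iff)
      then show ?thesis using m(3) by (auto simp: squarefree_def)
    qed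
  qed
  moreover have "g \<ge> 0" unfolding g_def by (rule Gcd_int_greater_eq_0)
  ultimately have "g = 1" by simp
  then show ?thesis by (simp add: bqf_primitive_def Q g_def)
qed

lemma forms_of_disc_eq:
  assumes "fundamental_discriminant d" "d < 0"
  shows "forms_of_disc d = {Q. coeff_a Q > 0 \<and> bqf_disc Q = d}"
proof -
  have "bqf_pos_def Q \<longleftrightarrow> coeff_a Q > 0" if "bqf_disc Q = d" for Q
  proof
    assume "bqf_pos_def Q"
    then have "bqf_eval Q 1 0 > 0" by (simp add: bqf_pos_def_def)
    then show "coeff_a Q > 0" by (simp add: bqf_eval_def)
  next
    assume "coeff_a Q > 0"
    then show "bqf_pos_def Q"
      unfolding bqf_pos_def_def using bqf_eval_pos assms(2) that by blast
  qed
  then show ?thesis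
    using fundamental_discriminant_primitive assms(1) by (auto simp: forms_of_disc_def)
qed

lemma properly_equivalent_refl: "properly_equivalent Q Q"
  unfolding properly_equivalent_def by (intro exI[of _ 1] exI[of _ 0]) simp

lemma properly_equivalent_sym:
  assumes "properly_equivalent Q1 Q2"
  shows "properly_equivalent Q2 Q1"
proof -
  obtain p q r s where det: "p * s - q * r = 1" and ev: "\<And>x y. bqf_eval Q1 x y = bqf_eval Q2 (p * x + q * y) (r * x + s * y)"
    using assms by (auto simp: properly_equivalent_def)
  have "bqf_eval Q2 x y = bqf_eval Q1 (s * x + (- q) * y) ((- r) * x + p * y)" for x y
  proof -
    have "p * (s * x + (- q) * y) + q * ((- r) * x + p * y) = (p * s - q * r) * x"
      "r * (s * x + (- q) * y) + s * ((- r) * x + p * y) = (p * s - q * r) * y"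
      by (simp_all add: algebra_simps)
    then show ?thesis unfolding ev det by simp
  qed
  moreover have "s * p - (- q) * (- r) = 1" using det by (simp add: mult.commute)
  ultimately show ?thesis unfolding properly_equivalent_def by blast
qed

lemma properly_equivalent_trans:
  assumes "properly_equivalent Q1 Q2" "properly_equivalent Q2 Q3"
  shows "properly_equivalent Q1 Q3"
proof -
  obtain p q r s where 1: "p * s - q * r = 1" "\<And>x y. bqf_eval Q1 x y = bqf_eval Q2 (p * x + q * y) (r * x + s * y)"
    using assms(1) by (auto simp: properly_equivalent_def)
  obtain p' q' r' s' where 2: "p' * s' - q' * r' = 1" "\<And>x y. bqf_eval Q2 x y = bqf_eval Q3 (p' * x + q' * y) (r' * x + s' * y)"
    using assms(2) by (auto simp: properly_equivalent_def)
  have "(p' * p + q' * r) * (r' * q + s' * s) - (p' * q + q' * s) * (r' * p + s' * r) = (p' * s' - q' * r') * (p * s - q * r)"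
    by (simp add: algebra_simps)
  also have "\<dots> = 1" using 1 2 by simp
  finally show ?thesis
    unfolding properly_equivalent_def
    by (intro exI[of _ "p' * p + q' * r"] exI[of _ "p' * q + q' * s"] exI[of _ "r' * p + s' * r"] exI[of _ "r' * q + s' * s"])
       (simp add: 1(2) 2(2) algebra_simps)
qed

lemma properly_equivalent_disc: "properly_equivalent Q1 Q2 \<Longrightarrow> bqf_disc Q1 = bqf_disc Q2"
  by (auto simp: properly_equivalent_iff bqf_disc_act)

lemma properly_equivalent_coeff_a_pos:
  assumes "properly_equivalent Q1 Q2" "coeff_a Q2 > 0" "bqf_disc Q2 < 0"
  shows "coeff_a Q1 > 0"
proof -
  obtain p q r s where *: "p * s - q * r = 1" "Q1 = bqf_act Q2 p q r s"
    using assms(1) by (auto simp: properly_equivalent_iff)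
  have "(p, r) \<noteq> (0, 0)" using *(1) by auto
  then show ?thesis using bqf_eval_pos[OF assms(2,3)] by (simp add: *(2) bqf_act_def)
qed

text \<open>Take a form of the class with least leading coefficient and translate \<open>b\<close>
  into \<open>(-a, a]\<close>. Interchanging the variables makes \<open>c\<close> a leading
  coefficient, so minimality gives \<open>a \<le> c\<close>; the same interchange repairs the sign
  of \<open>b\<close> when \<open>a = c\<close>.\<close>

lemma exists_reduced_form:
  assumes "coeff_a Q > 0" "bqf_disc Q < 0"
  obtains Q' where "bqf_reduced Q'" "properly_equivalent Q' Q"
proof -
  define P where "P = (\<lambda>Q'. properly_equivalent Q' Q)"
  have pos: "coeff_a Q' > 0" if "P Q'" for Q'
    using that properly_equivalent_coeff_a_pos assms by (auto simp: P_def)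
  obtain Q1 where Q1: "P Q1" and min: "\<And>Q'. P Q' \<Longrightarrow> nat (coeff_a Q1) \<le> nat (coeff_a Q')"
    using ex_has_least_nat[of P Q "\<lambda>Q'. nat (coeff_a Q')"] properly_equivalent_refl by (auto simp: P_def)
  have min': "coeff_a Q1 \<le> coeff_a Q'" if "P Q'" for Q'
    using min[OF that] pos[OF that] by simp
  have act: "P (bqf_act Q' p q r s)" if "P Q'" "p * s - q * r = 1" for Q' p q r s
    using that properly_equivalent_trans properly_equivalent_iff unfolding P_def by blast
  obtain a b c where abc: "Q1 = BQF a b c" by (cases Q1)
  have a: "a > 0" using pos[OF Q1] by (simp add: abc)
  \<comment> \<open>The offset \<open>a - 1\<close> centres the residue: \<open>b2\<close> becomes
    \<open>(b + a - 1) mod (2 a) - (a - 1)\<close>, in \<open>(-a, a]\<close>. The lower end is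
    excluded because reducedness forbids \<open>b = - a\<close>.\<close>
  define j where "j = - ((b + a - 1) div (2 * a))"
  define b2 where "b2 = b + 2 * a * j"
  define c2 where "c2 = a * j^2 + b * j + c"
  have b2: "- a < b2" "b2 \<le> a"
  proof -
    have "b2 = (b + a - 1) mod (2 * a) - a + 1"
      unfolding b2_def j_def by (simp add: minus_mult_div_eq_mod[symmetric])
    moreover have "0 \<le> (b + a - 1) mod (2 * a)" "(b + a - 1) mod (2 * a) < 2 * a" using a by simp_all
    ultimately show "- a < b2" "b2 \<le> a" by linarith+
  qed
  have Q2: "P (BQF a b2 c2)"
  proof -
    have "bqf_act Q1 1 j 0 1 = BQF a b2 c2"
      by (simp add: bqf_act_def abc bqf_eval_def b2_def c2_def power2_eq_square algebra_simps)
    then show ?thesis using act[OF Q1, of 1 1 j 0] by simp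
  qed
  have Q3: "P (BQF c2 (- b2) a)"
  proof -
    have "bqf_act (BQF a b2 c2) 0 (- 1) 1 0 = BQF c2 (- b2) a"
      by (simp add: bqf_act_def bqf_eval_def)
    then show ?thesis using act[OF Q2, of 0 0 "-1" 1] by simp
  qed
  have c2: "a \<le> c2" using min'[OF Q3] by (simp add: abc)
  show ?thesis
  proof (cases "a = c2 \<and> b2 < 0")
    case True
    then have "bqf_reduced (BQF c2 (- b2) a)" using b2 by (auto simp: bqf_reduced_def)
    then show ?thesis using Q3 that by (simp add: P_def)
  next
    case False
    then have "bqf_reduced (BQF a b2 c2)" using b2 c2 by (auto simp: bqf_reduced_def)
    then show ?thesis using Q2 that by (simp add: P_def)
  qed
qed

text \<open>In terms of \<open>u = \<bar>x\<bar>\<close> and \<open>v = \<bar>y\<bar>\<close> the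
  form is at least \<open>a u^2 - a u v + c v^2\<close>, because
  \<open>\<bar>b\<bar> \<le> a\<close>. For \<open>u < v\<close> this exceeds
  \<open>c (u^2 - u v + v^2)\<close> by \<open>(c - a) u (v - u) \<ge> 0\<close>.\<close>

lemma reduced_form_value_ge:
  assumes "bqf_reduced Q" "coeff_a Q > 0" "y \<noteq> 0"
  shows "coeff_c Q \<le> bqf_eval Q x y"
proof -
  obtain a b c where Q: "Q = BQF a b c" by (cases Q)
  have abc: "\<bar>b\<bar> \<le> a" "a \<le> c" "a > 0" using assms by (auto simp: Q bqf_reduced_def)
  define u v where "u = \<bar>x\<bar>" and "v = \<bar>y\<bar>"
  have uv: "u \<ge> 0" "v \<ge> 1" "x^2 = u * u" "y^2 = v * v" using assms(3) by (auto simp: u_def v_def power2_eq_square)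
  have "- (b * x * y) \<le> \<bar>b\<bar> * (u * v)" unfolding u_def v_def by (metis abs_ge_minus_self abs_mult mult.assoc)
  also have "\<dots> \<le> a * (u * v)" using abc uv by (intro mult_right_mono) auto
  finally have "a * (u * u) - a * (u * v) + c * (v * v) \<le> bqf_eval Q x y"
    by (simp add: Q bqf_eval_def uv)
  moreover have "c \<le> a * (u * u) - a * (u * v) + c * (v * v)"
  proof (cases "u \<ge> v")
    case True
    then have "u * v \<le> u * u" using uv by (intro mult_left_mono) auto
    then have "a * (u * v) \<le> a * (u * u)" using abc by simp
    moreover have "c * 1 \<le> c * (v * v)" using abc uv mult_mono[of 1 v 1 v] by (intro mult_left_mono) auto
    ultimately show ?thesis by simp
  next
    case False
    then have "u * (v - u) \<ge> 0" using uv by simp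
    then have "a * (u * (v - u)) \<le> c * (u * (v - u))" using abc by (intro mult_right_mono) auto
    then have "c * (u * u - u * v + v * v) \<le> a * (u * u) - a * (u * v) + c * (v * v)"
      by (simp add: algebra_simps)
    moreover have "1 \<le> u * u - u * v + v * v"
    proof -
      have "1 * 1 \<le> v * (v - u)" using False uv by (intro mult_mono) auto
      moreover have "v * (v - u) = v * v - u * v" by (simp add: algebra_simps)
      moreover have "0 \<le> u * u" by simp
      ultimately show ?thesis by linarith
    qed
    then have "c * 1 \<le> c * (u * u - u * v + v * v)" using abc by (intro mult_left_mono) auto
    ultimately show ?thesis by simp
  qed
  ultimately show ?thesis by (simp add: Q)
qed

text \<open>The lower bound, applied in both directions, identifies the leading coefficients. If
  \<open>r = 0\<close>, the matrix is a translation up to sign and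
  \<open>\<bar>b\<bar> \<le> a\<close> with the boundary convention leaves no room for it. If
  \<open>r \<noteq> 0\<close>, both forms have \<open>a = c\<close>, so both middle coefficients are
  nonnegative and the discriminant determines them.\<close>

lemma reduced_form_unique:
  assumes red: "bqf_reduced Q1" "bqf_reduced Q2" and pos: "coeff_a Q1 > 0" "coeff_a Q2 > 0"
    and eqv: "properly_equivalent Q1 Q2"
  shows "Q1 = Q2"
proof -
  obtain a b c where Q1: "Q1 = BQF a b c" by (cases Q1)
  obtain a' b' c' where Q2: "Q2 = BQF a' b' c'" by (cases Q2)
  have 1: "\<bar>b\<bar> \<le> a" "a \<le> c" "\<bar>b\<bar> = a \<or> a = c \<Longrightarrow> b \<ge> 0" "a > 0"
    using red(1) pos(1) by (auto simp: Q1 bqf_reduced_def)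
  have 2: "\<bar>b'\<bar> \<le> a'" "a' \<le> c'" "\<bar>b'\<bar> = a' \<or> a' = c' \<Longrightarrow> b' \<ge> 0" "a' > 0"
    using red(2) pos(2) by (auto simp: Q2 bqf_reduced_def)
  have disc: "b^2 - 4 * a * c = b'^2 - 4 * a' * c'"
    using properly_equivalent_disc[OF eqv] by (simp add: Q1 Q2 bqf_disc_def)
  have key: "coeff_a R2 \<le> coeff_a R1 \<and> (r \<noteq> 0 \<longrightarrow> coeff_c R2 \<le> coeff_a R1)"
    if "bqf_reduced R2" "coeff_a R2 > 0" "R1 = bqf_act R2 p q r s" "p * s - q * r = 1" for R1 R2 p q r s
  proof (cases "r = 0")
    case True
    then have "p * s = 1" using that(4) by simp
    then have "p^2 = 1" by (auto simp: zmult_eq_1_iff)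
    then show ?thesis using True by (simp add: that(3) bqf_act_def bqf_eval_def)
  next
    case False
    have "coeff_c R2 \<le> coeff_a R1"
      using reduced_form_value_ge[OF that(1,2) False] by (simp add: that(3) bqf_act_def)
    moreover have "coeff_a R2 \<le> coeff_c R2" using that(1) by (simp add: bqf_reduced_def)
    ultimately show ?thesis by simp
  qed
  obtain p q r s where M: "p * s - q * r = 1" "Q1 = bqf_act Q2 p q r s"
    using eqv by (auto simp: properly_equivalent_iff)
  have M': "s * p - (- q) * (- r) = 1" using M(1) by (simp add: mult.commute)
  have M2: "Q2 = bqf_act Q1 s (- q) (- r) p"
  proof (rule bqf_eqI)
    fix x y
    have "p * (s * x + (- q) * y) + q * ((- r) * x + p * y) = (p * s - q * r) * x"
      "r * (s * x + (- q) * y) + s * ((- r) * x + p * y) = (p * s - q * r) * y"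
      by (simp_all add: algebra_simps)
    then show "bqf_eval Q2 x y = bqf_eval (bqf_act Q1 s (- q) (- r) p) x y"
      unfolding M(2) bqf_eval_act M(1) by simp
  qed
  note k1 = key[OF red(2) pos(2) M(2,1)] and k2 = key[OF red(1) pos(1) M2 M']
  have a: "a = a'" using k1 k2 by (simp add: Q1 Q2)
  have b: "b = b'"
  proof (cases "r = 0")
    case True
    then have "p * s = 1" using M(1) by simp
    then have ps: "p = s" "p * p = 1" by (auto simp: zmult_eq_1_iff)
    have "b = 2 * a' * (p * q) + b' * (p * s)"
      using arg_cong[OF M(2), of coeff_b] True by (simp add: Q1 Q2 bqf_act_def)
    then have beq: "b = b' + 2 * a * (p * q)" using ps a by simp
    have "p * q = 0"
    proof (rule ccontr)
      assume "p * q \<noteq> 0"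
      define X where "X = a * (p * q)"
      have "p * q \<ge> 1 \<or> p * q \<le> -1" using \<open>p * q \<noteq> 0\<close> by linarith
      then have "a * (p * q) \<ge> a * 1 \<or> a * (p * q) \<le> a * (-1)"
        using 1(4) by (auto simp only: mult_le_cancel_left_pos)
      then have "X \<ge> a \<or> X \<le> - a" by (simp add: X_def)
      moreover have "b = b' + 2 * X" using beq by (simp add: X_def)
      ultimately show False using 1 2 a by auto
    qed
    then show ?thesis using beq by simp
  next
    case False
    then have "c = a" "c' = a'" using k1 k2 1(2) 2(2) a by (simp_all add: Q1 Q2)
    then have "b^2 = b'^2" "b \<ge> 0" "b' \<ge> 0" using disc a 1(3) 2(3) by auto
    then show ?thesis by (simp add: power2_eq_iff_nonneg)
  qed
  have "c = c'" using disc 1(4) by (simp add: a b)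
  then show ?thesis by (simp add: Q1 Q2 a b)
qed

lemma bqf_disc_reduced_forms:
  "Q \<in> reduced_forms d \<Longrightarrow> bqf_disc Q = d"
  by (simp add: reduced_forms_def forms_of_disc_def)

lemma coeff_a_reduced_forms:
  assumes "Q \<in> reduced_forms d"
  shows "coeff_a Q > 0"
proof -
  have "bqf_eval Q 1 0 > 0" using assms by (simp add: reduced_forms_def forms_of_disc_def bqf_pos_def_def)
  then show ?thesis by (simp add: bqf_eval_def)
qed

theorem class_number_eq_card_reduced_forms:
  assumes "fundamental_discriminant d" "d < 0"
  shows "class_number d = card (reduced_forms d)"
proof -
  let ?F = "forms_of_disc d"
  let ?R = "{(Q1, Q2). Q1 \<in> ?F \<and> Q2 \<in> ?F \<and> properly_equivalent Q1 Q2}"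
  note F = forms_of_disc_eq[OF assms]
  have eq: "equiv ?F ?R"
    by (rule equivI) (auto simp: refl_on_def sym_def trans_def
        intro: properly_equivalent_refl properly_equivalent_sym properly_equivalent_trans)
  have "bij_betw (\<lambda>Q. ?R `` {Q}) (reduced_forms d) (?F // ?R)"
  proof (rule bij_betwI')
    fix Q1 Q2 assume Q: "Q1 \<in> reduced_forms d" "Q2 \<in> reduced_forms d"
    then have QF: "Q1 \<in> ?F" "Q2 \<in> ?F" by (auto simp: reduced_forms_def)
    show "?R `` {Q1} = ?R `` {Q2} \<longleftrightarrow> Q1 = Q2"
    proof
      assume "?R `` {Q1} = ?R `` {Q2}"
      then have "(Q1, Q2) \<in> ?R" using eq_equiv_class[OF _ eq QF(2)] by blast
      then show "Q1 = Q2"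
        using Q coeff_a_reduced_forms by (intro reduced_form_unique) (auto simp: reduced_forms_def)
    qed simp
  next
    fix Q assume "Q \<in> reduced_forms d"
    then show "?R `` {Q} \<in> ?F // ?R" by (intro quotientI) (simp add: reduced_forms_def)
  next
    fix X assume "X \<in> ?F // ?R"
    then obtain Q where Q: "Q \<in> ?F" "X = ?R `` {Q}" by (auto elim: quotientE)
    then have Qp: "coeff_a Q > 0" "bqf_disc Q < 0" using assms(2) by (auto simp: F)
    then obtain Q' where Q': "bqf_reduced Q'" "properly_equivalent Q' Q" by (rule exists_reduced_form)
    have "Q' \<in> ?F"
      using properly_equivalent_coeff_a_pos[OF Q'(2) Qp] properly_equivalent_disc[OF Q'(2)] Q(1) by (simp add: F)
    then have red: "Q' \<in> reduced_forms d" and R: "(Q', Q) \<in> ?R" using Q' Q(1) by (auto simp: reduced_forms_def)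
    from equiv_class_eq[OF eq R] red show "\<exists>Q'\<in>reduced_forms d. X = ?R `` {Q'}"
      unfolding Q(2) by (intro bexI[of _ Q']) (rule sym)
  qed
  then show ?thesis unfolding class_number_def by (simp add: bij_betw_same_card)
qed

section \<open>Roots of the discriminant polynomial\<close>

text \<open>The principal form of discriminant \<open>d\<close> at \<open>(t, 1)\<close>;
  \<open>d mod 4\<close> can serve as its middle coefficient because a discriminant is 0 or 1 modulo
  4.\<close>

definition disc_poly :: "int \<Rightarrow> int \<Rightarrow> int" where
  "disc_poly d t = t^2 + (d mod 4) * t + ((d mod 4) - d) div 4"

text \<open>For a discriminant \<open>d\<close> the numbers \<open>b = 2 t + d mod 4\<close> are the
  solutions of \<open>b^2 = d\<close> modulo \<open>4 n\<close>, taken modulo \<open>2 n\<close>.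
  Working with \<open>t\<close> removes the factors 2 and 4, so the prime 2 needs no Hensel argument
  of its own.\<close>

definition disc_roots :: "int \<Rightarrow> nat \<Rightarrow> int set" where
  "disc_roots d n = {t \<in> {0..<int n}. int n dvd disc_poly d t}"

lemma finite_disc_roots [simp]: "finite (disc_roots d n)"
  by (rule finite_subset[of _ "{0..<int n}"]) (auto simp: disc_roots_def)

lemma disc_poly_mult_4:
  assumes "d mod 4 \<in> {0, 1}"
  shows "4 * disc_poly d t = (2 * t + d mod 4)^2 - d"
proof -
  have "4 * (((d mod 4) - d) div 4) = d mod 4 - d"
    by (rule dvd_mult_div_cancel) presburger
  moreover have "(d mod 4)^2 = d mod 4" using assms by auto
  ultimately show ?thesis
    by (simp add: disc_poly_def power2_sum algebra_simps)
qed

lemma disc_poly_add: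
  "disc_poly d (t + h) = disc_poly d t + h * (2 * t + d mod 4) + h^2"
  by (simp add: disc_poly_def algebra_simps power2_eq_square)

lemma disc_poly_cong: "[t = t'] (mod n) \<Longrightarrow> [disc_poly d t = disc_poly d t'] (mod n)"
  unfolding disc_poly_def by (intro cong_add cong_mult cong_pow cong_refl)

lemma dvd_disc_poly_mod: "n dvd disc_poly d (t mod n) \<longleftrightarrow> n dvd disc_poly d t"
  by (intro cong_dvd_iff disc_poly_cong) (simp add: cong_def)

lemma card_disc_roots_1 [simp]: "card (disc_roots d 1) = 1"
proof -
  have "disc_roots d 1 = {0}" by (auto simp: disc_roots_def)
  then show ?thesis by simp
qed

lemma card_disc_roots_mult:
  assumes "coprime m n" "m > 0" "n > 0"
  shows "card (disc_roots d (m * n)) = card (disc_roots d m) * card (disc_roots d n)"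
proof -
  let ?h = "\<lambda>t. (t mod int m, t mod int n)"
  have cop: "coprime (int m) (int n)" using assms(1) by simp
  have "bij_betw ?h (disc_roots d (m * n)) (disc_roots d m \<times> disc_roots d n)"
  proof (rule bij_betw_imageI)
    show "inj_on ?h (disc_roots d (m * n))"
    proof (rule inj_onI)
      fix t t' assume t: "t \<in> disc_roots d (m * n)" "t' \<in> disc_roots d (m * n)" and "?h t = ?h t'"
      then have "[t = t'] (mod int m)" "[t = t'] (mod int n)" by (auto simp: cong_def)
      then have "[t = t'] (mod int m * int n)" using cop by (rule coprime_cong_mult)
      then show "t = t'" using t by (simp add: disc_roots_def cong_def)
    qed
    show "?h ` disc_roots d (m * n) = disc_roots d m \<times> disc_roots d n"
    proof (intro equalityI subsetI)
      fix p assume "p \<in> ?h ` disc_roots d (m * n)"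
      then obtain t where t: "int (m * n) dvd disc_poly d t" "p = ?h t" by (auto simp: disc_roots_def)
      have "int m dvd disc_poly d t" "int n dvd disc_poly d t"
        using t(1) by (auto intro: dvd_mult_left dvd_mult_right)
      then show "p \<in> disc_roots d m \<times> disc_roots d n"
        using assms by (auto simp: t(2) disc_roots_def dvd_disc_poly_mod)
    next
      fix p assume "p \<in> disc_roots d m \<times> disc_roots d n"
      then obtain u v where p: "p = (u, v)" "u \<in> disc_roots d m" "v \<in> disc_roots d n" by auto
      obtain x where x: "[x = u] (mod int m)" "[x = v] (mod int n)"
        using binary_chinese_remainder_int[OF cop] by blast
      define t where "t = x mod (int m * int n)"
      have tu: "[t = u] (mod int m)" "[t = v] (mod int n)"
        using x by (auto simp: t_def cong_def mod_mod_cancel)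
      have "int m dvd disc_poly d t" "int n dvd disc_poly d t"
        using cong_dvd_iff[OF disc_poly_cong[OF tu(1)]] cong_dvd_iff[OF disc_poly_cong[OF tu(2)]] p
        by (auto simp: disc_roots_def)
      then have "int m * int n dvd disc_poly d t" using cop by (rule divides_mult)
      then have "t \<in> disc_roots d (m * n)" using assms by (simp add: disc_roots_def t_def)
      moreover have "?h t = p" using tu p by (auto simp: cong_def disc_roots_def)
      ultimately show "p \<in> ?h ` disc_roots d (m * n)" by (intro rev_image_eqI[of t]) simp_all
    qed
  qed
  then show ?thesis by (simp add: bij_betw_same_card card_cartesian_product)
qed

lemma card_linear_congruence:
  fixes a c q :: int
  assumes q: "q > 0" and "coprime a q"
  shows "card {t \<in> {0..<q}. [a * t = c] (mod q)} = 1"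
proof -
  obtain x where x: "[a * x = 1] (mod q)" using assms(2) cong_solve_coprime_int by blast
  have "[a * x * c = 1 * c] (mod q)" using x by (rule cong_scalar_right)
  then have 1: "[a * (x * c) = c] (mod q)" by (simp add: mult.assoc)
  have "{t \<in> {0..<q}. [a * t = c] (mod q)} = {x * c mod q}"
  proof (intro equalityI subsetI)
    fix t assume t: "t \<in> {t \<in> {0..<q}. [a * t = c] (mod q)}"
    then have "[a * t = a * (x * c)] (mod q)" using 1 by (metis (mono_tags, lifting) cong_sym cong_trans mem_Collect_eq)
    then have "[t = x * c] (mod q)" using assms(2) by (simp add: cong_mult_lcancel)
    then show "t \<in> {x * c mod q}" using t by (simp add: cong_def)
  next
    fix t assume "t \<in> {x * c mod q}"
    then have t: "t = x * c mod q" by simp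
    have "[t = x * c] (mod q)" by (simp add: t cong_def)
    then have "[a * t = a * (x * c)] (mod q)" by (rule cong_scalar_left)
    then show "t \<in> {t \<in> {0..<q}. [a * t = c] (mod q)}"
      using q 1 by (auto simp: t intro: cong_trans)
  qed
  then show ?thesis by simp
qed

text \<open>For odd \<open>p\<close> the factor 4 is a unit and
  \<open>t \<mapsto> 2 t + d mod 4\<close> permutes the residues, so the roots correspond to the
  square roots of \<open>d\<close>. For \<open>p = 2\<close> the two candidates are tested
  directly.\<close>

lemma card_disc_roots_prime:
  assumes d: "d mod 4 \<in> {0, 1}" and p: "prime p"
  shows "int (card (disc_roots d p)) = 1 + kronecker_prime d (int p)"
proof (cases "p = 2")
  case True
  have roots: "disc_roots d 2 = (if even (disc_poly d 0) then {0} else {}) \<union> (if even (disc_poly d 1) then {1} else {})"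
  proof -
    have "{0..<int 2} = {0, 1}" by auto
    then show ?thesis unfolding disc_roots_def by auto
  qed
  show ?thesis
  proof (cases "d mod 4 = 0")
    case True
    then have "even d" by presburger
    moreover have "disc_poly d 1 = disc_poly d 0 + 1" using True by (simp add: disc_poly_def)
    ultimately show ?thesis using \<open>p = 2\<close> by (auto simp: roots kronecker_prime_def)
  next
    case False
    then have d1: "d mod 4 = 1" using d by simp
    then have "odd d" by presburger
    have P: "disc_poly d 0 = (1 - d) div 4" "disc_poly d 1 = (1 - d) div 4 + 2" using d1 by (simp_all add: disc_poly_def)
    define k where "k = d div 4"
    have k: "d = 4 * k + 1" using d1 mult_div_mod_eq[of 4 d] by (simp add: k_def)
    then have "(1 - d) div 4 = - k" by simp
    moreover have "even k \<longleftrightarrow> d mod 8 = 1" "d mod 8 \<noteq> 7" unfolding k by presburger+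
    ultimately have "even ((1 - d) div 4) \<longleftrightarrow> d mod 8 = 1" "d mod 8 \<noteq> 7" by simp_all
    show ?thesis
    proof (cases "d mod 8 = 1")
      case True
      then have "even (disc_poly d 0)" "even (disc_poly d 1)"
        using \<open>even ((1 - d) div 4) \<longleftrightarrow> d mod 8 = 1\<close> by (simp_all add: P)
      then show ?thesis using \<open>p = 2\<close> \<open>odd d\<close> True by (simp add: roots kronecker_prime_def)
    next
      case False
      then have "odd (disc_poly d 0)" "odd (disc_poly d 1)"
        using \<open>even ((1 - d) div 4) \<longleftrightarrow> d mod 8 = 1\<close> by (simp_all add: P)
      then show ?thesis using \<open>p = 2\<close> \<open>odd d\<close> False \<open>d mod 8 \<noteq> 7\<close> by (simp add: roots kronecker_prime_def)
    qed
  qed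
next
  case False
  define q where "q = int p"
  have q: "prime q" "q > 2" "q > 0"
    using p False prime_gt_1_nat[OF p] by (auto simp: q_def)
  have "\<not> q dvd 2" using q zdvd_imp_le[of q 2] by auto
  then have cop: "coprime 2 q" using q(1) by (metis coprime_commute prime_imp_coprime)
  have cop4: "coprime q 4"
    using cop by (metis coprime_commute coprime_mult_right_iff mult_2_right numeral_Bit0 numeral_times_numeral semiring_norm(11) semiring_norm(12))
  have iff: "q dvd disc_poly d t \<longleftrightarrow> [(2 * t + d mod 4)^2 = d] (mod q)" for t
    using coprime_dvd_mult_right_iff[OF cop4, of "disc_poly d t"]
    by (simp add: disc_poly_mult_4[OF d] cong_iff_dvd_diff)
  have roots: "disc_roots d p = {t \<in> {0..<q}. [(2 * t + d mod 4)^2 = d] (mod q)}"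
    unfolding disc_roots_def q_def[symmetric] iff ..
  have lin: "card {t \<in> {0..<q}. [2 * t + d mod 4 = c] (mod q)} = 1" for c
  proof -
    have "[2 * t + d mod 4 = c] (mod q) \<longleftrightarrow> [2 * t = c - d mod 4] (mod q)" for t
      by (simp add: cong_iff_dvd_diff algebra_simps)
    then show ?thesis using card_linear_congruence[OF q(3) cop] by simp
  qed
  have fin: "finite {t \<in> {0..<q}. P t}" for P
    by (rule finite_subset[of _ "{0..<q}"]) auto
  have dvd_sq: "q dvd z^2 \<longleftrightarrow> q dvd z" for z
    using q(1) by (simp add: prime_dvd_power_iff)
  have Legendre: "kronecker_prime d (int p) = Legendre d q" using False by (simp add: kronecker_prime_def q_def)
  show ?thesis
  proof (cases "Legendre d q = 1")
    case True
    then obtain e where e: "[d = e^2] (mod q)" by (rule Legendre_eq_1E)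
    have "\<not> [d = 0] (mod q)" using True by (auto simp: Legendre_def)
    then have ne: "\<not> q dvd e" using cong_dvd_iff[OF e] dvd_sq[of e] by (simp add: cong_0_iff)
    have "[z^2 = d] (mod q) \<longleftrightarrow> [z = e] (mod q) \<or> [z = - e] (mod q)" for z
    proof -
      have "[z^2 = d] (mod q) \<longleftrightarrow> [z^2 = e^2] (mod q)" using e by (metis cong_sym cong_trans)
      also have "\<dots> \<longleftrightarrow> q dvd (z - e) * (z + e)" by (simp add: cong_iff_dvd_diff algebra_simps power2_eq_square)
      also have "\<dots> \<longleftrightarrow> [z = e] (mod q) \<or> [z = - e] (mod q)"
        using q(1) by (simp add: prime_dvd_mult_iff cong_iff_dvd_diff)
      finally show ?thesis .
    qed
    then have "disc_roots d p = {t \<in> {0..<q}. [2 * t + d mod 4 = e] (mod q)} \<union> {t \<in> {0..<q}. [2 * t + d mod 4 = - e] (mod q)}"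
      unfolding roots by auto
    moreover have disj: "{t \<in> {0..<q}. [2 * t + d mod 4 = e] (mod q)} \<inter> {t \<in> {0..<q}. [2 * t + d mod 4 = - e] (mod q)} = {}"
    proof -
      have False if "[x = e] (mod q)" "[x = - e] (mod q)" for x
      proof -
        have "[e = - e] (mod q)" using that by (metis cong_sym cong_trans)
        then have "q dvd 2 * e" by (simp add: cong_iff_dvd_diff)
        then show False using ne \<open>\<not> q dvd 2\<close> q(1) by (simp add: prime_dvd_mult_iff)
      qed
      then show ?thesis by blast
    qed
    ultimately have "card (disc_roots d p) = 1 + 1"
      using card_Un_disjoint[OF fin fin disj] lin by (simp only:)
    then show ?thesis using True Legendre by simp
  next
    case nr: False
    show ?thesis
    proof (cases "[d = 0] (mod q)")
      case True
      then have "[z^2 = d] (mod q) \<longleftrightarrow> [z = 0] (mod q)" for z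
        using dvd_sq[of z] by (metis cong_0_iff cong_sym cong_trans)
      then have "card (disc_roots d p) = 1" unfolding roots using lin[of 0] by simp
      then show ?thesis using True Legendre by (simp add: Legendre_def)
    next
      case False
      then have "\<not> QuadRes q d" using nr by (auto simp: Legendre_def split: if_splits)
      then have "disc_roots d p = {}" unfolding roots QuadRes_def by blast
      then show ?thesis using False nr Legendre by (auto simp: Legendre_def)
    qed
  qed
qed

text \<open>Hensel lifting: the derivative \<open>2 t + \<epsilon>\<close> satisfies \<open>(2 t + \<epsilon>)\<^sup>2 = 4 P(t) + d\<close>, so it is a unit
  at a root modulo a prime not dividing \<open>d\<close>.\<close>

lemma card_disc_roots_Suc:
  assumes d: "d mod 4 \<in> {0, 1}" and p: "prime p" "\<not> int p dvd d" and e: "e \<ge> 1"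
  shows "card (disc_roots d (p ^ Suc e)) = card (disc_roots d (p ^ e))"
proof -
  define q where "q = int p ^ e"
  have q: "q > 0" "int (p ^ e) = q" "int (p ^ Suc e) = q * int p" "int p dvd q"
    using prime_gt_0_nat[OF p(1)] e by (auto simp: q_def intro: dvd_power)
  have p0: "int p > 0" "prime (int p)" using p(1) prime_gt_0_nat by auto
  let ?h = "\<lambda>t. t mod q"
  have unit: "coprime (2 * t + d mod 4) (int p)" if "q dvd disc_poly d t" for t
  proof -
    have "\<not> int p dvd (2 * t + d mod 4)"
    proof
      assume *: "int p dvd (2 * t + d mod 4)"
      have "int p dvd (2 * t + d mod 4)^2 - 4 * disc_poly d t"
        using * that q(4) by (intro dvd_diff dvd_mult) (auto simp: power2_eq_square intro: dvd_trans)
      then show False using disc_poly_mult_4[OF d, of t] p(2) by simp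
    qed
    then show ?thesis using p0(2) by (metis coprime_commute prime_imp_coprime)
  qed
  \<comment> \<open>The quadratic term of the expansion has the factor \<open>q^2\<close>, a
    multiple of \<open>q * p\<close>, so the condition on the next digit \<open>j\<close> is
    linear.\<close>
  have lift: "q * int p dvd disc_poly d (t + q * j) \<longleftrightarrow> [(2 * t + d mod 4) * j = - (disc_poly d t div q)] (mod int p)"
    if "q dvd disc_poly d t" for t j
  proof -
    obtain l where l: "disc_poly d t = q * l" using \<open>q dvd disc_poly d t\<close> by (elim dvdE)
    obtain r where r: "q = int p * r" using q(4) by (elim dvdE)
    have "disc_poly d (t + q * j) = q * (l + j * (2 * t + d mod 4) + int p * (r * j^2))"
      unfolding disc_poly_add l by (simp add: r algebra_simps power2_eq_square)
    then have "q * int p dvd disc_poly d (t + q * j) \<longleftrightarrow> int p dvd (l + j * (2 * t + d mod 4) + int p * (r * j^2))"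
      using q(1) by simp
    also have "\<dots> \<longleftrightarrow> int p dvd l + j * (2 * t + d mod 4)" by (simp add: dvd_add_left_iff)
    also have "\<dots> \<longleftrightarrow> [(2 * t + d mod 4) * j = - (disc_poly d t div q)] (mod int p)"
      using q(1) by (simp add: l cong_iff_dvd_diff algebra_simps)
    finally show ?thesis .
  qed
  have "bij_betw ?h (disc_roots d (p ^ Suc e)) (disc_roots d (p ^ e))"
  proof (rule bij_betw_imageI)
    have root: "q dvd disc_poly d (t mod q)" if "q * int p dvd disc_poly d t" for t
      using that by (metis dvd_disc_poly_mod dvd_mult_left)
    show "inj_on ?h (disc_roots d (p ^ Suc e))"
    proof (rule inj_onI)
      fix t t' assume t: "t \<in> disc_roots d (p ^ Suc e)" "t' \<in> disc_roots d (p ^ Suc e)" and "t mod q = t' mod q"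
      define x j j' where "x = t mod q" and "j = t div q" and "j' = t' div q"
      have tt: "t = x + q * j" "t' = x + q * j'" using \<open>t mod q = t' mod q\<close> unfolding x_def j_def j'_def by (metis mod_mult_div_eq)+
      have tr: "0 \<le> t" "t < q * int p" "0 \<le> t'" "t' < q * int p" "q * int p dvd disc_poly d t" "q * int p dvd disc_poly d t'"
        using t unfolding disc_roots_def q(3) by auto
      have x: "q dvd disc_poly d x" using root[OF tr(5)] by (simp add: x_def)
      have "[(2 * x + d mod 4) * j = (2 * x + d mod 4) * j'] (mod int p)"
        using lift[OF x, of j] lift[OF x, of j'] tr(5,6) unfolding tt by (metis cong_sym cong_trans)
      then have "[j = j'] (mod int p)" using unit[OF x] by (simp add: cong_mult_lcancel)
      moreover have "0 \<le> j" "j < int p" "0 \<le> j'" "j' < int p"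
      proof -
        have "u div q < int p" if "u < q * int p" for u
        proof (rule ccontr)
          assume "\<not> u div q < int p"
          then have "q * int p \<le> q * (u div q)" using q(1) by (intro mult_left_mono) auto
          also have "\<dots> \<le> u" using q(1) mult_div_mod_eq[of q u] pos_mod_sign[of q u] by linarith
          finally show False using that by simp
        qed
        then show "j < int p" "j' < int p" using tr by (auto simp: j_def j'_def)
        show "0 \<le> j" "0 \<le> j'" using tr q(1) by (auto simp: j_def j'_def pos_imp_zdiv_nonneg_iff)
      qed
      ultimately have "j = j'" by (simp add: cong_def)
      then show "t = t'" using tt by simp
    qed
    show "?h ` disc_roots d (p ^ Suc e) = disc_roots d (p ^ e)"
    proof (intro equalityI subsetI)
      fix x assume "x \<in> ?h ` disc_roots d (p ^ Suc e)"
      then show "x \<in> disc_roots d (p ^ e)"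
        using root q(1) unfolding disc_roots_def q(2,3) by auto
    next
      fix x assume "x \<in> disc_roots d (p ^ e)"
      then have x: "0 \<le> x" "x < q" "q dvd disc_poly d x" unfolding disc_roots_def q(2) by auto
      have "card {j \<in> {0..<int p}. [(2 * x + d mod 4) * j = - (disc_poly d x div q)] (mod int p)} = 1"
        by (rule card_linear_congruence[OF p0(1) unit[OF x(3)]])
      then obtain j where j: "0 \<le> j" "j < int p" "[(2 * x + d mod 4) * j = - (disc_poly d x div q)] (mod int p)"
        by (auto simp: card_1_singleton_iff)
      have "q * j \<le> q * (int p - 1)" using j q(1) by (intro mult_left_mono) auto
      then have "x + q * j < q * int p" using x by (simp add: algebra_simps)
      then have "x + q * j \<in> disc_roots d (p ^ Suc e)"
        using lift[OF x(3), of j] j x q(1) unfolding disc_roots_def q(3) by auto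
      moreover have "?h (x + q * j) = x" using x by simp
      ultimately show "x \<in> ?h ` disc_roots d (p ^ Suc e)" by (intro rev_image_eqI[of "x + q * j"]) simp_all
    qed
  qed
  then show ?thesis by (rule bij_betw_same_card)
qed

text \<open>With \<open>P\<close> the polynomial and \<open>\<epsilon>\<close> its middle
  coefficient, a root modulo \<open>p^2\<close> for odd \<open>p\<close> would give
  \<open>p^2\<close> dividing \<open>(2 t + \<epsilon>)^2 - 4 P(t) = d\<close>. For
  \<open>p = 2\<close> it would make \<open>d div 4\<close> a square modulo 4. Both contradict
  fundamentality.\<close>

lemma disc_roots_ramified:
  assumes d: "fundamental_discriminant d" and p: "prime p" "int p dvd d" and e: "e \<ge> 2"
  shows "disc_roots d (p ^ e) = {}"
proof (rule ccontr)
  assume "disc_roots d (p ^ e) \<noteq> {}"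
  then obtain t where "int (p ^ e) dvd disc_poly d t" by (auto simp: disc_roots_def)
  moreover have "int p ^ 2 dvd int (p ^ e)" using e by (simp add: le_imp_power_dvd)
  ultimately have t: "int p ^ 2 dvd disc_poly d t" by (rule dvd_trans[rotated])
  have d4: "d mod 4 \<in> {0, 1}" using d by (auto simp: fundamental_discriminant_def)
  note eq = disc_poly_mult_4[OF d4, of t]
  have pp: "prime (int p)" using p(1) by simp
  show False
  proof (cases "p = 2")
    case True
    then have "even d" using p(2) by simp
    then have "d mod 4 \<noteq> 1" by presburger
    then have d0: "d mod 4 = 0" "d div 4 mod 4 \<in> {2, 3}" using d by (auto simp: fundamental_discriminant_def)
    have "d = 4 * (d div 4)" using d0(1) by presburger
    then have P: "disc_poly d t = t^2 - d div 4" using eq d0(1) by (simp add: power2_eq_square)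
    have "4 dvd t^2 - d div 4" using t by (simp add: P True)
    then have "t^2 mod 4 = d div 4 mod 4" by (simp add: mod_eq_dvd_iff)
    moreover have "t^2 mod 4 \<in> {0, 1}"
    proof (cases "even t")
      case True
      then obtain k where "t = 2 * k" by (elim evenE)
      then show ?thesis by (simp add: power2_eq_square)
    next
      case False
      then obtain k where "t = 2 * k + 1" by (elim oddE)
      then have "\<exists>l. t^2 = 1 + 4 * l" by (intro exI[of _ "k^2 + k"]) (simp add: power2_eq_square algebra_simps)
      then show ?thesis by auto
    qed
    ultimately show False using d0(2) by auto
  next
    case False
    have "int p dvd (2 * t + d mod 4)^2"
    proof -
      have "int p dvd 4 * disc_poly d t + d" using t p(2) by (intro dvd_add dvd_mult) (auto simp: power2_eq_square intro: dvd_mult_left)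
      then show ?thesis using eq by simp
    qed
    then have "int p dvd 2 * t + d mod 4" using pp prime_dvd_power by blast
    then have "int p ^ 2 dvd (2 * t + d mod 4)^2" by (rule dvd_power_same)
    then have "int p ^ 2 dvd (2 * t + d mod 4)^2 - 4 * disc_poly d t" using t by (intro dvd_diff dvd_mult)
    then have pd: "int p ^ 2 dvd d" using eq by simp
    have "is_unit (int p)"
    proof (cases "d mod 4 = 1")
      case True
      then show ?thesis using d pd by (auto simp: fundamental_discriminant_def squarefree_def)
    next
      case False
      then have sq: "squarefree (d div 4)" "d = 4 * (d div 4)" using d by (auto simp: fundamental_discriminant_def)
      have "coprime (int p) 2" using pp \<open>p \<noteq> 2\<close> by (metis int_int_eq of_nat_numeral primes_coprime two_is_prime_nat prime_nat_int_transfer)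
      then have "coprime (int p ^ 2) 4" by (metis coprime_power_left_iff coprime_power_right_iff num_double numeral_mult power2_eq_square)
      moreover have "int p ^ 2 dvd 4 * (d div 4)" using pd sq(2) by simp
      ultimately have "int p ^ 2 dvd d div 4" by (simp only: coprime_dvd_mult_right_iff)
      then show ?thesis using sq(1) by (auto simp: squarefree_def)
    qed
    then show False using pp not_prime_unit by blast
  qed
qed

text \<open>One expression for all cases: 2 if \<open>p\<close> splits, 0 if it is inert, and for
  ramified \<open>p\<close> 1 at exponent one and 0 beyond, by \<open>0 ^ 0 = 1\<close>. Two
  consecutive powers suit the sum over square divisors, which moves in steps of two.\<close>

lemma card_disc_roots_prime_power:
  assumes d: "fundamental_discriminant d" and p: "prime p"
  shows "int (card (disc_roots d (p ^ Suc e))) = kronecker_prime d (int p) ^ e + kronecker_prime d (int p) ^ Suc e"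
proof -
  let ?\<chi> = "kronecker_prime d (int p)"
  have d4: "d mod 4 \<in> {0, 1}" using d by (auto simp: fundamental_discriminant_def)
  have pp: "prime (int p)" using p by simp
  show ?thesis
  proof (cases "int p dvd d")
    case True
    then have \<chi>: "?\<chi> = 0" by (auto simp: kronecker_prime_def Legendre_def cong_0_iff)
    show ?thesis
    proof (cases e)
      case 0
      then show ?thesis using card_disc_roots_prime[OF d4 p] by simp
    next
      case (Suc n)
      then show ?thesis using disc_roots_ramified[OF d p True, of "Suc e"] \<chi> by simp
    qed
  next
    case False
    have sq: "?\<chi> * ?\<chi> = 1" by (rule kronecker_prime_square[OF pp False])
    show ?thesis
    proof (induction e)
      case 0
      then show ?case using card_disc_roots_prime[OF d4 p] by simp
    next
      case (Suc e)
      have "int (card (disc_roots d (p ^ Suc (Suc e)))) = ?\<chi> ^ e + ?\<chi> ^ Suc e"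
        using card_disc_roots_Suc[OF d4 p False, of "Suc e"] Suc.IH by simp
      also have "\<dots> = ?\<chi> ^ Suc (Suc e) + ?\<chi> ^ Suc e" using sq by (simp add: mult.assoc[symmetric])
      finally show ?case by simp
    qed
  qed
qed

section \<open>Divisor sums\<close>

text \<open>Applied with \<open>P\<close> expressing that \<open>k\<close> or \<open>k^2\<close>
  divides a given number; \<open>I\<close> and \<open>K\<close> are then the conditions on the
  exponent of \<open>p\<close> and on the part prime to \<open>p\<close>.\<close>

lemma bij_betw_prime_power_times:
  fixes p :: nat
  assumes p: "prime p" "\<not> p dvd m"
    and P: "\<And>k. P k \<Longrightarrow> k > 0"
    and split: "\<And>i k. \<not> p dvd k \<Longrightarrow> P (p ^ i * k) \<longleftrightarrow> I i \<and> K k"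
    and K: "\<And>k. K k \<Longrightarrow> \<not> p dvd k"
  shows "bij_betw (\<lambda>(i, k). p ^ i * k) ({i. I i} \<times> {k. K k}) {k. P k}"
proof (rule bij_betw_imageI)
  show "inj_on (\<lambda>(i, k). p ^ i * k) ({i. I i} \<times> {k. K k})"
  proof (rule inj_onI, safe)
    fix i k i' k' assume *: "p ^ i * k = p ^ i' * k'" and k: "K k" "K k'"
    have "multiplicity p (p ^ i * k) = i" if "\<not> p dvd k" "k > 0" for i k
      using that p(1) by (simp add: prime_elem_multiplicity_mult_distrib multiplicity_same_power not_dvd_imp_multiplicity_0)
    moreover have "k > 0" "k' > 0" using K[OF k(1)] K[OF k(2)] by (auto intro: gr0I)
    ultimately have "i = i'" using * K[OF k(1)] K[OF k(2)] by metis
    then show "i = i'" "k = k'" using * prime_gt_0_nat[OF p(1)] by auto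
  qed
  show "(\<lambda>(i, k). p ^ i * k) ` ({i. I i} \<times> {k. K k}) = {k. P k}"
  proof (intro equalityI subsetI)
    fix x assume x: "x \<in> {k. P k}"
    then have "x \<noteq> 0" using P by auto
    then obtain k where k: "x = p ^ multiplicity p x * k" "\<not> p dvd k"
      using multiplicity_decompose'[of x p] p(1) not_prime_unit by metis
    then have "I (multiplicity p x)" "K k" using x split[OF k(2), of "multiplicity p x"] by auto
    then show "x \<in> (\<lambda>(i, k). p ^ i * k) ` ({i. I i} \<times> {k. K k})"
      using k(1) by (intro rev_image_eqI[of "(multiplicity p x, k)"]) auto
  qed (use split K in auto)
qed

lemma prime_power_times_dvd_iff:
  fixes p :: nat
  assumes p: "prime p" "\<not> p dvd m" "\<not> p dvd k"
  shows "p ^ i * k dvd p ^ e * m \<longleftrightarrow> i \<le> e \<and> k dvd m"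
proof
  have cop: "coprime (p ^ j) m" "coprime (p ^ j) k" for j
    using p by (simp_all add: prime_imp_coprime)
  assume *: "p ^ i * k dvd p ^ e * m"
  have "p ^ i dvd p ^ e" using dvd_mult_left[OF *] cop(1) by (simp add: coprime_dvd_mult_left_iff)
  then have "i \<le> e" using prime_gt_1_nat[OF p(1)] by (simp add: power_dvd_imp_le)
  moreover have "k dvd m" using dvd_mult_right[OF *] cop(2)
    by (metis coprime_commute coprime_dvd_mult_right_iff)
  ultimately show "i \<le> e \<and> k dvd m" ..
qed (auto intro: mult_dvd_mono le_imp_power_dvd)

lemma prime_factor_induct [consumes 1, case_names one mult]:
  fixes n :: nat
  assumes "n > 0" "P 1"
    and "\<And>p e m. prime p \<Longrightarrow> \<not> p dvd m \<Longrightarrow> m > 0 \<Longrightarrow> P m \<Longrightarrow> P (p ^ Suc e * m)"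
  shows "P n"
  using assms(1)
proof (induction n rule: less_induct)
  case (less n)
  show ?case
  proof (cases "n = 1")
    case False
    then obtain p where p: "prime p" "p dvd n" using prime_factor_nat by blast
    obtain m where m: "n = p ^ multiplicity p n * m" "\<not> p dvd m"
      using multiplicity_decompose'[of n p] p(1) not_prime_unit less.prems by (metis less_numeral_extra(3))
    have "multiplicity p n > 0" using p less.prems by (simp add: prime_multiplicity_gt_zero_iff)
    then obtain e where e: "multiplicity p n = Suc e" using gr0_implies_Suc by blast
    have "m > 0" using m(2) by (auto intro: gr0I)
    moreover have "m < n"
    proof -
      have "1 * m < p ^ Suc e * m"
        using \<open>m > 0\<close> prime_gt_1_nat[OF p(1)] by (intro mult_strict_right_mono one_less_power) auto
      then show ?thesis using m(1) e by simp
    qed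
    ultimately have "P (p ^ Suc e * m)" using assms(3) p(1) m(2) less.IH by blast
    then show ?thesis using m(1) e by simp
  qed (use assms(2) in simp)
qed

lemma sum_kronecker_divisors_mult:
  fixes p :: nat
  assumes p: "prime p" "\<not> p dvd m" and m: "m > 0"
  shows "(\<Sum>k | k dvd p ^ e * m. kronecker d (int k)) =
    (\<Sum>i\<le>e. kronecker_prime d (int p) ^ i) * (\<Sum>k | k dvd m. kronecker d (int k))"
proof -
  have pp: "prime (int p)" using p by simp
  have "p ^ e * m > 0" using prime_gt_0_nat[OF p(1)] m by simp
  have "bij_betw (\<lambda>(i, k). p ^ i * k) ({i. i \<le> e} \<times> {k. k dvd m}) {k. k dvd p ^ e * m}"
  proof (rule bij_betw_prime_power_times[OF p])
    show "k > 0" if "k dvd p ^ e * m" for k by (rule dvd_pos_nat[OF \<open>p ^ e * m > 0\<close> that])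
    show "\<not> p dvd k" if "k dvd m" for k using that p(2) dvd_trans by blast
  qed (rule prime_power_times_dvd_iff[OF p])
  from sum.reindex_bij_betw[OF this, of "\<lambda>k. kronecker d (int k)"]
  have "(\<Sum>k | k dvd p ^ e * m. kronecker d (int k)) =
    (\<Sum>(i, k)\<in>{i. i \<le> e} \<times> {k. k dvd m}. kronecker d (int (p ^ i * k)))"
    by (simp add: case_prod_unfold)
  also have "\<dots> = (\<Sum>(i, k)\<in>{i. i \<le> e} \<times> {k. k dvd m}. kronecker_prime d (int p) ^ i * kronecker d (int k))"
  proof (intro sum.cong refl, clarify)
    fix i k assume "k dvd m"
    then have k: "int k > 0" using m by (simp add: dvd_pos_nat)
    have "kronecker d (int p ^ i) = kronecker_prime d (int p) ^ i"
      using pp prime_gt_0_int[OF pp] by (induction i) (simp_all add: kronecker_mult_pos kronecker_prime_eq)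
    then show "kronecker d (int (p ^ i * k)) = kronecker_prime d (int p) ^ i * kronecker d (int k)"
      using k prime_gt_0_int[OF pp] by (simp add: kronecker_mult_pos)
  qed
  also have "\<dots> = (\<Sum>i\<le>e. kronecker_prime d (int p) ^ i) * (\<Sum>k | k dvd m. kronecker d (int k))"
    by (simp add: sum_product sum.cartesian_product atMost_def)
  finally show ?thesis .
qed

lemma sum_disc_roots_mult:
  fixes p :: nat
  assumes p: "prime p" "\<not> p dvd m" and m: "m > 0"
  shows "(\<Sum>g | g^2 dvd p ^ e * m. int (card (disc_roots d (p ^ e * m div g^2)))) =
    (\<Sum>i | 2 * i \<le> e. int (card (disc_roots d (p ^ (e - 2 * i))))) *
    (\<Sum>g | g^2 dvd m. int (card (disc_roots d (m div g^2))))"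
proof -
  have "p ^ e * m > 0" using prime_gt_0_nat[OF p(1)] m by simp
  have nd: "\<not> p dvd g" if "g^2 dvd m" for g
  proof
    assume "p dvd g"
    then have "p dvd g^2" by (simp add: power2_eq_square)
    then show False using that p(2) dvd_trans by blast
  qed
  have "bij_betw (\<lambda>(i, k). p ^ i * k) ({i. 2 * i \<le> e} \<times> {g. g^2 dvd m}) {g. g^2 dvd p ^ e * m}"
  proof (rule bij_betw_prime_power_times[OF p _ _ nd])
    show "k > 0" if "k^2 dvd p ^ e * m" for k using that \<open>p ^ e * m > 0\<close> by (cases "k = 0") auto
    fix i k assume "\<not> p dvd k"
    then have "\<not> p dvd k^2" using p(1) prime_dvd_power by blast
    from prime_power_times_dvd_iff[OF p this, of "i * 2" e]
    show "(p ^ i * k)^2 dvd p ^ e * m \<longleftrightarrow> 2 * i \<le> e \<and> k^2 dvd m"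
      by (simp add: power_mult_distrib power_mult[symmetric] mult.commute)
  qed
  from sum.reindex_bij_betw[OF this, of "\<lambda>g. int (card (disc_roots d (p ^ e * m div g^2)))"]
  have "(\<Sum>g | g^2 dvd p ^ e * m. int (card (disc_roots d (p ^ e * m div g^2)))) =
    (\<Sum>(i, g)\<in>{i. 2 * i \<le> e} \<times> {g. g^2 dvd m}. int (card (disc_roots d (p ^ e * m div (p ^ i * g)^2))))"
    by (simp add: case_prod_unfold)
  also have "\<dots> = (\<Sum>(i, g)\<in>{i. 2 * i \<le> e} \<times> {g. g^2 dvd m}.
      int (card (disc_roots d (p ^ (e - 2 * i)))) * int (card (disc_roots d (m div g^2))))"
  proof (intro sum.cong refl, clarify)
    fix i g assume i: "2 * i \<le> e" and g: "g^2 dvd m"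
    obtain l where l: "m = g^2 * l" using g by (elim dvdE)
    have g0: "g > 0" "l > 0" using l m by (auto intro: gr0I)
    have pe: "p ^ e = p ^ (e - 2 * i) * (p ^ i)^2"
      using i by (simp add: power_mult[symmetric] power_add[symmetric] mult.commute)
    have "p ^ e * m div (p ^ i * g)^2 = p ^ (e - 2 * i) * l"
    proof -
      have "p ^ e * m = (p ^ (e - 2 * i) * l) * (p ^ i * g)^2"
        unfolding pe l by (simp add: power_mult_distrib)
      then show ?thesis using g0 prime_gt_0_nat[OF p(1)] by simp
    qed
    moreover have "m div g^2 = l" using l g0 by simp
    moreover have "coprime (p ^ (e - 2 * i)) l"
      using p l by (metis coprime_power_left_iff dvd_mult prime_imp_coprime)
    ultimately show "int (card (disc_roots d (p ^ e * m div (p ^ i * g)^2))) =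
        int (card (disc_roots d (p ^ (e - 2 * i)))) * int (card (disc_roots d (m div g^2)))"
      using g0 prime_gt_0_nat[OF p(1)] by (simp add: card_disc_roots_mult)
  qed
  also have "\<dots> = (\<Sum>i | 2 * i \<le> e. int (card (disc_roots d (p ^ (e - 2 * i))))) *
    (\<Sum>g | g^2 dvd m. int (card (disc_roots d (m div g^2))))"
    by (simp add: sum_product sum.cartesian_product)
  finally show ?thesis .
qed

lemma sum_disc_roots_prime_power:
  assumes d: "fundamental_discriminant d" and p: "prime p"
  shows "(\<Sum>i | 2 * i \<le> e. int (card (disc_roots d (p ^ (e - 2 * i))))) = (\<Sum>i\<le>e. kronecker_prime d (int p) ^ i)"
proof (induction e rule: induct_nat_012)
  case 0
  have "{i::nat. 2 * i \<le> 0} = {0}" by auto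
  then show ?case by (simp del: One_nat_def add: card_disc_roots_1[unfolded One_nat_def])
next
  case 1
  have "{i::nat. 2 * i \<le> Suc 0} = {0}" by auto
  then show ?case using card_disc_roots_prime_power[OF d p, of 0] by simp
next
  case (ge2 e)
  \<comment> \<open>Passing from \<open>e\<close> to \<open>e + 2\<close> adds only the new term at
    \<open>i = 0\<close>, which supplies exactly the powers \<open>e + 1\<close> and
    \<open>e + 2\<close> of the symbol.\<close>
  have "{i. 2 * i \<le> Suc (Suc e)} = insert 0 (Suc ` {i. 2 * i \<le> e})"
  proof (intro equalityI subsetI)
    fix i assume "i \<in> {i. 2 * i \<le> Suc (Suc e)}"
    then show "i \<in> insert 0 (Suc ` {i. 2 * i \<le> e})" by (cases i) auto
  qed auto
  moreover have "finite {i. 2 * i \<le> e}" by (rule finite_subset[of _ "{..e}"]) auto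
  ultimately have "(\<Sum>i | 2 * i \<le> Suc (Suc e). int (card (disc_roots d (p ^ (Suc (Suc e) - 2 * i))))) =
      int (card (disc_roots d (p ^ Suc (Suc e)))) + (\<Sum>i | 2 * i \<le> e. int (card (disc_roots d (p ^ (e - 2 * i)))))"
    by (simp add: sum.reindex)
  then show ?case
    using ge2 card_disc_roots_prime_power[OF d p, of "Suc e"] by simp
qed

text \<open>Both sides are multiplicative and agree at prime powers. On the left \<open>g\<close>
  will be the greatest common divisor of a representation, whose removal divides \<open>n\<close> by
  \<open>g^2\<close>.\<close>

theorem sum_disc_roots_eq_sum_kronecker:
  assumes d: "fundamental_discriminant d" and n: "n > 0"
  shows "(\<Sum>g | g^2 dvd n. int (card (disc_roots d (n div g^2)))) = (\<Sum>k | k dvd n. kronecker d (int k))"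
  using n
proof (induction n rule: prime_factor_induct)
  case one
  have "{g::nat. g^2 dvd 1} = {1}" "{k::nat. k dvd 1} = {1}" by auto
  then show ?case by (simp del: One_nat_def add: card_disc_roots_1)
next
  case (mult p e m)
  show ?case
    unfolding sum_disc_roots_mult[OF mult(1-3)] sum_kronecker_divisors_mult[OF mult(1-3)]
      sum_disc_roots_prime_power[OF d mult(1)] mult.IH ..
qed

section \<open>Representations by reduced forms\<close>

lemma bqf_act_act:
  "bqf_act (bqf_act Q p q r s) p' q' r' s' =
    bqf_act Q (p * p' + q * r') (p * q' + q * s') (r * p' + s * r') (r * q' + s * s')"
  by (rule bqf_eqI) (simp add: bqf_eval_act algebra_simps)

lemma bqf_act_id [simp]: "bqf_act Q 1 0 0 1 = Q"
  by (rule bqf_eqI) (simp add: bqf_eval_act)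

lemma primitive_dvdD:
  assumes "bqf_primitive (BQF a b c)" "a dvd b * r" "a dvd c * r"
  shows "a dvd r"
proof -
  have g: "gcd a (gcd b c) = 1" using assms(1) by (simp add: bqf_primitive_def)
  have "a dvd gcd (b * r) (c * r)" using assms by simp
  then have "a dvd gcd b c * r" by (simp add: gcd_mult_right gcd.commute)
  moreover have "coprime a (gcd b c)" using g by (simp add: coprime_iff_gcd_eq_1)
  ultimately show ?thesis by (simp add: coprime_dvd_mult_right_iff)
qed

text \<open>Combining the coefficient equations with the determinant gives the linear relations
  \<open>a (p - s) = - b r\<close> and \<open>a q = - c r\<close>. Primitivity then makes
  \<open>a\<close> divide \<open>r\<close>, and \<open>u = r / a\<close>, \<open>t = p + s\<close>
  solve the Pell equation.\<close>

lemma automorphE: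
  assumes prim: "bqf_primitive (BQF a b c)" and a: "a > 0" and D: "bqf_disc (BQF a b c) = - D"
    and aut: "bqf_act (BQF a b c) p q r s = BQF a b c" and det: "p * s - q * r = 1"
  obtains t u where "t^2 + D * u^2 = 4" "2 * p = t - b * u" "q = - c * u" "r = a * u" "2 * s = t + b * u"
proof -
  let ?Q = "BQF a b c"
  have D': "D = 4 * a * c - b^2" using D by (simp add: bqf_disc_def)
  have A: "bqf_eval ?Q p r = a" "2 * a * p * q + b * (p * s + q * r) + 2 * c * r * s = b" "bqf_eval ?Q q s = c"
    using aut by (simp_all add: bqf_act_def)
  have "2 * s * bqf_eval ?Q p r - r * (2 * a * p * q + b * (p * s + q * r) + 2 * c * r * s) = (2 * a * p + b * r) * (p * s - q * r)"
    by (simp add: bqf_eval_def algebra_simps power2_eq_square)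
  then have 1: "a * (p - s) = - b * r" unfolding A det by (simp add: algebra_simps)
  have "s * (2 * a * p * q + b * (p * s + q * r) + 2 * c * r * s) - 2 * r * bqf_eval ?Q q s = (2 * a * q + b * s) * (p * s - q * r)"
    by (simp add: bqf_eval_def algebra_simps power2_eq_square)
  then have 2: "a * q = - c * r" unfolding A det by (simp add: algebra_simps)
  have "a dvd b * r" using 1 by (metis dvd_minus_iff dvd_triv_left mult_minus_left)
  moreover have "a dvd c * r" using 2 by (metis dvd_minus_iff dvd_triv_left mult_minus_left)
  ultimately have "a dvd r" by (rule primitive_dvdD[OF prim])
  then obtain u where u: "r = a * u" by (elim dvdE)
  have "a * (p - s) = a * (- b * u)" using 1 u by simp
  then have "a = 0 \<or> p - s = - b * u" by (simp only: mult_cancel_left)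
  then have ps: "p - s = - b * u" using a by simp
  have "a * q = a * (- c * u)" using 2 u by simp
  then have "a = 0 \<or> q = - c * u" by (simp only: mult_cancel_left)
  then have q: "q = - c * u" using a by simp
  have "(p + s)^2 = (p - s)^2 + 4 * (p * s)" by (simp add: power2_eq_square algebra_simps)
  also have "p * s = 1 + q * r" using det by simp
  finally have "(p + s)^2 + D * u^2 = 4"
    unfolding ps q u D' by (simp add: algebra_simps power2_eq_square)
  then show ?thesis using ps q u by (intro that[of "p + s" u]) auto
qed

lemma automorphI:
  fixes t u :: int
  assumes D: "bqf_disc (BQF a b c) = - D" and tu: "t^2 + D * u^2 = 4"
  obtains p s where "2 * p = t - b * u" "2 * s = t + b * u" "p * s - (- c * u) * (a * u) = 1"
    "bqf_act (BQF a b c) p (- c * u) (a * u) s = BQF a b c"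
proof -
  have D': "D = 4 * a * c - b^2" using D by (simp add: bqf_disc_def)
  have "(t - b * u) * (t + b * u) = 4 * (1 - a * c * u^2)"
    using tu unfolding D' by (simp add: algebra_simps power2_eq_square)
  then have "even ((t - b * u) * (t + b * u))" by simp
  then have "even (t - b * u)" by auto
  then obtain p where p: "t - b * u = 2 * p" by (elim evenE)
  have t: "t = 2 * p + b * u" using p by simp
  have det: "p * (p + b * u) - (- c * u) * (a * u) = 1"
    using tu unfolding t D' by (simp add: algebra_simps power2_eq_square)
  have "bqf_act (BQF a b c) p (- c * u) (a * u) (p + b * u) = BQF a b c"
  proof -
    let ?d = "p * (p + b * u) - (- c * u) * (a * u)"
    have "bqf_eval (BQF a b c) p (a * u) = a * ?d" "bqf_eval (BQF a b c) (- c * u) (p + b * u) = c * ?d"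
      "2 * a * p * (- c * u) + b * (p * (p + b * u) + (- c * u) * (a * u)) + 2 * c * (a * u) * (p + b * u) = b * ?d"
      by (simp_all add: bqf_eval_def algebra_simps power2_eq_square)
    then show ?thesis unfolding det by (simp add: bqf_act_def)
  qed
  then show ?thesis using det t by (intro that[of p "p + b * u"]) auto
qed

text \<open>For a negative discriminant \<open>-D\<close> these are the units
  \<open>(t + u \<surd>(-D)) / 2\<close> of the quadratic order, in bijection with the automorphs of
  any primitive form of that discriminant; their number is \<open>w\<close>.\<close>

definition pell_solutions :: "int \<Rightarrow> (int \<times> int) set" where
  "pell_solutions D = {(t, u). t^2 + D * u^2 = 4}"

definition root_form :: "int \<Rightarrow> nat \<Rightarrow> int \<Rightarrow> bqf" where
  "root_form d n t = BQF (int n) (2 * t + d mod 4) (disc_poly d t div int n)"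

lemma bqf_disc_root_form:
  assumes "d mod 4 \<in> {0, 1}" "t \<in> disc_roots d n"
  shows "bqf_disc (root_form d n t) = d"
proof -
  have "int n * (disc_poly d t div int n) = disc_poly d t"
    using assms(2) by (simp add: disc_roots_def)
  then have "4 * int n * (disc_poly d t div int n) = 4 * disc_poly d t" by simp
  then show ?thesis using disc_poly_mult_4[OF assms(1), of t] by (simp add: bqf_disc_def root_form_def)
qed

text \<open>The pairs of a reduced form and a primitive representation of \<open>n\<close> by it that belong to the
  root \<open>t\<close>: completing the representation to a matrix transforms the form into \<open>root_form d n t\<close>.\<close>

definition root_fibre :: "int \<Rightarrow> nat \<Rightarrow> int \<Rightarrow> (bqf \<times> int \<times> int) set" where
  "root_fibre d n t = {(Q, x, y). Q \<in> reduced_forms d \<and>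
    (\<exists>q s. x * s - q * y = 1 \<and> bqf_act Q x q y s = root_form d n t)}"

text \<open>Only the reduced form \<open>Q0\<close> equivalent to \<open>root_form d n t\<close> can
  occur. The matrices carrying it there are the products of its automorphs with one fixed matrix,
  and \<open>\<phi>\<close> records the first column of such a product.\<close>

lemma card_root_fibre:
  assumes d: "fundamental_discriminant d" "d < 0" and n: "n > 0" and t: "t \<in> disc_roots d n"
  shows "card (root_fibre d n t) = card (pell_solutions (- d))"
proof -
  define F where "F = root_form d n t"
  have d4: "d mod 4 \<in> {0, 1}" using d by (auto simp: fundamental_discriminant_def)
  have F: "coeff_a F > 0" "bqf_disc F < 0" "bqf_disc F = d"
    using bqf_disc_root_form[OF d4 t] d n by (auto simp: F_def root_form_def)
  obtain Q0 where Q0: "bqf_reduced Q0" "properly_equivalent Q0 F"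
    using exists_reduced_form[OF F(1,2)] by blast
  have Q0d: "coeff_a Q0 > 0" "bqf_disc Q0 = d"
    using properly_equivalent_coeff_a_pos[OF Q0(2) F(1,2)] properly_equivalent_disc[OF Q0(2)] F by auto
  then have Q0r: "Q0 \<in> reduced_forms d"
    using Q0 forms_of_disc_eq[OF d] by (simp add: reduced_forms_def)
  obtain a b c where abc: "Q0 = BQF a b c" by (cases Q0)
  have prim: "bqf_primitive (BQF a b c)"
    using fundamental_discriminant_primitive[of Q0] d Q0d by (simp add: abc)
  have a: "a > 0" and disc: "bqf_disc (BQF a b c) = - (- d)" using Q0d by (simp_all add: abc)
  obtain p0 q0 r0 s0 where M0: "p0 * s0 - q0 * r0 = 1" "F = bqf_act Q0 p0 q0 r0 s0"
    using properly_equivalent_sym[OF Q0(2)] by (auto simp: properly_equivalent_iff)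
  have n0: "a * p0^2 + b * p0 * r0 + c * r0^2 = int n"
    using M0(2) by (simp add: F_def root_form_def bqf_act_def abc bqf_eval_def)
  define \<phi> where "\<phi> = (\<lambda>(t, u). (Q0, (((t - b * u) div 2) * p0 - c * u * r0), (a * u * p0 + ((t + b * u) div 2) * r0)))"
  have "bij_betw \<phi> (pell_solutions (- d)) (root_fibre d n t)"
  proof (rule bij_betw_imageI)
    have even: "2 * ((t - b * u) div 2) = t - b * u" "2 * ((t + b * u) div 2) = t + b * u"
      if "(t, u) \<in> pell_solutions (- d)" for t u
    proof -
      have "t^2 + (- d) * u^2 = 4" using that by (simp add: pell_solutions_def)
      then obtain p s where "2 * p = t - b * u" "2 * s = t + b * u"
        by (rule automorphI[OF disc]) (rule that)
      then show "2 * ((t - b * u) div 2) = t - b * u" "2 * ((t + b * u) div 2) = t + b * u"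
        by (metis nonzero_mult_div_cancel_left zero_neq_numeral)+
    qed
    show "inj_on \<phi> (pell_solutions (- d))"
    proof (rule inj_onI, safe)
      fix t u t' u' assume tu: "(t, u) \<in> pell_solutions (- d)" "(t', u') \<in> pell_solutions (- d)" "\<phi> (t, u) = \<phi> (t', u')"
      define X Y where "X t u = ((t - b * u) div 2) * p0 - c * u * r0"
        and "Y t u = a * u * p0 + ((t + b * u) div 2) * r0" for t u
      have XY: "X t u = X t' u'" "Y t u = Y t' u'" using tu(3) by (auto simp: \<phi>_def X_def Y_def)
      have lin: "2 * X t u = t * p0 - u * (b * p0 + 2 * c * r0)" "2 * Y t u = t * r0 + u * (2 * a * p0 + b * r0)"
        if "(t, u) \<in> pell_solutions (- d)" for t u
      proof -
        have "2 * X t u = (2 * ((t - b * u) div 2)) * p0 - 2 * c * u * r0"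
          "2 * Y t u = 2 * a * u * p0 + (2 * ((t + b * u) div 2)) * r0"
          by (simp_all add: X_def Y_def algebra_simps)
        then show "2 * X t u = t * p0 - u * (b * p0 + 2 * c * r0)" "2 * Y t u = t * r0 + u * (2 * a * p0 + b * r0)"
          unfolding even[OF that] by (simp_all add: algebra_simps)
      qed
      \<comment> \<open>The first column determines \<open>(t, u)\<close>: the linear system has
        determinant \<open>2 n\<close>, because \<open>Q0\<close> takes the value \<open>n\<close>
        at \<open>(p0, r0)\<close>.\<close>
      have "u * (2 * int n) = p0 * (2 * Y t u) - r0 * (2 * X t u)" "t * (2 * int n) = (2 * a * p0 + b * r0) * (2 * X t u) + (b * p0 + 2 * c * r0) * (2 * Y t u)"
        if "(t, u) \<in> pell_solutions (- d)" for t u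
        unfolding lin[OF that] n0[symmetric] by (simp_all add: algebra_simps power2_eq_square)
      from this[OF tu(1)] this[OF tu(2)] have "u * (2 * int n) = u' * (2 * int n)" "t * (2 * int n) = t' * (2 * int n)"
        unfolding XY by simp_all
      then show "t = t'" "u = u'" using n by simp_all
    qed
    show "\<phi> ` pell_solutions (- d) = root_fibre d n t"
    proof (intro equalityI subsetI)
      fix z assume "z \<in> \<phi> ` pell_solutions (- d)"
      then obtain t' u where tu: "(t', u) \<in> pell_solutions (- d)" "z = \<phi> (t', u)" by auto
      obtain p s where ps: "2 * p = t' - b * u" "2 * s = t' + b * u" "p * s - (- c * u) * (a * u) = 1"
          "bqf_act (BQF a b c) p (- c * u) (a * u) s = BQF a b c"
        using automorphI[OF disc, of t' u] tu(1) unfolding pell_solutions_def by blast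
      have div: "(t' - b * u) div 2 = p" "(t' + b * u) div 2 = s" using ps(1,2) by (auto simp: eq_commute)
      have z: "z = (Q0, p * p0 + (- c * u) * r0, (a * u) * p0 + s * r0)"
        by (simp add: tu(2) \<phi>_def div)
      have "bqf_act Q0 (p * p0 + (- c * u) * r0) (p * q0 + (- c * u) * s0) ((a * u) * p0 + s * r0) ((a * u) * q0 + s * s0) = F"
        using bqf_act_act[of Q0 p "- c * u" "a * u" s p0 q0 r0 s0] ps(4) M0(2) by (simp add: abc)
      moreover have "(p * p0 + (- c * u) * r0) * ((a * u) * q0 + s * s0) - (p * q0 + (- c * u) * s0) * ((a * u) * p0 + s * r0)
          = (p * s - (- c * u) * (a * u)) * (p0 * s0 - q0 * r0)"
        by (simp add: algebra_simps)
      ultimately show "z \<in> root_fibre d n t"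
        unfolding root_fibre_def z F_def[symmetric] using Q0r ps(3) M0(1) by fastforce
    next
      fix z assume "z \<in> root_fibre d n t"
      then obtain Q x y q s where z: "z = (Q, x, y)" "Q \<in> reduced_forms d" "x * s - q * y = 1" "bqf_act Q x q y s = F"
        by (auto simp: root_fibre_def F_def)
      have "properly_equivalent F Q" using z(3,4) by (auto simp: properly_equivalent_iff)
      then have "properly_equivalent Q0 Q" using Q0(2) properly_equivalent_trans by blast
      then have QQ: "Q = Q0"
        using reduced_form_unique[OF Q0(1)] z(2) coeff_a_reduced_forms Q0d(1) by (auto simp: reduced_forms_def)
      \<comment> \<open>The given matrix times the inverse of the fixed one, hence an automorph of
        \<open>Q0\<close>.\<close>
      define p1 q1 r1 s1 where "p1 = x * s0 - q * r0" and "q1 = - x * q0 + q * p0"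
        and "r1 = y * s0 - s * r0" and "s1 = - y * q0 + s * p0"
      have "bqf_act F s0 (- q0) (- r0) p0 = bqf_act Q0 p1 q1 r1 s1"
        using bqf_act_act[of Q0 x q y s s0 "- q0" "- r0" p0] z(4)
        by (simp add: QQ p1_def q1_def r1_def s1_def)
      moreover have "bqf_act F s0 (- q0) (- r0) p0 = Q0"
        using bqf_act_act[of Q0 p0 q0 r0 s0 s0 "- q0" "- r0" p0] M0 by (simp add: mult.commute)
      ultimately have aut: "bqf_act (BQF a b c) p1 q1 r1 s1 = BQF a b c" by (simp add: abc)
      have "p1 * s1 - q1 * r1 = (x * s - q * y) * (p0 * s0 - q0 * r0)"
        by (simp add: p1_def q1_def r1_def s1_def algebra_simps)
      then have det: "p1 * s1 - q1 * r1 = 1" using z(3) M0(1) by simp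
      obtain t' u where tu: "t'^2 + (- d) * u^2 = 4" "2 * p1 = t' - b * u" "q1 = - c * u" "r1 = a * u" "2 * s1 = t' + b * u"
        using automorphE[OF prim a disc aut det] by blast
      have div: "(t' - b * u) div 2 = p1" "(t' + b * u) div 2 = s1" using tu(2,5) by (auto simp: eq_commute)
      have "p1 * p0 + q1 * r0 = x * (p0 * s0 - q0 * r0)" "r1 * p0 + s1 * r0 = y * (p0 * s0 - q0 * r0)"
        by (simp_all add: p1_def q1_def r1_def s1_def algebra_simps)
      then have "\<phi> (t', u) = z"
        unfolding \<phi>_def case_prod_conv div z(1) QQ using tu(3,4) M0(1) by simp
      moreover have "(t', u) \<in> pell_solutions (- d)" using tu(1) by (simp add: pell_solutions_def)
      ultimately show "z \<in> \<phi> ` pell_solutions (- d)" by (intro rev_image_eqI) auto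
    qed
  qed
  then show ?thesis by (rule bij_betw_same_card[symmetric])
qed

text \<open>Bezout completes \<open>(x, y)\<close> to a matrix of determinant 1, uniquely up to
  adding multiples of the first column to the second. Such an addition changes the middle
  coefficient by a multiple of \<open>2 n\<close>, so one choice brings the root into
  \<open>{0..<int n}\<close>.\<close>

lemma primitive_representations_eq_UN_root_fibre:
  assumes d: "fundamental_discriminant d" "d < 0" and n: "n > 0"
  shows "(SIGMA Q:reduced_forms d. {(x, y). coprime x y \<and> bqf_eval Q x y = int n}) = (\<Union>t\<in>disc_roots d n. root_fibre d n t)"
proof (intro equalityI subsetI)
  have d4: "d mod 4 \<in> {0, 1}" using d by (auto simp: fundamental_discriminant_def)
  fix z assume "z \<in> (SIGMA Q:reduced_forms d. {(x, y). coprime x y \<and> bqf_eval Q x y = int n})"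
  then obtain Q x y where z: "z = (Q, x, y)" "Q \<in> reduced_forms d" "coprime x y" "bqf_eval Q x y = int n" by auto
  obtain u v where "u * x + v * y = 1" using bezout_int[of x y] z(3) by auto
  then have det0: "x * u - (- v) * y = 1" by (simp add: algebra_simps)
  define B where "B q s = 2 * coeff_a Q * x * q + coeff_b Q * (x * s + q * y) + 2 * coeff_c Q * y * s" for q s
  define B0 where "B0 = B (- v) u"
  have B_sq: "(B q s)^2 - 4 * int n * bqf_eval Q q s = d" if "x * s - q * y = 1" for q s
    using bqf_disc_act[of Q x q y s] that bqf_disc_reduced_forms[OF z(2)] z(4)
    by (simp add: bqf_act_def bqf_disc_def B_def)
  have B0e: "even (B0 - d mod 4)"
  proof -
    have "d = B0^2 - 2 * (2 * int n * bqf_eval Q (- v) u)" using B_sq[OF det0] by (simp add: B0_def)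
    then have "even d \<longleftrightarrow> even (B0^2 - 2 * (2 * int n * bqf_eval Q (- v) u))" by (rule arg_cong)
    then have "even (B0^2) \<longleftrightarrow> even d" by simp
    moreover have "even (d mod 4) \<longleftrightarrow> even d" by presburger
    ultimately show ?thesis by simp
  qed
  define t0 where "t0 = (B0 - d mod 4) div 2"
  have t0: "B0 = 2 * t0 + d mod 4" using B0e by (simp add: t0_def)
  define j where "j = - (t0 div int n)"
  define t where "t = t0 + int n * j"
  define q s where "q = - v + j * x" and "s = u + j * y"
  have det: "x * s - q * y = 1" using det0 by (simp add: q_def s_def algebra_simps)
  have "B q s = B0 + 2 * j * bqf_eval Q x y"
    by (simp add: B0_def B_def q_def s_def bqf_eval_def algebra_simps power2_eq_square)
  then have Bt: "B q s = 2 * t + d mod 4" using t0 z(4) by (simp add: t_def)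
  have "4 * disc_poly d t = 4 * (int n * bqf_eval Q q s)"
    using disc_poly_mult_4[OF d4, of t] B_sq[OF det] unfolding Bt by simp
  then have P: "disc_poly d t = int n * bqf_eval Q q s" by simp
  have "t = t0 mod int n" by (simp add: t_def j_def minus_div_mult_eq_mod[symmetric] mult.commute)
  then have "t \<in> disc_roots d n" using n P by (simp add: disc_roots_def)
  moreover have "bqf_act Q x q y s = root_form d n t"
    using Bt P n z(4) by (simp add: bqf_act_def root_form_def B_def)
  ultimately show "z \<in> (\<Union>t\<in>disc_roots d n. root_fibre d n t)"
    using z(1,2) det by (auto simp: root_fibre_def)
next
  fix z assume "z \<in> (\<Union>t\<in>disc_roots d n. root_fibre d n t)"
  then obtain t Q x y q s where z: "z = (Q, x, y)" "Q \<in> reduced_forms d" "x * s - q * y = 1" "bqf_act Q x q y s = root_form d n t"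
    by (auto simp: root_fibre_def)
  have "coprime x y"
  proof (rule coprimeI)
    fix e assume "e dvd x" "e dvd y"
    then have "e dvd x * s - q * y" by simp
    then show "is_unit e" by (simp only: z(3))
  qed
  moreover have "bqf_eval Q x y = int n" using z(4) by (simp add: bqf_act_def root_form_def)
  ultimately show "z \<in> (SIGMA Q:reduced_forms d. {(x, y). coprime x y \<and> bqf_eval Q x y = int n})"
    using z by simp
qed

text \<open>Two completions of one first column differ by a multiple \<open>j\<close> of it, so the
  corresponding roots differ by \<open>j n\<close> and coincide modulo \<open>n\<close>.\<close>

lemma root_fibre_disjoint:
  assumes n: "n > 0" and t: "t \<in> disc_roots d n" "t' \<in> disc_roots d n" "t \<noteq> t'"
  shows "root_fibre d n t \<inter> root_fibre d n t' = {}"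
proof (rule ccontr)
  assume "root_fibre d n t \<inter> root_fibre d n t' \<noteq> {}"
  then obtain Q x y q s q' s' where 1: "x * s - q * y = 1" "bqf_act Q x q y s = root_form d n t"
    and 2: "x * s' - q' * y = 1" "bqf_act Q x q' y s' = root_form d n t'"
    by (auto simp: root_fibre_def)
  define j where "j = s * q' - q * s'"
  have *: "q' - q = x * j + q' * (1 - (x * s - q * y)) - q * (1 - (x * s' - q' * y))"
    "s' - s = y * j + s' * (1 - (x * s - q * y)) - s * (1 - (x * s' - q' * y))"
    by (simp_all add: j_def algebra_simps)
  have qs: "q' = q + j * x" "s' = s + j * y" using * unfolding 1(1) 2(1) by (simp_all add: algebra_simps)
  have n': "bqf_eval Q x y = int n" using 1(2) by (simp add: bqf_act_def root_form_def)
  have "2 * t' + d mod 4 = 2 * t + d mod 4 + 2 * j * bqf_eval Q x y"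
  proof -
    have "2 * t' + d mod 4 = 2 * coeff_a Q * x * q' + coeff_b Q * (x * s' + q' * y) + 2 * coeff_c Q * y * s'"
      "2 * t + d mod 4 = 2 * coeff_a Q * x * q + coeff_b Q * (x * s + q * y) + 2 * coeff_c Q * y * s"
      using 1(2) 2(2) by (simp_all add: bqf_act_def root_form_def)
    then show ?thesis unfolding qs by (simp add: bqf_eval_def algebra_simps power2_eq_square)
  qed
  then have "t' = t + j * int n" using n' by simp
  then have "[t' = t] (mod int n)" by (simp add: cong_iff_dvd_diff)
  then show False using t by (simp add: disc_roots_def cong_def)
qed

lemma reduced_form_disc_bounds:
  assumes "Q \<in> reduced_forms (- D)"
  shows "coeff_a Q \<ge> 1" "\<bar>coeff_b Q\<bar> \<le> coeff_a Q" "coeff_a Q \<le> coeff_c Q"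
    "D = 4 * coeff_a Q * coeff_c Q - (coeff_b Q)^2" "3 * coeff_a Q * coeff_c Q \<le> D"
proof -
  show 1: "coeff_a Q \<ge> 1" using coeff_a_reduced_forms[OF assms] by simp
  show 2: "\<bar>coeff_b Q\<bar> \<le> coeff_a Q" and 3: "coeff_a Q \<le> coeff_c Q"
    using assms by (auto simp: reduced_forms_def bqf_reduced_def)
  show 4: "D = 4 * coeff_a Q * coeff_c Q - (coeff_b Q)^2"
    using bqf_disc_reduced_forms[OF assms] by (simp add: bqf_disc_def)
  have "(coeff_b Q)^2 = \<bar>coeff_b Q\<bar> * \<bar>coeff_b Q\<bar>" by (simp add: power2_eq_square)
  also have "\<dots> \<le> coeff_a Q * coeff_c Q" using 1 2 3 by (intro mult_mono) auto
  finally show "3 * coeff_a Q * coeff_c Q \<le> D" using 4 by simp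
qed

lemma finite_reduced_forms: "finite (reduced_forms (- D))"
proof (rule finite_subset)
  show "reduced_forms (- D) \<subseteq> (\<lambda>(a, b, c). BQF a b c) ` ({0..D} \<times> {-D..D} \<times> {0..D})"
  proof
    fix Q assume Q: "Q \<in> reduced_forms (- D)"
    note b = reduced_form_disc_bounds[OF Q]
    have "1 * coeff_c Q \<le> (3 * coeff_a Q) * coeff_c Q" using b by (intro mult_right_mono) auto
    then have "coeff_c Q \<le> D" using b(5) by simp
    then show "Q \<in> (\<lambda>(a, b, c). BQF a b c) ` ({0..D} \<times> {-D..D} \<times> {0..D})"
      using b by (intro image_eqI[of _ _ "(coeff_a Q, coeff_b Q, coeff_c Q)"]) auto
  qed
qed auto

lemma sum_primitive_representations:
  assumes d: "fundamental_discriminant (- D)" "D > 0" and n: "n > 0"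
  shows "(\<Sum>Q\<in>reduced_forms (- D). card {(x, y). coprime x y \<and> bqf_eval Q x y = int n}) =
    card (pell_solutions D) * card (disc_roots (- D) n)"
proof -
  have fin: "finite {(x, y). coprime x y \<and> bqf_eval Q x y = int n}" if "Q \<in> reduced_forms (- D)" for Q
  proof (rule finite_subset[of _ "{(x, y). bqf_eval Q x y = int n}"])
    show "finite {(x, y). bqf_eval Q x y = int n}"
      using coeff_a_reduced_forms[OF that] bqf_disc_reduced_forms[OF that] d(2)
      by (intro finite_bqf_representations) auto
  qed auto
  have neg: "- D < 0" using d(2) by simp
  have "(\<Sum>Q\<in>reduced_forms (- D). card {(x, y). coprime x y \<and> bqf_eval Q x y = int n}) =
    card (SIGMA Q:reduced_forms (- D). {(x, y). coprime x y \<and> bqf_eval Q x y = int n})"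
    by (rule card_SigmaI[OF finite_reduced_forms, symmetric]) (use fin in blast)
  also have "\<dots> = card (\<Union>t\<in>disc_roots (- D) n. root_fibre (- D) n t)"
    unfolding primitive_representations_eq_UN_root_fibre[OF d(1) neg n] ..
  also have "\<dots> = (\<Sum>t\<in>disc_roots (- D) n. card (root_fibre (- D) n t))"
  proof (rule card_UN_disjoint)
    have "finite (SIGMA Q:reduced_forms (- D). {(x, y). coprime x y \<and> bqf_eval Q x y = int n})"
      by (rule finite_SigmaI[OF finite_reduced_forms]) (rule fin)
    then have "finite (\<Union>t\<in>disc_roots (- D) n. root_fibre (- D) n t)"
      unfolding primitive_representations_eq_UN_root_fibre[OF d(1) neg n] .
    then show "\<forall>t\<in>disc_roots (- D) n. finite (root_fibre (- D) n t)"
      by (meson UN_upper finite_subset)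
  qed (use root_fibre_disjoint[OF n] in auto)
  also have "\<dots> = (\<Sum>t\<in>disc_roots (- D) n. card (pell_solutions D))"
    using card_root_fibre[OF d(1) neg n] by (intro sum.cong refl) simp
  finally show ?thesis by (simp add: mult.commute)
qed

lemma num_reps_eq_sum_primitive:
  assumes Q: "coeff_a Q > 0" "bqf_disc Q < 0" and n: "n > 0"
  shows "num_reps n Q = (\<Sum>g | g^2 dvd n. card {(x, y). coprime x y \<and> bqf_eval Q x y = int (n div g^2)})"
proof -
  let ?P = "\<lambda>g. {(x, y). coprime x y \<and> bqf_eval Q x y = int (n div g^2)}"
  have fin: "finite (?P g)" for g
    by (rule finite_subset[OF _ finite_bqf_representations[OF Q, of "int (n div g^2)"]]) auto
  have finG: "finite {g. g^2 dvd n}"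
  proof (rule finite_subset)
    show "{g. g^2 dvd n} \<subseteq> {..n}"
    proof
      fix g assume "g \<in> {g. g^2 dvd n}"
      then have "g^2 \<le> n" using n by (auto intro: dvd_imp_le)
      moreover have "g \<le> g^2" by (cases g) (auto simp: power2_eq_square)
      ultimately show "g \<in> {..n}" by simp
    qed
  qed simp
  have nsq: "int n = int (n div g^2) * (int g)^2" "g > 0" if "g^2 dvd n" for g
  proof -
    have "n = n div g^2 * g^2" using that by simp
    then show "int n = int (n div g^2) * (int g)^2" by (metis of_nat_mult of_nat_power)
    show "g > 0" using that n by (cases "g = 0") auto
  qed
  have "bij_betw (\<lambda>(g, x, y). (int g * x, int g * y)) (SIGMA g:{g. g^2 dvd n}. ?P g) {(x, y). bqf_eval Q x y = int n}"
  proof (rule bij_betw_imageI)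
    show "inj_on (\<lambda>(g, x, y). (int g * x, int g * y)) (SIGMA g:{g. g^2 dvd n}. ?P g)"
    proof (rule inj_onI)
      fix p p' assume p: "p \<in> (SIGMA g:{g. g^2 dvd n}. ?P g)" "p' \<in> (SIGMA g:{g. g^2 dvd n}. ?P g)"
        and eq: "(case p of (g, x, y) \<Rightarrow> (int g * x, int g * y)) = (case p' of (g, x, y) \<Rightarrow> (int g * x, int g * y))"
      obtain g x y where 1: "p = (g, x, y)" "g^2 dvd n" "coprime x y" using p(1) by auto
      obtain g' x' y' where 2: "p' = (g', x', y')" "g'^2 dvd n" "coprime x' y'" using p(2) by auto
      have e: "int g * x = int g' * x'" "int g * y = int g' * y'" using eq 1 2 by auto
      have "gcd (int g * x) (int g * y) = int g" "gcd (int g' * x') (int g' * y') = int g'"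
        using 1(3) 2(3) by (simp_all add: gcd_mult_left)
      then have "g = g'" using e by simp
      then show "p = p'" using e nsq(2)[OF 1(2)] 1 2 by simp
    qed
    show "(\<lambda>(g, x, y). (int g * x, int g * y)) ` (SIGMA g:{g. g^2 dvd n}. ?P g) = {(x, y). bqf_eval Q x y = int n}"
    proof (intro equalityI subsetI)
      fix p assume "p \<in> (\<lambda>(g, x, y). (int g * x, int g * y)) ` (SIGMA g:{g. g^2 dvd n}. ?P g)"
      then obtain g x y where p: "p = (int g * x, int g * y)" "g^2 dvd n" "bqf_eval Q x y = int (n div g^2)" by auto
      have "bqf_eval Q (int g * x) (int g * y) = int n"
        unfolding bqf_eval_scale p(3) nsq(1)[OF p(2)] by (simp add: mult.commute)
      then show "p \<in> {(x, y). bqf_eval Q x y = int n}" by (simp add: p(1))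
    next
      fix p assume "p \<in> {(x, y). bqf_eval Q x y = int n}"
      then obtain x y where p: "p = (x, y)" "bqf_eval Q x y = int n" by auto
      have nz: "x \<noteq> 0 \<or> y \<noteq> 0" using p(2) n by (auto simp: bqf_eval_def)
      obtain x' y' where xy: "x = gcd x y * x'" "y = gcd x y * y'" "coprime x' y'"
        using gcd_coprime_exists[of x y] nz by (auto simp: mult.commute)
      define g where "g = nat (gcd x y)"
      have g: "int g = gcd x y" "g > 0" using nz by (auto simp: g_def)
      have n': "int n = (int g)^2 * bqf_eval Q x' y'" using p(2) xy(1,2) bqf_eval_scale[of Q "int g" x' y'] g(1) by simp
      then have "int (g^2) dvd int n" by simp
      then have gd: "g^2 dvd n" by (simp only: int_dvd_int_iff)
      have "int (n div g^2) * (int g)^2 = bqf_eval Q x' y' * (int g)^2"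
        using nsq(1)[OF gd] n' by (simp only: mult.commute)
      then have "int (n div g^2) = bqf_eval Q x' y' \<or> (int g)^2 = 0" by (simp only: mult_cancel_right) blast
      then have "bqf_eval Q x' y' = int (n div g^2)" using g(2) by auto
      then show "p \<in> (\<lambda>(g, x, y). (int g * x, int g * y)) ` (SIGMA g:{g. g^2 dvd n}. ?P g)"
        using xy g gd p(1) by (intro rev_image_eqI[of "(g, x', y')"]) auto
    qed
  qed
  from bij_betw_same_card[OF this] show ?thesis
    unfolding num_reps_def using fin finG by (subst (asm) card_SigmaI) auto
qed

theorem sum_num_reps:
  assumes d: "fundamental_discriminant (- D)" "D > 0" and n: "n > 0"
  shows "int (\<Sum>Q\<in>reduced_forms (- D). num_reps n Q) =
    int (card (pell_solutions D)) * (\<Sum>k | k dvd n. kronecker (- D) (int k))"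
proof -
  have "(\<Sum>Q\<in>reduced_forms (- D). num_reps n Q) =
    (\<Sum>Q\<in>reduced_forms (- D). \<Sum>g | g^2 dvd n. card {(x, y). coprime x y \<and> bqf_eval Q x y = int (n div g^2)})"
    using num_reps_eq_sum_primitive n coeff_a_reduced_forms bqf_disc_reduced_forms d(2)
    by (intro sum.cong refl) fastforce
  also have "\<dots> = (\<Sum>g | g^2 dvd n. \<Sum>Q\<in>reduced_forms (- D). card {(x, y). coprime x y \<and> bqf_eval Q x y = int (n div g^2)})"
    by (rule sum.swap)
  also have "\<dots> = (\<Sum>g | g^2 dvd n. card (pell_solutions D) * card (disc_roots (- D) (n div g^2)))"
  proof (intro sum.cong refl)
    fix g assume "g \<in> {g. g^2 dvd n}"
    then have "n div g^2 > 0" using n by (auto elim!: dvdE)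
    then show "(\<Sum>Q\<in>reduced_forms (- D). card {(x, y). coprime x y \<and> bqf_eval Q x y = int (n div g^2)}) =
        card (pell_solutions D) * card (disc_roots (- D) (n div g^2))"
      by (rule sum_primitive_representations[OF d])
  qed
  also have "\<dots> = card (pell_solutions D) * (\<Sum>g | g^2 dvd n. card (disc_roots (- D) (n div g^2)))"
    by (rule sum_distrib_left[symmetric])
  finally show ?thesis
    using sum_disc_roots_eq_sum_kronecker[OF d(1) n] by simp
qed

lemma card_pell_solutions:
  assumes "fundamental_discriminant (- D)" "D > 0"
  shows "card (pell_solutions D) = (if D = 3 then 6 else if D = 4 then 4 else 2)"
proof -
  have "D \<noteq> 1" "D \<noteq> 2" using assms(1) by (auto simp: fundamental_discriminant_def)
  then have D: "D \<ge> 3" using assms(2) by simp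
  have sq: "z^2 \<le> 4 \<Longrightarrow> z \<in> {-2, -1, 0, 1, 2}" for z :: int
  proof -
    assume "z^2 \<le> 4"
    then have "\<bar>z\<bar>^2 \<le> 2^2" by simp
    then have "\<bar>z\<bar> \<le> 2" by (rule power2_le_imp_le) simp
    then show ?thesis by auto
  qed
  have bound: "t \<in> {-2, -1, 0, 1, 2} \<and> u \<in> {-1, 0, 1} \<and> (u \<noteq> 0 \<longrightarrow> D \<le> 4)" if "(t, u) \<in> pell_solutions D" for t u
  proof -
    have eq: "t^2 + D * u^2 = 4" using that by (simp add: pell_solutions_def)
    have "D * u^2 \<ge> 0" using assms(2) by simp
    then have t: "t^2 \<le> 4" "D * u^2 \<le> 4" using eq zero_le_power2[of t] by linarith+
    have "3 * u^2 \<le> D * u^2" using D by (intro mult_right_mono) auto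
    then have "3 * u^2 \<le> 4" using t(2) by simp
    then have "u^2 \<le> 1" by simp
    then have "\<bar>u\<bar> \<le> 1" by (simp add: abs_square_le_1)
    then have u: "u \<in> {-1, 0, 1}" by auto
    then have "u \<noteq> 0 \<longrightarrow> D \<le> 4" using t(2) by auto
    then show ?thesis using sq[OF t(1)] u by blast
  qed
  consider "D = 3" | "D = 4" | "D > 4" using D by linarith
  then show ?thesis
  proof cases
    case 1
    have "pell_solutions D = {(2, 0), (-2, 0), (1, 1), (1, -1), (-1, 1), (-1, -1)}"
    proof (intro equalityI subsetI)
      fix p assume p: "p \<in> pell_solutions D"
      obtain t u where tu: "p = (t, u)" by (cases p)
      have "t^2 + 3 * u^2 = 4" using p 1 by (simp add: tu pell_solutions_def)
      then show "p \<in> {(2, 0), (-2, 0), (1, 1), (1, -1), (-1, 1), (-1, -1)}"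
        using bound[of t u] p by (auto simp: tu)
    qed (auto simp: pell_solutions_def 1)
    then show ?thesis using 1 by simp
  next
    case 2
    have "pell_solutions D = {(2, 0), (-2, 0), (0, 1), (0, -1)}"
    proof (intro equalityI subsetI)
      fix p assume p: "p \<in> pell_solutions D"
      obtain t u where tu: "p = (t, u)" by (cases p)
      have "t^2 + 4 * u^2 = 4" using p 2 by (simp add: tu pell_solutions_def)
      then show "p \<in> {(2, 0), (-2, 0), (0, 1), (0, -1)}"
        using bound[of t u] p by (auto simp: tu)
    qed (auto simp: pell_solutions_def 2)
    then show ?thesis using 2 by simp
  next
    case 3
    have "pell_solutions D = {(2, 0), (-2, 0)}"
    proof (intro equalityI subsetI)
      fix p assume p: "p \<in> pell_solutions D"
      obtain t u where tu: "p = (t, u)" by (cases p)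
      have "u = 0" using bound[of t u] p 3 by (auto simp: tu)
      moreover have "t^2 + D * u^2 = 4" using p by (simp add: tu pell_solutions_def)
      ultimately show "p \<in> {(2, 0), (-2, 0)}"
        using bound[of t u] p by (auto simp: tu)
    qed (auto simp: pell_solutions_def)
    then show ?thesis using 3 by simp
  qed
qed

section \<open>Ambiguous forms and odd class numbers\<close>

text \<open>Records the smaller factor of every unordered factorization of \<open>n\<close> into two
  different factors.\<close>

definition small_divisors :: "nat \<Rightarrow> nat set" where
  "small_divisors n = {u. u dvd n \<and> u * u < n}"

lemma card_divisors_nonsquare:
  assumes n: "n > 0" "\<And>u. u * u \<noteq> n"
  shows "card {u. u dvd n} = 2 * card (small_divisors n)"
proof -
  let ?L = "{u. u dvd n \<and> u * u > n}"
  have "bij_betw (\<lambda>u. n div u) (small_divisors n) ?L"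
  proof (rule bij_betwI')
    fix u v assume "u \<in> small_divisors n" "v \<in> small_divisors n"
    then have "n = u * (n div u)" "n = v * (n div v)" by (simp_all add: small_divisors_def)
    then show "n div u = n div v \<longleftrightarrow> u = v"
      using n(1) by (metis mult_cancel_right mult_zero_right less_irrefl)
  next
    fix u assume "u \<in> small_divisors n"
    then obtain v where v: "n = u * v" "u * u < u * v" by (auto simp: small_divisors_def elim!: dvdE)
    then have "u > 0" "u < v" using n(1) by auto
    then have "u * v < v * v" by simp
    then show "n div u \<in> ?L" using v \<open>u > 0\<close> by simp
  next
    fix v assume "v \<in> ?L"
    then obtain u where u: "n = v * u" "v * u < v * v" by (auto elim!: dvdE)
    then have "v > 0" "u < v" "u > 0" using n(1) by auto
    then have "u * u < v * u" by simp
    then show "\<exists>u\<in>small_divisors n. v = n div u"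
      using u \<open>u > 0\<close> by (intro bexI[of _ u]) (auto simp: small_divisors_def)
  qed
  then have "card ?L = card (small_divisors n)" by (rule bij_betw_same_card[symmetric])
  moreover have "{u. u dvd n} = small_divisors n \<union> ?L"
    using n(2) by (auto simp: small_divisors_def neq_iff)
  moreover have "card (small_divisors n \<union> ?L) = card (small_divisors n) + card ?L"
    using n(1) by (intro card_Un_disjoint) (auto simp: small_divisors_def intro: finite_subset[of _ "{u. u dvd n}"])
  ultimately show ?thesis by simp
qed

lemma squarefree_nonsquare:
  fixes n u :: nat
  assumes "squarefree n" "n > 1"
  shows "u * u \<noteq> n"
proof
  assume "u * u = n"
  then have "u^2 dvd n" by (simp add: power2_eq_square)
  then have "u dvd 1" using assms(1) by (auto simp: squarefree_def)
  then show False using \<open>u * u = n\<close> assms(2) by simp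
qed

text \<open>The number of unordered factorizations of a squarefree number is \<open>2\<^sup>t\<^sup>-\<^sup>1\<close> for \<open>t\<close> prime factors;
  only its parity matters.\<close>

lemma odd_card_small_divisors_imp_prime:
  assumes sf: "squarefree n" and n: "n > 1" and odd: "odd (card (small_divisors n))"
  shows "prime n"
proof -
  obtain p where p: "prime p" "p dvd n" using n prime_factor_nat by (metis nat_neq_iff)
  then obtain m where m: "n = p * m" by (elim dvdE)
  have m0: "m > 0" using m n by (auto intro: gr0I)
  have sfm: "squarefree m" using sf m by (metis dvd_triv_right squarefree_mono)
  have pm: "\<not> p dvd m"
  proof
    assume "p dvd m"
    then have "p^2 dvd n" using m by (auto simp: power2_eq_square)
    then have "is_unit p" using sf by (auto simp: squarefree_def)
    then show False using p(1) not_prime_unit by blast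
  qed
  show ?thesis
  proof (cases "m = 1")
    case True
    then show ?thesis using p m by simp
  next
    case False
    then have m1: "m > 1" using m0 by simp
    have "bij_betw (\<lambda>(i, k). p ^ i * k) ({i. i \<le> 1} \<times> {k. k dvd m}) {k. k dvd p ^ 1 * m}"
    proof (rule bij_betw_prime_power_times[OF p(1) pm])
      show "k > 0" if "k dvd p ^ 1 * m" for k using dvd_pos_nat[of n k] that n m prime_gt_0_nat[OF p(1)] m0 by simp
      show "\<not> p dvd k" if "k dvd m" for k using that pm dvd_trans by blast
    qed (rule prime_power_times_dvd_iff[OF p(1) pm])
    \<comment> \<open>Removing \<open>p\<close> halves the number of divisors. Since
      \<open>m > 1\<close> is again squarefree, hence no square, the same holds for the small
      divisors, whose number is therefore even.\<close>
    from bij_betw_same_card[OF this] have "card {k. k dvd n} = 2 * card {k. k dvd m}"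
      by (simp add: m card_cartesian_product)
    then have "card (small_divisors n) = 2 * card (small_divisors m)"
      using card_divisors_nonsquare[of n] card_divisors_nonsquare[of m]
        squarefree_nonsquare[OF sf n] squarefree_nonsquare[OF sfm m1] n m0 by simp
    then show ?thesis using odd by simp
  qed
qed

lemma reduced_forms_iff:
  assumes "fundamental_discriminant (- D)" "D > 0"
  shows "Q \<in> reduced_forms (- D) \<longleftrightarrow> coeff_a Q > 0 \<and> bqf_disc Q = - D \<and> bqf_reduced Q"
  using assms forms_of_disc_eq[of "- D"] by (auto simp: reduced_forms_def)

lemma int_image_small_divisors:
  assumes "n > 0"
  shows "int ` small_divisors n = {u. 0 < u \<and> u dvd int n \<and> u * u < int n}"
proof (intro equalityI subsetI)
  fix x assume "x \<in> int ` small_divisors n"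
  then obtain u where u: "x = int u" "u dvd n" "u * u < n" by (auto simp: small_divisors_def)
  have "u > 0" using u(2) assms by (rule dvd_pos_nat[rotated])
  moreover have "int u * int u < int n" using u(3) by (metis of_nat_less_iff of_nat_mult)
  ultimately show "x \<in> {u. 0 < u \<and> u dvd int n \<and> u * u < int n}" using u by simp
next
  fix x assume x: "x \<in> {u. 0 < u \<and> u dvd int n \<and> u * u < int n}"
  define u where "u = nat x"
  have u: "x = int u" using x by (simp add: u_def)
  have "u dvd n" using x by (simp add: u)
  moreover have "int (u * u) < int n" using x by (simp add: u)
  then have "u * u < n" by (simp only: of_nat_less_iff)
  ultimately show "x \<in> int ` small_divisors n" unfolding u by (auto simp: small_divisors_def)
qed

text \<open>A reduced form is properly equivalent to its conjugate exactly when
  \<open>b = 0\<close>, \<open>b = a\<close> or \<open>a = c\<close>. The first case is kept apart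
  because it requires \<open>4\<close> to divide \<open>D\<close>; the generic forms below contain
  one member of each remaining conjugate pair.\<close>

definition ambiguous_forms_zero :: "int \<Rightarrow> bqf set" where
  "ambiguous_forms_zero d = {Q \<in> reduced_forms d. coeff_b Q = 0}"

definition ambiguous_forms_pos :: "int \<Rightarrow> bqf set" where
  "ambiguous_forms_pos d = {Q \<in> reduced_forms d. coeff_b Q > 0 \<and> (coeff_b Q = coeff_a Q \<or> coeff_a Q = coeff_c Q)}"

definition generic_forms_pos :: "int \<Rightarrow> bqf set" where
  "generic_forms_pos d = {Q \<in> reduced_forms d. coeff_b Q > 0 \<and> coeff_b Q \<noteq> coeff_a Q \<and> coeff_a Q \<noteq> coeff_c Q}"

lemma bqf_conj_conj [simp]: "bqf_conj (bqf_conj Q) = Q"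
  by (simp add: bqf_conj_def)

lemma bqf_disc_conj [simp]: "bqf_disc (bqf_conj Q) = bqf_disc Q"
  by (simp add: bqf_conj_def bqf_disc_def)

lemma bqf_conj_coeffs [simp]:
  "coeff_a (bqf_conj Q) = coeff_a Q" "coeff_b (bqf_conj Q) = - coeff_b Q" "coeff_c (bqf_conj Q) = coeff_c Q"
  by (simp_all add: bqf_conj_def)

text \<open>With \<open>b < 0\<close> the boundary convention excludes
  \<open>\<bar>b\<bar> = a\<close> and \<open>a = c\<close>, so the conjugate is generic; conversely
  generic forms stay reduced under conjugation.\<close>

lemma reduced_forms_decomposition:
  assumes "fundamental_discriminant (- D)" "D > 0"
  shows "reduced_forms (- D) = (ambiguous_forms_zero (- D) \<union> ambiguous_forms_pos (- D)) \<union>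
    (generic_forms_pos (- D) \<union> bqf_conj ` generic_forms_pos (- D))"
proof (intro equalityI subsetI)
  fix Q assume Q: "Q \<in> reduced_forms (- D)"
  show "Q \<in> (ambiguous_forms_zero (- D) \<union> ambiguous_forms_pos (- D)) \<union>
    (generic_forms_pos (- D) \<union> bqf_conj ` generic_forms_pos (- D))"
  proof (cases "coeff_b Q < 0")
    case True
    then have "bqf_conj Q \<in> generic_forms_pos (- D)"
      using Q by (auto simp: generic_forms_pos_def reduced_forms_iff[OF assms] bqf_reduced_def)
    then have "bqf_conj (bqf_conj Q) \<in> bqf_conj ` generic_forms_pos (- D)" by (rule imageI)
    then show ?thesis by simp
  next
    case False
    then show ?thesis
      using Q by (auto simp: ambiguous_forms_zero_def ambiguous_forms_pos_def generic_forms_pos_def)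
  qed
next
  fix Q assume "Q \<in> (ambiguous_forms_zero (- D) \<union> ambiguous_forms_pos (- D)) \<union>
    (generic_forms_pos (- D) \<union> bqf_conj ` generic_forms_pos (- D))"
  then show "Q \<in> reduced_forms (- D)"
    by (auto simp: ambiguous_forms_zero_def ambiguous_forms_pos_def generic_forms_pos_def
        reduced_forms_iff[OF assms] bqf_reduced_def)
qed

lemma card_reduced_forms:
  assumes "fundamental_discriminant (- D)" "D > 0"
  shows "card (reduced_forms (- D)) =
    card (ambiguous_forms_zero (- D)) + card (ambiguous_forms_pos (- D)) + 2 * card (generic_forms_pos (- D))"
proof -
  let ?Z = "ambiguous_forms_zero (- D)" and ?A = "ambiguous_forms_pos (- D)" and ?G = "generic_forms_pos (- D)"
  have fin: "finite ?Z" "finite ?A" "finite ?G"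
    using finite_reduced_forms[of D] by (auto simp: ambiguous_forms_zero_def ambiguous_forms_pos_def generic_forms_pos_def)
  have "card ((?Z \<union> ?A) \<union> (?G \<union> bqf_conj ` ?G)) = card (?Z \<union> ?A) + card (?G \<union> bqf_conj ` ?G)"
    using fin by (intro card_Un_disjoint) (auto simp: ambiguous_forms_zero_def ambiguous_forms_pos_def generic_forms_pos_def)
  also have "card (?Z \<union> ?A) = card ?Z + card ?A"
    using fin by (intro card_Un_disjoint) (auto simp: ambiguous_forms_zero_def ambiguous_forms_pos_def)
  also have "card (?G \<union> bqf_conj ` ?G) = card ?G + card (bqf_conj ` ?G)"
    using fin by (intro card_Un_disjoint) (auto simp: generic_forms_pos_def)
  also have "card (bqf_conj ` ?G) = card ?G"
    by (rule card_image) (metis bqf_conj_conj inj_onI)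
  finally show ?thesis using reduced_forms_decomposition[OF assms] by simp
qed

text \<open>A reduced form with \<open>b = a\<close> or \<open>a = c\<close> corresponds to the factorization \<open>D = a (4 c - a)\<close>
  respectively \<open>D = (2 a - b) (2 a + b)\<close>; the quotient of the factors is at least 3 in the first case
  and at most 3 in the second one.\<close>

lemma card_ambiguous_forms_pos:
  assumes "fundamental_discriminant (- D)" "D > 0"
  shows "card (ambiguous_forms_pos (- D)) = card {U. 0 < U \<and> U dvd D \<and> U * U < D \<and> 4 dvd U + D div U}"
proof (rule bij_betw_same_card, rule bij_betw_byWitness)
  let ?g = "\<lambda>Q. if coeff_b Q = coeff_a Q then coeff_a Q else 2 * coeff_a Q - coeff_b Q"
  let ?F = "\<lambda>U. if D div U \<ge> 3 * U then BQF U U ((U + D div U) div 4)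
    else BQF ((U + D div U) div 4) ((D div U - U) div 2) ((U + D div U) div 4)"
  \<comment> \<open>The two factors of \<open>D\<close> add up to \<open>4 c\<close> in the case
    \<open>b = a\<close> and to \<open>4 a\<close> in the case \<open>a = c\<close>, whence the
    divisibility by 4.\<close>
  let ?W = "{U. 0 < U \<and> U dvd D \<and> U * U < D \<and> 4 dvd U + D div U}"
  have amb: "(0 < a \<and> b = a \<and> a \<le> c \<and> D = a * (4 * c - a)) \<or> (0 < b \<and> b < a \<and> a = c \<and> D = (2 * a - b) * (2 * a + b))"
    if "BQF a b c \<in> ambiguous_forms_pos (- D)" for a b c
  proof -
    have r: "BQF a b c \<in> reduced_forms (- D)" and b: "b > 0" "b = a \<or> a = c"
      using that by (auto simp: ambiguous_forms_pos_def)
    note B = reduced_form_disc_bounds[OF r, simplified]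
    show ?thesis
    proof (cases "b = a")
      case True
      then show ?thesis using B by (simp add: algebra_simps power2_eq_square)
    next
      case False
      then show ?thesis using B b by (simp add: algebra_simps power2_eq_square)
    qed
  qed
  have main: "?F (?g Q) = Q \<and> ?g Q \<in> ?W" if "Q \<in> ambiguous_forms_pos (- D)" for Q
  proof -
    obtain a b c where Q: "Q = BQF a b c" by (cases Q)
    from amb[of a b c] that consider
      (1) "0 < a" "b = a" "a \<le> c" "D = a * (4 * c - a)" | (2) "0 < b" "b < a" "a = c" "D = (2 * a - b) * (2 * a + b)"
      unfolding Q by blast
    then show ?thesis
    proof cases
      case 1
      have "D div a = 4 * c - a" using 1 by simp
      moreover have "a * a < a * (4 * c - a)" using 1 by (intro mult_strict_left_mono) auto
      ultimately show ?thesis using 1 by (simp add: Q)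
    next
      case 2
      have "D div (2 * a - b) = 2 * a + b" using 2 by simp
      moreover have "(2 * a - b) * (2 * a - b) < (2 * a - b) * (2 * a + b)" using 2 by (intro mult_strict_left_mono) auto
      ultimately show ?thesis using 2 by (simp add: Q)
    qed
  qed
  then show "\<forall>Q\<in>ambiguous_forms_pos (- D). ?F (?g Q) = Q" "?g ` ambiguous_forms_pos (- D) \<subseteq> ?W"
    by blast+
  have main': "?g (?F U) = U \<and> ?F U \<in> ambiguous_forms_pos (- D)" if U: "U \<in> ?W" for U
  proof -
    define V where "V = D div U"
    have V: "D = U * V" "U > 0" using U by (auto simp: V_def)
    have "U * U < U * V" using U V by simp
    then have UV: "U < V" using V(2) by simp
    obtain k where k: "U + V = 4 * k" using U by (auto simp: V_def elim!: dvdE)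
    then have Vk: "V = 4 * k - U" by simp
    show ?thesis
    proof (cases "V \<ge> 3 * U")
      case True
      have F: "?F U = BQF U U k" using True k by (simp add: V_def[symmetric])
      have "bqf_disc (BQF U U k) = - D" using V(1) by (simp add: bqf_disc_def Vk power2_eq_square algebra_simps)
      then have "BQF U U k \<in> ambiguous_forms_pos (- D)"
        using V(2) True by (simp add: ambiguous_forms_pos_def reduced_forms_iff[OF assms] bqf_reduced_def Vk)
      then show ?thesis unfolding F by simp
    next
      case False
      define b where "b = 2 * k - U"
      have b: "V - U = 2 * b" "U = 2 * k - b" "V = 2 * k + b" using k by (simp_all add: b_def)
      have F: "?F U = BQF k b k" using False k b(1) by (simp add: V_def[symmetric])
      have bk: "0 < b" "b < k" using UV False b by simp_all
      have "bqf_disc (BQF k b k) = - D" using V(1) by (simp add: bqf_disc_def b(2,3) power2_eq_square algebra_simps)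
      then have "BQF k b k \<in> ambiguous_forms_pos (- D)"
        using bk by (simp add: ambiguous_forms_pos_def reduced_forms_iff[OF assms] bqf_reduced_def)
      then show ?thesis unfolding F using bk b by simp
    qed
  qed
  then show "\<forall>U\<in>?W. ?g (?F U) = U" "?F ` ?W \<subseteq> ambiguous_forms_pos (- D)"
    by blast+
qed

text \<open>Here \<open>D = 4 a c\<close>, so \<open>M = a c\<close>. The inequality is not strict
  because \<open>a = c\<close> is compatible with \<open>b = 0\<close>.\<close>

lemma card_ambiguous_forms_zero:
  assumes "fundamental_discriminant (- (4 * M))" "M > 0"
  shows "card (ambiguous_forms_zero (- (4 * M))) = card {u. 0 < u \<and> u dvd M \<and> u * u \<le> M}"
proof (rule bij_betw_same_card, rule bij_betw_byWitness)
  have pos: "4 * M > 0" using assms(2) by simp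
  let ?W = "{u. 0 < u \<and> u dvd M \<and> u * u \<le> M}" and ?F = "\<lambda>u. BQF u 0 (M div u)"
  have main: "?F (coeff_a Q) = Q \<and> coeff_a Q \<in> ?W" if "Q \<in> ambiguous_forms_zero (- (4 * M))" for Q
  proof -
    obtain a b c where Q: "Q = BQF a b c" by (cases Q)
    have r: "BQF a b c \<in> reduced_forms (- (4 * M))" and b: "b = 0"
      using that by (auto simp: ambiguous_forms_zero_def Q)
    note B = reduced_form_disc_bounds[OF r, simplified]
    have M: "M = a * c" using B b by simp
    have "a * a \<le> a * c" using B by (intro mult_left_mono) auto
    then show ?thesis using B b M by (simp add: Q)
  qed
  then show "\<forall>Q\<in>ambiguous_forms_zero (- (4 * M)). ?F (coeff_a Q) = Q" "coeff_a ` ambiguous_forms_zero (- (4 * M)) \<subseteq> ?W"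
    by blast+
  have "?F u \<in> ambiguous_forms_zero (- (4 * M))" if u: "u \<in> ?W" for u
  proof -
    have M: "M = u * (M div u)" "u > 0" using u by simp_all
    have "u * u \<le> u * (M div u)" using u by simp
    then have "u \<le> M div u" using M(2) by simp
    moreover have "bqf_disc (?F u) = - (4 * M)" using u by (simp add: bqf_disc_def)
    ultimately show ?thesis
      using M(2) by (simp add: ambiguous_forms_zero_def reduced_forms_iff[OF assms(1) pos] bqf_reduced_def)
  qed
  then show "?F ` ?W \<subseteq> ambiguous_forms_zero (- (4 * M))" by blast
qed simp

lemma squarefree_of_nat_imp_squarefree:
  assumes "squarefree (int n)"
  shows "squarefree n"
  unfolding squarefree_def
proof (intro allI impI)
  fix x :: nat assume "x^2 dvd n"
  then have "(int x)^2 dvd int n" by (simp flip: of_nat_power)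
  then have "int x dvd 1" using assms unfolding squarefree_def by blast
  then show "is_unit x" by simp
qed

lemma mod_4_cases: "(x::int) mod 4 \<in> {0, 1, 2, 3}"
proof -
  have "0 \<le> x mod 4" "x mod 4 < 4" by simp_all
  then show ?thesis by auto
qed

text \<open>Conjugation pairs off the generic forms, so the number of ambiguous forms is odd. With
  \<open>M = D / 4\<close> for even \<open>D\<close>, that number counts the small divisors of
  \<open>D\<close> if \<open>D\<close> is odd, those of \<open>M\<close> if \<open>M\<close> is
  even, and twice those of \<open>M\<close> if \<open>M > 1\<close> is odd. The last case is
  impossible; \<open>M = 1\<close> is treated separately.\<close>

theorem odd_class_number:
  fixes D :: nat
  assumes d: "fundamental_discriminant (- int D)" "D > 0" and odd: "odd (card (reduced_forms (- int D)))"
  shows "D = 4 \<or> D = 8 \<or> prime D"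
    and "card (ambiguous_forms_zero (- int D) \<union> ambiguous_forms_pos (- int D)) = 1"
proof -
  let ?Z = "ambiguous_forms_zero (- int D)" and ?A = "ambiguous_forms_pos (- int D)"
  have D0: "int D > 0" using d(2) by simp
  have odd': "odd (card ?Z + card ?A)"
    using odd card_reduced_forms[OF d(1) D0] by simp
  have card_un: "card (?Z \<union> ?A) = card ?Z + card ?A"
    using finite_reduced_forms[of "int D"]
    by (intro card_Un_disjoint) (auto simp: ambiguous_forms_zero_def ambiguous_forms_pos_def)
  note A = card_ambiguous_forms_pos[OF d(1) D0]
  have card_int: "card {u. 0 < u \<and> u dvd int n \<and> u * u < int n} = card (small_divisors n)" if "n > 0" for n
    unfolding int_image_small_divisors[OF that, symmetric] by (rule card_image) simp
  have small_prime: "card (small_divisors p) = 1" if "prime p" for p :: nat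
  proof -
    have "small_divisors p = {1}"
      using that prime_gt_1_nat[OF that] by (auto simp: small_divisors_def prime_nat_iff)
    then show ?thesis by simp
  qed
  have "(D = 4 \<or> D = 8 \<or> prime D) \<and> card ?Z + card ?A = 1"
  proof (cases "(- int D) mod 4 = 1")
    case True
    then have D4: "int D mod 4 = 3" by presburger
    have "squarefree (int D)" using d(1) True by (auto simp: fundamental_discriminant_def squarefree_def)
    then have sf: "squarefree D" by (rule squarefree_of_nat_imp_squarefree)
    have D1: "D > 1" using D4 by (cases "D = 1") (use d(2) in auto)
    have "?Z = {}"
    proof (rule ccontr)
      assume "?Z \<noteq> {}"
      then obtain Q where "Q \<in> reduced_forms (- int D)" "coeff_b Q = 0" by (auto simp: ambiguous_forms_zero_def)
      then have "int D = 4 * (coeff_a Q * coeff_c Q)" using reduced_form_disc_bounds(4)[of Q "int D"] by simp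
      then show False using D4 by simp
    qed
    \<comment> \<open>As \<open>D\<close> is 3 modulo 4, of two complementary divisors one is 1 and
      the other 3 modulo 4, so their sum is always a multiple of 4.\<close>
    moreover have "{U. 0 < U \<and> U dvd int D \<and> U * U < int D \<and> 4 dvd U + int D div U} =
        {U. 0 < U \<and> U dvd int D \<and> U * U < int D}"
    proof -
      have "4 dvd U + int D div U" if "U dvd int D" for U
      proof -
        define V where "V = int D div U"
        have "int D = U * V" using that by (simp add: V_def)
        then have *: "((U mod 4) * (V mod 4)) mod 4 = 3" using D4 by (simp add: mod_mult_eq)
        have "(U mod 4 + V mod 4) mod 4 = 0" using * mod_4_cases[of U] mod_4_cases[of V] by auto
        then show ?thesis unfolding V_def[symmetric] by (simp add: mod_add_eq dvd_eq_mod_eq_0)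
      qed
      then show ?thesis by blast
    qed
    ultimately have "card ?Z = 0" "card ?A = card (small_divisors D)"
      using A card_int[OF d(2)] by simp_all
    then show ?thesis
      using odd' odd_card_small_divisors_imp_prime[OF sf D1] small_prime by auto
  next
    case False
    define M where "M = D div 4"
    have "(- int D) mod 4 = 0" "(- int D) div 4 mod 4 \<in> {2, 3}" "squarefree ((- int D) div 4)"
      using d(1) False by (auto simp: fundamental_discriminant_def)
    moreover from this have "int D mod 4 = 0" by presburger
    then have DM: "D = 4 * M" unfolding M_def by presburger
    moreover have "(- int D) div 4 = - int M" using DM by simp
    ultimately have M4: "(- int M) mod 4 \<in> {2, 3}" and "squarefree (int M)"
      by (auto simp: squarefree_def)
    then have sf: "squarefree M" by (intro squarefree_of_nat_imp_squarefree)
    have M0: "M > 0" using DM d(2) by simp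
    have Z: "card ?Z = card {u. 0 < u \<and> u dvd int M \<and> u * u \<le> int M}"
      using card_ambiguous_forms_zero[of "int M"] d(1) M0 by (simp add: DM)
    have Z1: "card ?Z = card (small_divisors M)" if "M > 1"
    proof -
      have "u * u \<noteq> int M" for u
      proof
        assume "u * u = int M"
        then have "int (nat \<bar>u\<bar> * nat \<bar>u\<bar>) = int M" by simp
        then show False using squarefree_nonsquare[OF sf that] by (simp only: of_nat_eq_iff)
      qed
      then have "{u. 0 < u \<and> u dvd int M \<and> u * u \<le> int M} = {u. 0 < u \<and> u dvd int M \<and> u * u < int M}"
        by (auto simp: le_less)
      then show ?thesis using Z card_int[OF M0] by simp
    qed
    let ?W = "{U. 0 < U \<and> U dvd int D \<and> U * U < int D \<and> 4 dvd U + int D div U}"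
    have W: "\<exists>u v. U = 2 * u \<and> int M = u * v \<and> even (u + v) \<and> 0 < u \<and> u * u < int M" if "U \<in> ?W" for U
    proof -
      define V where "V = int D div U"
      have UV: "U * V = 4 * int M" "4 dvd U + V" "U > 0" "U * U < 4 * int M" using that DM by (auto simp: V_def)
      have "even (U * V)" "even (U + V)" using UV(1,2) by (simp, presburger)
      then have "even U" "even V" by auto
      then obtain u v where uv: "U = 2 * u" "V = 2 * v" by (auto elim!: evenE)
      moreover have "even (u + v)" using UV(2) unfolding uv by presburger
      ultimately show ?thesis using UV by (intro exI[of _ u] exI[of _ v]) auto
    qed
    show ?thesis
    proof (cases "(- int M) mod 4 = 2")
      case True
      \<comment> \<open>Since \<open>M\<close> is 2 modulo 4, one factor in \<open>M = u v\<close>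
        is odd and the other even, against the even sum.\<close>
      have W0: "?W = {}"
      proof (rule ccontr)
        assume "?W \<noteq> {}"
        then obtain u v where uv: "int M = u * v" "even (u + v)" using W by blast
        have "(- int M) mod 4 = 2 \<longrightarrow> int M mod 4 = 2" by presburger
        then have "((u mod 4) * (v mod 4)) mod 4 = 2" using True uv(1) by (simp add: mod_mult_eq)
        moreover note mod_4_cases[of u] mod_4_cases[of v]
        moreover have "even (u mod 4 + v mod 4)" using uv(2) by presburger
        ultimately show False by auto
      qed
      have "card ?A = 0" unfolding A W0 by simp
      moreover have M1: "M > 1" using True M0 by (cases "M = 1") auto
      ultimately have "prime M" using odd' Z1 odd_card_small_divisors_imp_prime[OF sf] by simp
      moreover have "even M" using True by presburger
      ultimately have "M = 2" using prime_prime_factor primes_dvd_imp_eq two_is_prime_nat by blast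
      then show ?thesis using DM Z1 small_prime[of 2] \<open>card ?A = 0\<close> by simp
    next
      case False
      then have M1: "int M mod 4 = 1" using M4 by auto presburger
      \<comment> \<open>For odd \<open>M\<close> complementary divisors always have an even sum. For
        \<open>M > 1\<close> the forms with \<open>b > 0\<close> are then as numerous as those with
        \<open>b = 0\<close>, which makes the total even.\<close>
      have Weq: "?W = (\<lambda>u. 2 * u) ` {u. 0 < u \<and> u dvd int M \<and> u * u < int M}"
      proof (intro equalityI subsetI)
        fix U assume "U \<in> ?W"
        then show "U \<in> (\<lambda>u. 2 * u) ` {u. 0 < u \<and> u dvd int M \<and> u * u < int M}"
          using W[of U] by auto
      next
        fix U assume "U \<in> (\<lambda>u. 2 * u) ` {u. 0 < u \<and> u dvd int M \<and> u * u < int M}"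
        then obtain u v where u: "U = 2 * u" "0 < u" "int M = u * v" "u * u < int M" by (auto elim!: dvdE)
        have "odd (u * v)" using M1 u(3) by (metis dvd_mod_iff even_numeral odd_one)
        then have "even (u + v)" by simp
        moreover have "int D div U = 2 * v" using u by (simp add: DM)
        moreover from calculation(1) have "4 dvd 2 * u + 2 * v" by presburger
        ultimately have "4 dvd U + int D div U" by (simp add: u(1))
        then show "U \<in> ?W" using u by (simp add: DM)
      qed
      have A1: "card ?A = card (small_divisors M)"
        unfolding A Weq card_int[OF M0, symmetric] by (rule card_image) (simp add: inj_on_def)
      have "M = 1" using Z1 A1 odd' M0 by (cases "M = 1") auto
      moreover have "{u. 0 < u \<and> u dvd int 1 \<and> u * u \<le> int 1} = {1}" by auto
      moreover have "small_divisors 1 = {}" by (auto simp: small_divisors_def)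
      ultimately show ?thesis using DM Z A1 by simp
    qed
  qed
  then show "D = 4 \<or> D = 8 \<or> prime D" "card (?Z \<union> ?A) = 1" using card_un by auto
qed

section \<open>The principal form and the listing of the reduced forms\<close>

lemma principal_form_reduced:
  assumes "fundamental_discriminant (- D)" "D > 0"
  shows "principal_form (- D) \<in> ambiguous_forms_zero (- D) \<union> ambiguous_forms_pos (- D)"
proof (cases "(- D) mod 4 = 0")
  case True
  then have "4 * (- ((- D) div 4)) = D" by presburger
  moreover from this assms(2) have "- ((- D) div 4) \<ge> 1" by presburger
  ultimately show ?thesis
    using True by (simp add: principal_form_def ambiguous_forms_zero_def reduced_forms_iff[OF assms] bqf_reduced_def bqf_disc_def)
next
  case False
  then have "(- D) mod 4 = 1" using assms(1) by (auto simp: fundamental_discriminant_def)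
  then have "4 * ((1 + D) div 4) = 1 + D" by presburger
  moreover from this assms(2) have "(1 + D) div 4 \<ge> 1" by presburger
  ultimately show ?thesis
    using False by (simp add: principal_form_def ambiguous_forms_pos_def reduced_forms_iff[OF assms] bqf_reduced_def bqf_disc_def)
qed

text \<open>Disposes of \<open>D = 4\<close> and \<open>D = 8\<close> once \<open>k \<ge> 1\<close>,
  and of \<open>D = 3\<close>, so that also \<open>w = 2\<close>. The bound 12 is that of
  \<open>3 a c \<le> D\<close>: with \<open>a \<ge> 2\<close> one has
  \<open>a c \<ge> 4\<close>.\<close>

lemma reduced_forms_small:
  assumes d: "fundamental_discriminant (- D)" "D > 0" and small: "D < 12"
  shows "reduced_forms (- D) \<subseteq> {principal_form (- D)}"
proof
  fix Q assume Q: "Q \<in> reduced_forms (- D)"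
  obtain a b c where abc: "Q = BQF a b c" by (cases Q)
  note B = reduced_form_disc_bounds[OF Q, unfolded abc bqf.sel]
  have red: "\<bar>b\<bar> = a \<Longrightarrow> b \<ge> 0" using Q by (auto simp: abc reduced_forms_def bqf_reduced_def)
  have "a = 1"
  proof (rule ccontr)
    assume "a \<noteq> 1"
    then have "2 * 2 \<le> a * c" using B by (intro mult_mono) auto
    then show False using B(5) small by simp
  qed
  then have "b = -1 \<or> b = 0 \<or> b = 1" using B(2) by arith
  then have "b \<in> {0, 1}" "D = 4 * c - b^2" using B(4) red \<open>a = 1\<close> by auto
  then show "Q \<in> {principal_form (- D)}"
  proof (cases "b = 0")
    case True
    then have "D = 4 * c" using \<open>D = 4 * c - b^2\<close> by simp
    then show ?thesis by (simp add: principal_form_def abc True \<open>a = 1\<close>)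
  next
    case False
    then have b: "b = 1" using \<open>b \<in> {0, 1}\<close> by simp
    then have D: "D = 4 * c - 1" using \<open>D = 4 * c - b^2\<close> by simp
    have "(- D) mod 4 = 1" unfolding D by presburger
    moreover have "(1 - (- D)) div 4 = c" unfolding D by simp
    ultimately show ?thesis by (simp add: principal_form_def abc b \<open>a = 1\<close>)
  qed
qed

lemma exists_listing:
  assumes d: "fundamental_discriminant (- D)" "D > 0"
    and amb: "card (ambiguous_forms_zero (- D) \<union> ambiguous_forms_pos (- D)) = 1"
    and card: "card (reduced_forms (- D)) = 2 * k + 1"
  shows "\<exists>Q. lists_reduced_forms (- D) k Q"
proof -
  let ?G = "generic_forms_pos (- D)" and ?Q0 = "principal_form (- D)"
  have fin: "finite ?G" using finite_reduced_forms[of D] by (auto simp: generic_forms_pos_def)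
  have AZ: "ambiguous_forms_zero (- D) \<union> ambiguous_forms_pos (- D) = {?Q0}"
    using amb principal_form_reduced[OF d] by (metis card_1_singletonE singletonD)
  have "card (ambiguous_forms_zero (- D) \<union> ambiguous_forms_pos (- D)) =
      card (ambiguous_forms_zero (- D)) + card (ambiguous_forms_pos (- D))"
    using finite_reduced_forms[of D]
    by (intro card_Un_disjoint) (auto simp: ambiguous_forms_zero_def ambiguous_forms_pos_def)
  then have "card ?G = k" using card card_reduced_forms[OF d] amb by simp
  then obtain f where f: "bij_betw f {1..k} ?G"
    using ex_bij_betw_nat_finite_1[OF fin] by auto
  define Q where "Q = (\<lambda>i. if i = 0 then ?Q0 else f i)"
  define L where "L = concat (map (\<lambda>i. [Q i, bqf_conj (Q i)]) [1..<Suc k])"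
  have Qf: "Q i = f i" if "i \<ge> 1" for i using that by (simp add: Q_def)
  have setL: "set L = ?G \<union> bqf_conj ` ?G"
  proof -
    have "set L = (\<Union>i\<in>{1..<Suc k}. {Q i, bqf_conj (Q i)})"
      unfolding L_def by (simp del: upt_Suc)
    also have "\<dots> = (\<Union>i\<in>{1..k}. {f i, bqf_conj (f i)})"
      using Qf by (intro SUP_cong) auto
    also have "\<dots> = f ` {1..k} \<union> bqf_conj ` f ` {1..k}" by blast
    finally show ?thesis using f by (simp add: bij_betw_def)
  qed
  have len: "length L = 2 * k"
    unfolding L_def by (simp add: length_concat o_def sum_list_triv)
  have R: "set (Q 0 # L) = reduced_forms (- D)"
    using reduced_forms_decomposition[OF d] unfolding AZ by (simp add: setL Q_def)
  \<comment> \<open>Counting replaces a disjointness argument: the list has length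
    \<open>2 k + 1\<close>, which is also the number of its entries as a set.\<close>
  moreover have "distinct (Q 0 # L)"
  proof (rule card_distinct)
    show "card (set (Q 0 # L)) = length (Q 0 # L)" unfolding R card by (simp add: len)
  qed
  ultimately have "lists_reduced_forms (- D) k Q"
    unfolding lists_reduced_forms_def L_def Let_def by (simp add: Q_def)
  then show ?thesis by blast
qed

text \<open>\<open>nome\<close> maps the upper half-plane onto the punctured unit disc, so the
  difference of the two expansions is a power series vanishing on the whole disc.\<close>

lemma nome_power_series_unique:
  fixes s t :: "nat \<Rightarrow> complex"
  assumes "\<And>z. z \<in> upper_half_plane \<Longrightarrow> (\<lambda>n. s (Suc n) * nome z ^ Suc n) sums f z"
    and "\<And>z. z \<in> upper_half_plane \<Longrightarrow> (\<lambda>n. t (Suc n) * nome z ^ Suc n) sums f z"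
    and "n > 0"
  shows "s n = t n"
proof (rule ccontr)
  assume ne: "s n \<noteq> t n"
  \<comment> \<open>The two expansions say nothing about index 0, so the value there is set to
    0.\<close>
  define a where "a k = (if k = 0 then 0 else s k - t k)" for k
  have "(\<lambda>k. a k * (w - 0) ^ k) sums 0" if "norm (w - 0) < 1" for w
  proof (cases "w = 0")
    case True
    have "(\<lambda>k. a k * (0 :: complex) ^ k) = (\<lambda>_. 0)" by (auto simp: a_def fun_eq_iff power_0_left)
    then show ?thesis using True by simp
  next
    case False
    moreover have "norm w < 1" using that by simp
    ultimately obtain z where z: "z \<in> upper_half_plane" "nome z = w"
      by (rule nome_image_upper_half_plane)
    have "(\<lambda>k. s (Suc k) * w ^ Suc k - t (Suc k) * w ^ Suc k) sums (f z - f z)"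
      using sums_diff[OF assms(1,2)[OF z(1)]] unfolding z(2) .
    then have "(\<lambda>k. a (Suc k) * w ^ Suc k) sums 0"
      by (simp only: left_diff_distrib[symmetric] a_def nat.distinct if_False diff_self)
    then have "(\<lambda>k. a k * w ^ k) sums 0"
      by (subst (asm) sums_Suc_iff) (simp add: a_def)
    then show ?thesis by simp
  qed
  note sums = this
  have an: "a n \<noteq> 0" "n > 0" using ne assms(3) by (simp_all add: a_def)
  show False
  proof (rule powser_0_nonzero[of 1 0 a "\<lambda>_. 0" n])
    fix r :: real assume "r > 0" and *: "\<And>z. z \<in> cball (0 :: complex) r - {0} \<Longrightarrow> (0 :: complex) \<noteq> 0"
    then have "of_real r \<in> cball 0 r - {0 :: complex}" by simp
    from *[OF this] show False by simp
  qed (use sums an in auto)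
qed

section \<open>The linear system for the representation numbers\<close>

lemma num_reps_conj: "num_reps n (bqf_conj Q) = num_reps n Q"
  unfolding num_reps_def
proof (rule bij_betw_same_card[of "\<lambda>(x, y). (x, - y)"], rule bij_betw_byWitness[where f' = "\<lambda>(x, y). (x, - y)"])
qed (auto simp: bqf_eval_def bqf_conj_def)

lemma sum_listed_reduced_forms:
  fixes f :: "bqf \<Rightarrow> nat"
  assumes L: "lists_reduced_forms d k Q" and f: "\<And>Q. f (bqf_conj Q) = f Q"
  shows "(\<Sum>R\<in>reduced_forms d. f R) = f (Q 0) + 2 * (\<Sum>i\<in>{1..k}. f (Q i))"
proof -
  define L where "L = Q 0 # concat (map (\<lambda>i. [Q i, bqf_conj (Q i)]) [1..<Suc k])"
  have "distinct L" "set L = reduced_forms d" 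
    using L unfolding lists_reduced_forms_def Let_def L_def by blast+
  then have "(\<Sum>R\<in>reduced_forms d. f R) = sum_list (map f L)" by (metis sum_list_distinct_conv_sum_set)
  also have "\<dots> = f (Q 0) + sum_list (map (\<lambda>i. 2 * f (Q i)) [1..<Suc k])"
  proof -
    have "sum_list (map f (concat (map (\<lambda>i. [Q i, bqf_conj (Q i)]) xs))) = sum_list (map (\<lambda>i. 2 * f (Q i)) xs)" for xs
      by (induction xs) (simp_all add: f)
    then show ?thesis unfolding L_def by (simp del: upt_Suc)
  qed
  also have "sum_list (map (\<lambda>i. 2 * f (Q i)) [1..<Suc k]) = (\<Sum>i\<in>{1..k}. 2 * f (Q i))"
    by (simp only: sum_list_distinct_conv_sum_set[OF distinct_upt] set_upt atLeastLessThanSuc_atLeastAtMost)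
  finally show ?thesis by (simp add: sum_distrib_left)
qed

lemma listed_forms_reduced:
  assumes "lists_reduced_forms d k Q" "i \<le> k"
  shows "Q i \<in> reduced_forms d"
proof -
  have S: "set (Q 0 # concat (map (\<lambda>i. [Q i, bqf_conj (Q i)]) [1..<Suc k])) = reduced_forms d"
    using assms(1) unfolding lists_reduced_forms_def Let_def by blast
  show ?thesis
  proof (cases "i = 0")
    case False
    then have "i \<in> set [1..<Suc k]" using assms(2) by (simp del: upt_Suc)
    then show ?thesis unfolding S[symmetric] by (force simp del: upt_Suc)
  qed (use S in auto)
qed

text \<open>The weight 2 accounts for a form and its conjugate. With \<open>m = 2 K + 1\<close>,
  adding up the differences gives \<open>4 (\<Sum>j. t j) = m N 0 - 2 T\<close>. Then
  \<open>N r = N 0 - 2 t r\<close>, and the coefficient of \<open>t r\<close> becomes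
  \<open>4 / m - 2 = - (4 K - 2) / m\<close>.\<close>

lemma representation_formula_algebra:
  fixes N :: "nat \<Rightarrow> complex" and K :: nat
  assumes N: "N 0 + 2 * (\<Sum>i\<in>{1..K}. N i) = 2 * T" and t: "\<And>i. i \<in> {1..K} \<Longrightarrow> t i = (N 0 - N i) / 2"
  shows "N 0 = 2 / (2 * of_nat K + 1) * T + 4 / (2 * of_nat K + 1) * (\<Sum>j\<in>{1..K}. t j)"
    and "r \<in> {1..K} \<Longrightarrow> N r = 2 / (2 * of_nat K + 1) * T + 4 / (2 * of_nat K + 1) * (\<Sum>j\<in>{1..K} - {r}. t j)
      - (4 * of_nat K - 2) / (2 * of_nat K + 1) * t r"
proof -
  define m :: complex where "m = 2 * of_nat K + 1"
  have m: "m \<noteq> 0"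
    unfolding m_def by (metis of_nat_1 of_nat_add of_nat_eq_0_iff of_nat_mult of_nat_numeral one_neq_zero add_is_0)
  have "(\<Sum>j\<in>{1..K}. t j) = (\<Sum>j\<in>{1..K}. (N 0 - N j) / 2)" using t by (intro sum.cong) auto
  also have "\<dots> = (of_nat K * N 0 - (\<Sum>j\<in>{1..K}. N j)) / 2"
    by (simp add: sum_subtractf flip: sum_divide_distrib)
  finally have E: "(\<Sum>j\<in>{1..K}. t j) = (of_nat K * N 0 - (\<Sum>j\<in>{1..K}. N j)) / 2" .
  have "4 * (\<Sum>j\<in>{1..K}. t j) = 2 * (of_nat K * N 0 - (\<Sum>j\<in>{1..K}. N j))"
    unfolding E by simp
  then have S: "4 * (\<Sum>j\<in>{1..K}. t j) = m * N 0 - 2 * T"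
    unfolding N[symmetric] m_def by (simp add: algebra_simps)
  then have "m * N 0 = 2 * T + 4 * (\<Sum>j\<in>{1..K}. t j)" by simp
  then have N0: "N 0 = 2 / m * T + 4 / m * (\<Sum>j\<in>{1..K}. t j)"
    using m by (simp add: field_simps)
  then show "N 0 = 2 / (2 * of_nat K + 1) * T + 4 / (2 * of_nat K + 1) * (\<Sum>j\<in>{1..K}. t j)"
    by (simp only: m_def)
  assume r: "r \<in> {1..K}"
  have Sr: "(\<Sum>j\<in>{1..K}. t j) = t r + (\<Sum>j\<in>{1..K} - {r}. t j)" using r by (intro sum.remove) auto
  have "N r = N 0 - 2 * t r" unfolding t[OF r] by (simp add: diff_divide_distrib)
  also have "\<dots> = 2 / m * T + 4 / m * (\<Sum>j\<in>{1..K} - {r}. t j) + (4 / m - 2) * t r"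
    unfolding N0 Sr by (simp add: algebra_simps)
  also have "4 / m - 2 = - ((4 * of_nat K - 2) / m)"
  proof -
    have "4 / m - 2 = (4 - 2 * m) / m" using m by (simp add: diff_divide_distrib)
    also have "4 - 2 * m = - (4 * of_nat K - 2)" by (simp add: m_def)
    finally show ?thesis by (simp only: minus_divide_left)
  qed
  finally show "N r = 2 / (2 * of_nat K + 1) * T + 4 / (2 * of_nat K + 1) * (\<Sum>j\<in>{1..K} - {r}. t j)
      - (4 * of_nat K - 2) / (2 * of_nat K + 1) * t r"
    by (simp add: m_def)
qed

theorem theorem1p1:
  fixes D k :: nat and w :: int
  assumes "D > 0"
    and "fundamental_discriminant (- int D)"
    and "class_number (- int D) = 2 * k + 1"
    and "w = (if D = 3 then 6 else if D = 4 then 4 else 2)"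
  shows "card (reduced_forms (- int D)) = 2 * k + 1 \<and>
    (\<exists>Q. lists_reduced_forms (- int D) k Q) \<and>
    (\<forall>Q. lists_reduced_forms (- int D) k Q \<longrightarrow>
      (k = 0 \<longrightarrow>
        (\<forall>n>0. int (num_reps n (Q 0)) = w * (\<Sum>d | d dvd n. kronecker (- int D) (int d)))) \<and>
      (k \<ge> 1 \<longrightarrow>
        (\<forall>r\<in>{1..k}. is_cusp_form 1 D (\<lambda>d. of_int (kronecker (- int D) d))
           (theta_diff (Q 0) (Q r))) \<and>
        (\<exists>t :: nat \<Rightarrow> nat \<Rightarrow> complex. \<forall>r\<in>{1..k}. \<forall>z\<in>upper_half_plane.
           (\<lambda>n. t r (Suc n) * nome z ^ Suc n) sums theta_diff (Q 0) (Q r) z) \<and>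
        (\<forall>t :: nat \<Rightarrow> nat \<Rightarrow> complex.
           (\<forall>r\<in>{1..k}. \<forall>z\<in>upper_half_plane.
             (\<lambda>n. t r (Suc n) * nome z ^ Suc n) sums theta_diff (Q 0) (Q r) z) \<longrightarrow>
           (\<forall>r\<in>{1..k}. t r 1 = 1) \<and>
           (\<forall>n>0.
             of_nat (num_reps n (Q 0)) =
               2 / (2 * of_nat k + 1) * of_int (\<Sum>d | d dvd n. kronecker (- int D) (int d))
               + 4 / (2 * of_nat k + 1) * (\<Sum>j\<in>{1..k}. t j n) \<and>
             (\<forall>r\<in>{1..k}.
               num_reps n (Q r) = num_reps n (bqf_conj (Q r)) \<and>
               of_nat (num_reps n (Q r)) =
                 2 / (2 * of_nat k + 1) * of_int (\<Sum>d | d dvd n. kronecker (- int D) (int d))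
                 + 4 / (2 * of_nat k + 1) * (\<Sum>j\<in>{1..k} - {r}. t j n)
                 - (4 * of_nat k - 2) / (2 * of_nat k + 1) * t r n)))))"
proof -
  have fd: "fundamental_discriminant (- int D)" and D0: "int D > 0" using assms by simp_all
  have card: "card (reduced_forms (- int D)) = 2 * k + 1"
    using class_number_eq_card_reduced_forms[OF fd] D0 assms(3) by simp
  then have odd: "odd (card (reduced_forms (- int D)))" by simp
  note oc = odd_class_number[OF fd assms(1) odd]
  have ex: "\<exists>Q. lists_reduced_forms (- int D) k Q"
    by (rule exists_listing[OF fd D0 oc(2) card])
  have total: "int (num_reps n (Q 0)) + 2 * (\<Sum>i\<in>{1..k}. int (num_reps n (Q i))) = w * (\<Sum>d | d dvd n. kronecker (- int D) (int d))"
    if "lists_reduced_forms (- int D) k Q" "n > 0" for Q n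
    using sum_num_reps[OF fd D0 that(2)] card_pell_solutions[OF fd D0] assms(4)
      sum_listed_reduced_forms[OF that(1), of "num_reps n", OF num_reps_conj] by simp
  have part2: "(\<forall>r\<in>{1..k}. is_cusp_form 1 D (\<lambda>d. of_int (kronecker (- int D) d)) (theta_diff (Q 0) (Q r))) \<and>
        (\<exists>t :: nat \<Rightarrow> nat \<Rightarrow> complex. \<forall>r\<in>{1..k}. \<forall>z\<in>upper_half_plane.
           (\<lambda>n. t r (Suc n) * nome z ^ Suc n) sums theta_diff (Q 0) (Q r) z) \<and>
        (\<forall>t :: nat \<Rightarrow> nat \<Rightarrow> complex.
           (\<forall>r\<in>{1..k}. \<forall>z\<in>upper_half_plane.
             (\<lambda>n. t r (Suc n) * nome z ^ Suc n) sums theta_diff (Q 0) (Q r) z) \<longrightarrow>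
           (\<forall>r\<in>{1..k}. t r 1 = 1) \<and>
           (\<forall>n>0.
             of_nat (num_reps n (Q 0)) =
               2 / (2 * of_nat k + 1) * of_int (\<Sum>d | d dvd n. kronecker (- int D) (int d))
               + 4 / (2 * of_nat k + 1) * (\<Sum>j\<in>{1..k}. t j n) \<and>
             (\<forall>r\<in>{1..k}.
               num_reps n (Q r) = num_reps n (bqf_conj (Q r)) \<and>
               of_nat (num_reps n (Q r)) =
                 2 / (2 * of_nat k + 1) * of_int (\<Sum>d | d dvd n. kronecker (- int D) (int d))
                 + 4 / (2 * of_nat k + 1) * (\<Sum>j\<in>{1..k} - {r}. t j n)
                 - (4 * of_nat k - 2) / (2 * of_nat k + 1) * t r n)))"
    if L: "lists_reduced_forms (- int D) k Q" and k: "k \<ge> 1" for Q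
  proof -
    have big: "\<not> int D < 12"
    proof
      assume "int D < 12"
      from card_mono[OF _ reduced_forms_small[OF fd D0 this]] have "card (reduced_forms (- int D)) \<le> 1" by simp
      then show False using card k by simp
    qed
    then have p: "prime D" and w: "w = 2" using oc(1) assms(4) by auto
    have Q: "coeff_a (Q i) > 0" "bqf_disc (Q i) = - int D" "bqf_disc (Q i) < 0" if "i \<le> k" for i
      using coeff_a_reduced_forms[OF listed_forms_reduced[OF L that]]
        bqf_disc_reduced_forms[OF listed_forms_reduced[OF L that]] D0 by simp_all
    \<comment> \<open>The explicit coefficients. Any other expansion agrees with them at positive
      indices, which transfers everything shown for \<open>s\<close> to an arbitrary
      \<open>t\<close>.\<close>
    define s where "s r n = (of_nat (num_reps n (Q 0)) - of_nat (num_reps n (Q r))) / (2 :: complex)" for r n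
    have s: "(\<lambda>n. s r (Suc n) * nome z ^ Suc n) sums theta_diff (Q 0) (Q r) z"
      if "r \<in> {1..k}" "z \<in> upper_half_plane" for r z
      unfolding s_def by (rule theta_diff_sums) (use Q[of 0] Q[of r] that in auto)
    have cusp: "is_cusp_form 1 D (\<lambda>d. of_int (kronecker (- int D) d)) (theta_diff (Q 0) (Q r))" if "r \<in> {1..k}" for r
      using that Q[of 0] Q[of r] by (intro theta_diff_cusp_form[OF p]) auto
    have ts: "t r n = s r n" if "\<forall>r\<in>{1..k}. \<forall>z\<in>upper_half_plane. (\<lambda>n. t r (Suc n) * nome z ^ Suc n) sums theta_diff (Q 0) (Q r) z"
        "r \<in> {1..k}" "n > 0" for t r n
      by (rule nome_power_series_unique[where f = "theta_diff (Q 0) (Q r)"]) (use that s in auto)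
    have totalC: "of_nat (num_reps n (Q 0)) + 2 * (\<Sum>i\<in>{1..k}. of_nat (num_reps n (Q i))) =
        2 * (of_int (\<Sum>d | d dvd n. kronecker (- int D) (int d)) :: complex)" if "n > 0" for n
      using arg_cong[OF total[OF L that], of "of_int :: int \<Rightarrow> complex"] by (simp add: w)
    have s1: "s r 1 = 1" if r: "r \<in> {1..k}" for r
    proof -
      have "{d::nat. d dvd 1} = {1}" by auto
      then have "int (num_reps 1 (Q 0)) + 2 * (\<Sum>i\<in>{1..k}. int (num_reps 1 (Q i))) = 2"
        using total[OF L, of 1] by (simp add: w)
      then have sum1: "num_reps 1 (Q 0) + 2 * (\<Sum>i\<in>{1..k}. num_reps 1 (Q i)) = 2"
        by (simp flip: of_nat_sum)
      have "Q 0 = principal_form (- int D)" using L by (simp add: lists_reduced_forms_def)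
      then have "coeff_a (Q 0) = 1" by (simp add: principal_form_def)
      then have "{(1, 0), (-1, 0)} \<subseteq> {(x, y). bqf_eval (Q 0) x y = int 1}" by (simp add: bqf_eval_def)
      from card_mono[OF finite_bqf_representations[OF Q(1,3)[of 0]] this]
      have "num_reps 1 (Q 0) \<ge> 2" by (simp add: num_reps_def)
      then have "num_reps 1 (Q 0) = 2" "(\<Sum>i\<in>{1..k}. num_reps 1 (Q i)) = 0" using sum1 by linarith+
      moreover from this(2) have "num_reps 1 (Q r) = 0" using r by simp
      ultimately show ?thesis by (simp add: s_def)
    qed
    have formula: "of_nat (num_reps n (Q 0)) =
               2 / (2 * of_nat k + 1) * of_int (\<Sum>d | d dvd n. kronecker (- int D) (int d))
               + 4 / (2 * of_nat k + 1) * (\<Sum>j\<in>{1..k}. t j n) \<and>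
             (\<forall>r\<in>{1..k}.
               num_reps n (Q r) = num_reps n (bqf_conj (Q r)) \<and>
               of_nat (num_reps n (Q r)) =
                 2 / (2 * of_nat k + 1) * of_int (\<Sum>d | d dvd n. kronecker (- int D) (int d))
                 + 4 / (2 * of_nat k + 1) * (\<Sum>j\<in>{1..k} - {r}. t j n)
                 - (4 * of_nat k - 2) / (2 * of_nat k + 1) * t r n)"
      if t: "\<forall>r\<in>{1..k}. \<forall>z\<in>upper_half_plane. (\<lambda>n. t r (Suc n) * nome z ^ Suc n) sums theta_diff (Q 0) (Q r) z"
        and n: "n > 0" for t n
    proof -
      have "t i n = (of_nat (num_reps n (Q 0)) - of_nat (num_reps n (Q i))) / 2" if "i \<in> {1..k}" for i
        using ts[OF t that n] by (simp add: s_def)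
      note alg = representation_formula_algebra[where N = "\<lambda>i. of_nat (num_reps n (Q i))" and t = "\<lambda>i. t i n", OF totalC[OF n] this]
      show ?thesis
        using alg num_reps_conj by (intro conjI ballI) auto
    qed
    show ?thesis
    proof (intro conjI)
      show "\<forall>r\<in>{1..k}. is_cusp_form 1 D (\<lambda>d. of_int (kronecker (- int D) d)) (theta_diff (Q 0) (Q r))"
        using cusp by blast
      show "\<exists>t :: nat \<Rightarrow> nat \<Rightarrow> complex. \<forall>r\<in>{1..k}. \<forall>z\<in>upper_half_plane.
           (\<lambda>n. t r (Suc n) * nome z ^ Suc n) sums theta_diff (Q 0) (Q r) z"
        using s by blast
      show "\<forall>t :: nat \<Rightarrow> nat \<Rightarrow> complex.
           (\<forall>r\<in>{1..k}. \<forall>z\<in>upper_half_plane.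
             (\<lambda>n. t r (Suc n) * nome z ^ Suc n) sums theta_diff (Q 0) (Q r) z) \<longrightarrow>
           (\<forall>r\<in>{1..k}. t r 1 = 1) \<and>
           (\<forall>n>0.
             of_nat (num_reps n (Q 0)) =
               2 / (2 * of_nat k + 1) * of_int (\<Sum>d | d dvd n. kronecker (- int D) (int d))
               + 4 / (2 * of_nat k + 1) * (\<Sum>j\<in>{1..k}. t j n) \<and>
             (\<forall>r\<in>{1..k}.
               num_reps n (Q r) = num_reps n (bqf_conj (Q r)) \<and>
               of_nat (num_reps n (Q r)) =
                 2 / (2 * of_nat k + 1) * of_int (\<Sum>d | d dvd n. kronecker (- int D) (int d))
                 + 4 / (2 * of_nat k + 1) * (\<Sum>j\<in>{1..k} - {r}. t j n)
                 - (4 * of_nat k - 2) / (2 * of_nat k + 1) * t r n))"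
      proof (intro allI impI, rule conjI)
        fix t :: "nat \<Rightarrow> nat \<Rightarrow> complex"
        assume t: "\<forall>r\<in>{1..k}. \<forall>z\<in>upper_half_plane.
             (\<lambda>n. t r (Suc n) * nome z ^ Suc n) sums theta_diff (Q 0) (Q r) z"
        show "\<forall>r\<in>{1..k}. t r 1 = 1"
        proof
          fix r assume r: "r \<in> {1..k}"
          show "t r 1 = 1" using ts[OF t r, of 1] s1[OF r] by simp
        qed
      qed (intro allI impI, rule formula)
    qed
  qed
  have part1: "\<forall>n>0. int (num_reps n (Q 0)) = w * (\<Sum>d | d dvd n. kronecker (- int D) (int d))"
    if "lists_reduced_forms (- int D) k Q" "k = 0" for Q
    using total[OF that(1)] that(2) by auto
  show ?thesis
    by (rule conjI[OF card conjI[OF ex]], intro allI impI, rule conjI; intro impI; (rule part1 part2; assumption))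
qed

end
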